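(* Let $X(t) = \mathbb U(F_0(t))$ and $Y(t) = \int_0^t X(s)\,ds$ for $t\ge 0$, where $\mathbb U$ is a standard Brownian bridge on $[0,1]$. Then almost surely there exists a uniquely defined random continuously differentiable function $H$ on $[0,1]$ satisfying the following conditions: (1) $H(t)\ge Y(t)$ for every $t\in[0,1]$; (2) $H$ has convex second derivative on $(0,1)$; (3) $H(0)=Y(0)$ and $H'(0)=X(0)$; (4) $H(1)=Y(1)$ and $H'(1)=X(1)$; (5) $\int_0^1 \big(H(t)-Y(t)\big)\,dH^{(3)}(t)=0$. The same claim holds if one instead considers a standard Brownian motion $\tilde X$ on $[0,1]$, sets $\tilde Y(t)=\int_0^t\tilde X(s)\,ds$, and replaces $(X,Y,H)$ by $(\tilde X,\tilde Y,\tilde H)$ throughout (where $\tilde H$ is different from $H$).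
   Context: Here $F_0$ is the distribution function of the triangular density $f_0(t)=2(1-t)\mathbf 1_{[0,1]}(t)$, i.e. $F_0(t)=2t-t^2$ for $t\in[0,1]$ and $F_0(t)=1$ for $t\ge1$. The derivative of a convex function is interpreted as either its left or its right derivative; in particular $H^{(3)}$ denotes such a derivative of the convex function $H^{(2)}$ and is nondecreasing, so the integral in (5) is a Lebesgue–Stieltjes integral over $(0,1)$. *)

theory Defs
  imports "HOL-Probability.Probability" "HOL-Real_Asymp.Real_Asymp"
begin

definition normal_law :: "real \<Rightarrow> real \<Rightarrow> real measure" where
  "normal_law m s =
     (if s = 0 then return borel m else density lborel (\<lambda>x. ennreal (normal_density m s x)))"

text \<open>Processes are indexed by all reals, but only the values on the index set \<open>T\<close>
  (below always \<open>[0,1]\<close>) are constrained.\<close>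

definition gaussian_process :: "'a measure \<Rightarrow> real set \<Rightarrow> (real \<Rightarrow> 'a \<Rightarrow> real) \<Rightarrow> bool" where
  "gaussian_process M T X \<longleftrightarrow>
     (\<forall>t\<in>T. X t \<in> borel_measurable M) \<and>
     (\<forall>S (c :: real \<Rightarrow> real). finite S \<and> S \<subseteq> T \<longrightarrow>
        (\<exists>m s. 0 \<le> s \<and> distr M borel (\<lambda>\<omega>. \<Sum>t\<in>S. c t * X t \<omega>) = normal_law m s))"

definition standard_brownian_bridge :: "'a measure \<Rightarrow> (real \<Rightarrow> 'a \<Rightarrow> real) \<Rightarrow> bool" where
  "standard_brownian_bridge M U \<longleftrightarrow>
     prob_space M \<and>
     gaussian_process M {0..1} U \<and>
     (\<forall>t\<in>{0..1}. (\<integral>\<omega>. U t \<omega> \<partial>M) = 0) \<and>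
     (\<forall>s\<in>{0..1}. \<forall>t\<in>{0..1}. (\<integral>\<omega>. U s \<omega> * U t \<omega> \<partial>M) = min s t - s * t) \<and>
     (AE \<omega> in M. continuous_on {0..1} (\<lambda>t. U t \<omega>))"

definition standard_brownian_motion :: "'a measure \<Rightarrow> (real \<Rightarrow> 'a \<Rightarrow> real) \<Rightarrow> bool" where
  "standard_brownian_motion M B \<longleftrightarrow>
     prob_space M \<and>
     (\<forall>t\<in>{0..1}. B t \<in> borel_measurable M) \<and>
     (AE \<omega> in M. B 0 \<omega> = 0) \<and>
     (\<forall>n. \<forall>t :: nat \<Rightarrow> real. mono_on {..n} t \<and> t ` {..n} \<subseteq> {0..1} \<longrightarrow>
        prob_space.indep_vars M (\<lambda>_. borel) (\<lambda>i \<omega>. B (t (Suc i)) \<omega> - B (t i) \<omega>) {..<n}) \<and>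
     (\<forall>s t. 0 \<le> s \<and> s < t \<and> t \<le> 1 \<longrightarrow>
        distr M borel (\<lambda>\<omega>. B t \<omega> - B s \<omega>) = normal_law 0 (sqrt (t - s))) \<and>
     (AE \<omega> in M. continuous_on {0..1} (\<lambda>t. B t \<omega>))"

definition triangular_density :: "real \<Rightarrow> real" where
  "triangular_density t = 2 * (1 - t) * indicator {0..1} t"

definition triangular_cdf :: "real \<Rightarrow> real" where
  "triangular_cdf = cdf (density lborel (\<lambda>t. ennreal (triangular_density t)))"

lemma triangular_cdf_eq:
  assumes "0 \<le> t"
  shows "triangular_cdf t = (if t \<le> 1 then 2 * t - t\<^sup>2 else 1)"
proof -
  let ?b = "min t 1"
  have "emeasure (density lborel (\<lambda>t. ennreal (triangular_density t))) {..t} =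
      (\<integral>\<^sup>+x. ennreal (triangular_density x) * indicator {..t} x \<partial>lborel)"
    by (rule emeasure_density) (auto simp: triangular_density_def)
  also have "\<dots> = (\<integral>\<^sup>+x. ennreal (2 * (1 - x)) * indicator {0..?b} x \<partial>lborel)"
    by (intro nn_integral_cong) (auto simp: triangular_density_def split: split_indicator)
  also have "\<dots> = ennreal ((2 * ?b - ?b\<^sup>2) - (2 * 0 - 0\<^sup>2))"
    using assms
    by (intro nn_integral_FTC_Icc) (auto intro!: derivative_eq_intros)
  finally have "triangular_cdf t = enn2real (ennreal (2 * ?b - ?b\<^sup>2))"
    by (simp add: triangular_cdf_def cdf_def measure_def)
  moreover have "0 \<le> 2 * ?b - ?b\<^sup>2"
  proof -
    have "0 \<le> ?b * (2 - ?b)" using assms by (intro mult_nonneg_nonneg) auto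
    then show ?thesis by (simp add: power2_eq_square algebra_simps)
  qed
  ultimately show ?thesis by (auto simp: min_def)
qed

text \<open>The Lebesgue--Stieltjes measure on the open interval \<open>(a,b)\<close> of a nondecreasing
  right-continuous function, which may be unbounded near \<open>a\<close> and \<open>b\<close>; for this reason
  \<open>interval_measure\<close>, which needs such a function on the whole line, does not apply.\<close>

definition stieltjes_measure :: "real \<Rightarrow> real \<Rightarrow> (real \<Rightarrow> real) \<Rightarrow> real measure" where
  "stieltjes_measure a b F =
     extend_measure {a<..<b} {(x, y). a < x \<and> x \<le> y \<and> y < b}
       (\<lambda>(x, y). {x<..y}) (\<lambda>(x, y). ennreal (F y - F x))"

lemma space_stieltjes_measure [simp]: "space (stieltjes_measure a b F) = {a<..<b}"
  unfolding stieltjes_measure_def by (subst space_extend_measure) auto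

lemma sets_stieltjes_measure_subset: "sets (stieltjes_measure a b F) \<subseteq> sets borel"
proof -
  have "sets (stieltjes_measure a b F) =
      sigma_sets {a<..<b} ((\<lambda>(x, y). {x<..y}) ` {(x, y). a < x \<and> x \<le> y \<and> y < b})"
    unfolding stieltjes_measure_def by (subst sets_extend_measure) auto
  also have "\<dots> \<subseteq> sets borel"
  proof
    fix A assume "A \<in> sigma_sets {a<..<b} ((\<lambda>(x, y). {x<..y}) ` {(x, y). a < x \<and> x \<le> y \<and> y < b})"
    then show "A \<in> sets borel"
      by induction auto
  qed
  finally show ?thesis .
qed

lemma emeasure_stieltjes_measure_Ioc:
  assumes mono: "\<And>x y. a < x \<Longrightarrow> x \<le> y \<Longrightarrow> y < b \<Longrightarrow> F x \<le> F y"
    and right_cont: "\<And>x. a < x \<Longrightarrow> x < b \<Longrightarrow> continuous (at_right x) F"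
    and xy: "a < x" "x \<le> y" "y < b"
  shows "emeasure (stieltjes_measure a b F) {x<..y} = ennreal (F y - F x)"
proof -
  have ab: "a < b" using xy by simp
  define d where "d = (\<lambda>n. (b - a) / real (n + 2))"
  define p q where "p = (\<lambda>n. a + d n)" and "q = (\<lambda>n. b - d n)"
  have d_pos: "0 < d n" for n
    using ab by (simp add: d_def)
  have half: "d n \<le> (b - a) / 2" for n
    unfolding d_def using ab by (intro divide_left_mono) auto
  have step: "d (Suc n) \<le> d n" for n
    unfolding d_def using ab by (intro divide_left_mono) auto
  have p: "a < p n" and q: "q n < b" for n
    using d_pos[of n] by (auto simp: p_def q_def)
  have pq: "p n \<le> q n" for n
  proof -
    have "2 * d n \<le> b - a" using half[of n] by (simp add: field_simps)
    then show ?thesis by (simp add: p_def q_def)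
  qed
  have p_Suc: "p (Suc n) \<le> p n" and q_Suc: "q n \<le> q (Suc n)" for n
    using step[of n] by (simp_all add: p_def q_def)
  have p_lim: "p \<longlonglongrightarrow> a" and q_lim: "q \<longlonglongrightarrow> b"
    unfolding p_def q_def d_def by real_asymp+
  define c where "c = (\<lambda>n x. max (p n) (min (q n) x))"
  have c: "a < c n x" "c n x < b" for n x
    using p[of n] q[of n] pq[of n] by (auto simp: c_def)
  have c_mono: "c n x \<le> c n y" if "x \<le> y" for n x y
    using that by (auto simp: c_def)
  define D where "D = (\<lambda>n x. F (c (Suc n) x) - F (c n x))"
  have D_mono: "D n x \<le> D n y" if xy: "x \<le> y" for n x y
  proof (cases "c n x = c n y")
    case True
    then show ?thesis
      using mono[OF c(1)[of "Suc n" x] c_mono[OF xy, of "Suc n"] c(2)[of "Suc n" y]]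
      by (simp add: D_def)
  next
    case False
    then have "c n y \<le> c (Suc n) y" "c (Suc n) x \<le> c n x"
      using xy p_Suc[of n] q_Suc[of n] pq[of n] by (auto simp: c_def max_def min_def split: if_splits)
    then have "F (c n y) \<le> F (c (Suc n) y)" "F (c (Suc n) x) \<le> F (c n x)"
      by (auto intro!: mono c)
    then show ?thesis by (simp add: D_def)
  qed
  have Fc_cont: "continuous (at_right x) (\<lambda>x. F (c n x))" for n x
  proof (cases "p n \<le> x \<and> x < q n")
    case True
    then have "continuous (at_right x) F"
      using p[of n] q[of n] by (intro right_cont) auto
    then have "(F \<longlongrightarrow> F x) (at_right x)"
      by (simp add: continuous_within)
    moreover have "eventually (\<lambda>y. F y = F (c n y)) (at_right x)"
      using True by (auto simp: eventually_at_right[of x "q n"] c_def intro!: exI[of _ "q n"])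
    ultimately have "((\<lambda>y. F (c n y)) \<longlongrightarrow> F x) (at_right x)"
      by (rule Lim_transform_eventually)
    then show ?thesis using True by (simp add: continuous_within c_def)
  next
    case False
    then have "eventually (\<lambda>y. F (c n x) = F (c n y)) (at_right x)"
    proof (cases "x < p n")
      case True
      then show ?thesis
        using pq[of n] by (auto simp: eventually_at_right[of x "p n"] c_def intro!: exI[of _ "p n"])
    next
      case False
      with \<open>\<not> (p n \<le> x \<and> x < q n)\<close> have "q n \<le> x" by auto
      then show ?thesis
        by (auto simp: eventually_at_right[of x "x + 1"] c_def intro!: exI[of _ "x + 1"])
    qed
    then have "((\<lambda>y. F (c n y)) \<longlongrightarrow> F (c n x)) (at_right x)"
      by (rule Lim_transform_eventually[OF tendsto_const])
    then show ?thesis by (simp add: continuous_within)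
  qed
  have D_cont: "continuous (at_right x) (D n)" for n x
    unfolding D_def by (intro continuous_diff Fc_cont)
  define \<mu> where "\<mu> = (\<lambda>A. \<Sum>n. emeasure (interval_measure (D n)) A)"
  show ?thesis
  proof (rule emeasure_extend_measure_Pair[OF stieltjes_measure_def])
    show "a < x \<and> x \<le> y \<and> y < b" using xy by simp
  next
    fix x y assume "a < x \<and> x \<le> y \<and> y < b"
    then have xy: "a < x" "x \<le> y" "y < b" by auto
    have "eventually (\<lambda>n. p n < x) sequentially" "eventually (\<lambda>n. y < q n) sequentially"
      using xy order_tendstoD(2)[OF p_lim] order_tendstoD(1)[OF q_lim] by auto
    then have "eventually (\<lambda>n. c n x = x \<and> c n y = y) sequentially"
      by eventually_elim (use xy in \<open>auto simp: c_def\<close>)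
    moreover have "(\<Sum>n<N. D n y - D n x) = F (c N y) - F (c N x)" for N
    proof (induction N)
      case 0
      have "p 0 = q 0" by (simp add: p_def q_def d_def field_simps)
      then show ?case by (simp add: c_def)
    next
      case (Suc N)
      then show ?case by (simp add: D_def)
    qed
    ultimately have "eventually (\<lambda>N. F y - F x = (\<Sum>n<N. D n y - D n x)) sequentially"
      by (auto elim: eventually_mono)
    then have "(\<lambda>n. D n y - D n x) sums (F y - F x)"
      unfolding sums_def by (rule Lim_transform_eventually[OF tendsto_const])
    then have "(\<Sum>n. ennreal (D n y - D n x)) = ennreal (F y - F x)"
      using D_mono[OF xy(2)] by (subst suminf_ennreal_eq) auto
    then show "\<mu> {x<..y} = ennreal (F y - F x)"
      using xy by (simp add: \<mu>_def emeasure_interval_measure_Ioc D_mono D_cont)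
  next
    show "{x<..y} \<in> Pow {a<..<b}" if "a < x \<and> x \<le> y \<and> y < b" for x y
      using that by auto
    show "positive (sets (stieltjes_measure a b F)) \<mu>"
      by (simp add: positive_def \<mu>_def)
    show "countably_additive (sets (stieltjes_measure a b F)) \<mu>"
      unfolding countably_additive_def
    proof (intro allI impI)
      fix A :: "nat \<Rightarrow> real set"
      assume A: "range A \<subseteq> sets (stieltjes_measure a b F)" "disjoint_family A"
      then have "range A \<subseteq> sets borel" using sets_stieltjes_measure_subset by blast
      then have *: "(\<Sum>i. emeasure (interval_measure (D n)) (A i)) =
          emeasure (interval_measure (D n)) (\<Union>i. A i)" for n
        by (intro suminf_emeasure) (use A in auto)
      have "(\<Sum>i. \<mu> (A i)) = (\<integral>\<^sup>+i. (\<Sum>n. emeasure (interval_measure (D n)) (A i)) \<partial>count_space UNIV)"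
        by (simp add: \<mu>_def nn_integral_count_space_nat)
      also have "\<dots> = (\<Sum>n. \<integral>\<^sup>+i. emeasure (interval_measure (D n)) (A i) \<partial>count_space UNIV)"
        by (rule nn_integral_suminf) auto
      also have "\<dots> = \<mu> (\<Union>i. A i)"
        by (simp add: \<mu>_def nn_integral_count_space_nat *)
      finally show "(\<Sum>i. \<mu> (A i)) = \<mu> (\<Union>i. A i)" .
    qed
  qed
qed

text \<open>For convex \<open>f\<close> this is nondecreasing and right-continuous on the interior of the domain.
  The left derivative is the left-continuous version of the same function and therefore has the
  same Lebesgue--Stieltjes measure.\<close>

definition right_deriv :: "(real \<Rightarrow> real) \<Rightarrow> real \<Rightarrow> real" where
  "right_deriv f x = vector_derivative f (at_right x)"

text \<open>\<open>H1\<close> and \<open>H2\<close> are the first and second derivatives of \<open>H\<close>, one-sided at 0 and 1 in the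
  case of \<open>H1\<close>. The integral of a non-integrable function is 0 by convention, so integrability is
  demanded separately.\<close>

definition invelope :: "(real \<Rightarrow> real) \<Rightarrow> (real \<Rightarrow> real) \<Rightarrow> (real \<Rightarrow> real) \<Rightarrow> bool" where
  "invelope X Y H \<longleftrightarrow> (\<exists>H1 H2.
     (\<forall>t\<in>{0..1}. (H has_real_derivative H1 t) (at t within {0..1})) \<and>
     continuous_on {0..1} H1 \<and>
     (\<forall>t\<in>{0..1}. H t \<ge> Y t) \<and>
     (\<forall>t\<in>{0<..<1}. (H1 has_real_derivative H2 t) (at t)) \<and>
     convex_on {0<..<1} H2 \<and>
     H 0 = Y 0 \<and> H1 0 = X 0 \<and>
     H 1 = Y 1 \<and> H1 1 = X 1 \<and>
     integrable (stieltjes_measure 0 1 (right_deriv H2)) (\<lambda>t. H t - Y t) \<and>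
     (\<integral>t. (H t - Y t) \<partial>stieltjes_measure 0 1 (right_deriv H2)) = 0)"

text \<open>Functions on \<open>[0,1]\<close> are represented by functions on all reals, hence uniqueness is
  equality on \<open>[0,1]\<close>.\<close>

definition ae_unique_random_invelope ::
  "'a measure \<Rightarrow> (real \<Rightarrow> 'a \<Rightarrow> real) \<Rightarrow> (real \<Rightarrow> 'a \<Rightarrow> real) \<Rightarrow> bool" where
  "ae_unique_random_invelope M X Y \<longleftrightarrow>
     (\<exists>H :: real \<Rightarrow> 'a \<Rightarrow> real.
        (\<forall>t\<in>{0..1}. H t \<in> borel_measurable M) \<and>
        (AE \<omega> in M.
           invelope (\<lambda>t. X t \<omega>) (\<lambda>t. Y t \<omega>) (\<lambda>t. H t \<omega>) \<and>
           (\<forall>G. invelope (\<lambda>t. X t \<omega>) (\<lambda>t. Y t \<omega>) G \<longrightarrow> (\<forall>t\<in>{0..1}. G t = H t \<omega>))))"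

end

theory Submission
  imports Defs
begin

text \<open>
  The statement is deterministic at heart: every continuous path \<open>X\<close> on the unit interval, with
  primitive \<open>Y\<close>, has exactly one invelope, and the invelope depends continuously on the path in the
  supremum norm. Both processes have almost surely continuous paths, so the random statement follows once
  the invelope is seen to be measurable; it is the limit of the invelopes of the Bernstein polynomials of
  the path, and these are continuous functions of finitely many values of the path.

  An invelope solves the obstacle problem of a clamped beam: its fourth derivative is a nonnegative measure
  carried by the contact set of \<open>H\<close> and \<open>Y\<close>. For rough paths such as Brownian motion the second derivative
  need not be square integrable near the end points, so the usual energy may be infinite. Uniqueness and
  existence rest on a weighted energy instead. If \<open>D\<close> is the difference of two invelopes,
  \<open>\<phi> t = t * (1 - t)\<close> and \<open>\<mu>\<close> is the difference of the two fourth derivatives, then integration by parts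
  gives that the integral of \<open>\<phi> * D\<close> with respect to \<open>\<mu>\<close> equals the integral of \<open>\<phi> * D2\<^sup>2 + 4 * D1\<^sup>2\<close>, up to
  boundary terms. These vanish: \<open>D\<close> and \<open>D1\<close> are 0 at both end points, and a convex second derivative
  of a function that is continuously differentiable up to the end points grows slowly enough there.
  For two invelopes of the same path the left-hand side is nonpositive, since \<open>D \<le> 0\<close> on one contact set
  and \<open>D \<ge> 0\<close> on the other; for different paths its positive part is small with their distance
  (\<open>energy_estimate\<close>, \<open>contact_invelope_stability\<close>).

  For existence, subtracting a cubic polynomial reduces to paths that vanish together with their primitive
  at both end points. If \<open>X\<close> has a continuous derivative, the second derivative of the invelope is the
  projection in mean square of that derivative onto the cone of convex functions
  (\<open>contact_invelope_exists_smooth\<close>). A continuous path is a uniform limit of polynomials, whose invelopes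
  converge by the stability estimate. The delicate point is that the limit is continuously differentiable up
  to the end points with the right slopes; there the first derivatives are small uniformly along the sequence,
  because they equal the path at points of contact and are controlled by convexity between such points
  (\<open>derivatives_uniformly_small\<close>).

  Throughout, the complementarity condition is used in a local form: the second derivative is affine
  on intervals without contact. The Stieltjes integral enters only through \<open>stieltjes_integral_zero_iff\<close>.
\<close>

section \<open>Subgradients of convex functions on the open unit interval\<close>

definition subgradient_selection :: "(real \<Rightarrow> real) \<Rightarrow> (real \<Rightarrow> real) \<Rightarrow> bool" where
  "subgradient_selection h k \<longleftrightarrow>
     (\<forall>x\<in>{0<..<1}. \<forall>t\<in>{0<..<1}. h x + k x * (t - x) \<le> h t)"

lemma subgradient_selectionD:
  assumes "subgradient_selection h k" "0 < x" "x < 1" "0 < t" "t < 1"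
  shows "h x + k x * (t - x) \<le> h t"
  using assms by (auto simp: subgradient_selection_def)

lemma subgradient_selection_mono:
  assumes "subgradient_selection h k" "0 < x" "x \<le> y" "y < 1"
  shows "k x \<le> k y"
proof (cases "x = y")
  case False
  have "h x + k x * (y - x) \<le> h y" "h y + k y * (x - y) \<le> h x"
    using assms by (auto intro!: subgradient_selectionD)
  then have "k x * (y - x) \<le> k y * (y - x)" by (simp add: algebra_simps)
  then show ?thesis using False assms by simp
qed simp

lemma subgradient_selection_imp_convex:
  assumes "subgradient_selection h k"
  shows "convex_on {0<..<1} h"
proof (rule convex_onI)
  fix t x y :: real assume t: "0 < t" "t < 1" and xy: "x \<in> {0<..<1}" "y \<in> {0<..<1}"
  define c where "c = (1 - t) * x + t * y"
  have c: "c \<in> {0<..<1}"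
    using convexD_alt[of "{0<..<1::real}" x y t] t xy by (simp add: c_def)
  have "(1 - t) * (h c + k c * (x - c)) + t * (h c + k c * (y - c)) \<le> (1 - t) * h x + t * h y"
    using assms c t xy by (intro add_mono mult_left_mono subgradient_selectionD) auto
  moreover have "(1 - t) * (h c + k c * (x - c)) + t * (h c + k c * (y - c)) = h c"
    by (simp add: c_def algebra_simps)
  ultimately show "h ((1 - t) *\<^sub>R x + t *\<^sub>R y) \<le> (1 - t) * h x + t * h y"
    by (simp add: c_def)
qed simp

lemma subgradient_selection_diff_affine:
  assumes "subgradient_selection h k"
  shows "subgradient_selection (\<lambda>t. h t - (a + b * t)) (\<lambda>t. k t - b)"
  using assms unfolding subgradient_selection_def by (simp add: algebra_simps)

lemma subgradient_selection_reflect: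
  assumes "subgradient_selection h k"
  shows "subgradient_selection (\<lambda>t. h (1 - t)) (\<lambda>t. - k (1 - t))"
  unfolding subgradient_selection_def
proof (intro ballI)
  fix x t :: real assume "x \<in> {0<..<1}" "t \<in> {0<..<1}"
  then have "h (1 - x) + k (1 - x) * ((1 - t) - (1 - x)) \<le> h (1 - t)"
    using assms by (intro subgradient_selectionD) auto
  then show "h (1 - x) + - k (1 - x) * (t - x) \<le> h (1 - t)" by (simp add: algebra_simps)
qed

lemma convex_on_unit_continuous:
  fixes h :: "real \<Rightarrow> real"
  assumes "convex_on {0<..<1} h"
  shows "continuous_on {0<..<1} h"
  using assms by (intro convex_on_continuous) auto

lemma has_right_derivative_convex:
  assumes h: "convex_on {0<..<1} h" and x: "0 < x" "x < 1"
  shows "((\<lambda>t. (h t - h x) / (t - x)) \<longlongrightarrow> right_deriv h x) (at_right x)"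
    and "\<And>t. 0 < t \<Longrightarrow> t < 1 \<Longrightarrow> h x + right_deriv h x * (t - x) \<le> h t"
proof -
  define s where "s t = (h x - h t) / (x - t)" for t
  define K where "K = Inf (s ` ({x<..} \<inter> {0<..<1}))"
  have sub: "h x + K * (t - x) \<le> h t" if "0 < t" "t < 1" for t
    using convex_le_Inf_differential[OF h, of x t] x that by (simp add: K_def s_def[abs_def])
  have lower: "K \<le> s t" if "x < t" "t < 1" for t
    using sub[of t] that x by (simp add: s_def field_simps)
  have "(s \<longlongrightarrow> K) (at_right x)"
  proof (rule order_tendstoI)
    fix a assume "a < K"
    then show "eventually (\<lambda>t. a < s t) (at_right x)"
      using lower x by (auto simp: eventually_at_right[of x 1] intro!: exI[of _ 1] less_le_trans[OF _ lower])
  next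
    fix a assume a: "K < a"
    have "(x + 1) / 2 \<in> {x<..} \<inter> {0<..<1}" using x by auto
    then have "s ` ({x<..} \<inter> {0<..<1}) \<noteq> {}" by blast
    moreover have "bdd_below (s ` ({x<..} \<inter> {0<..<1}))"
      using lower by (auto intro!: bdd_belowI[of _ K])
    ultimately obtain t where t: "x < t" "t < 1" "s t < a"
      using a x by (auto simp: K_def cInf_less_iff)
    have "s r < a" if "x < r" "r < t" for r
      using convex_on_slope_le(1)[OF h, of x t r] that t x by (simp add: s_def)
    then show "eventually (\<lambda>t. s t < a) (at_right x)"
      using t by (auto simp: eventually_at_right[of x t] intro!: exI[of _ t])
  qed
  moreover have "s = (\<lambda>t. (h t - h x) / (t - x))"
  proof
    show "s t = (h t - h x) / (t - x)" for t
      using minus_divide_divide[of "h x - h t" "x - t"] by (simp add: s_def)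
  qed
  ultimately have lim: "((\<lambda>t. (h t - h x) / (t - x)) \<longlongrightarrow> K) (at_right x)" by simp
  then have "(h has_real_derivative K) (at_right x)"
    by (simp add: has_field_derivative_iff)
  then have "right_deriv h x = K"
    unfolding right_deriv_def
    by (intro vector_derivative_within) (auto simp: has_real_derivative_iff_has_vector_derivative)
  then show "((\<lambda>t. (h t - h x) / (t - x)) \<longlongrightarrow> right_deriv h x) (at_right x)"
    "\<And>t. 0 < t \<Longrightarrow> t < 1 \<Longrightarrow> h x + right_deriv h x * (t - x) \<le> h t"
    using lim sub by simp_all
qed

lemma subgradient_selection_right_deriv:
  assumes "convex_on {0<..<1} h"
  shows "subgradient_selection h (right_deriv h)"
  using has_right_derivative_convex(2)[OF assms] by (auto simp: subgradient_selection_def)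

text \<open>For \<open>x < y < t\<close> the slope of the chord over \<open>[y,t]\<close> bounds the right derivative at \<open>y\<close>
  and tends to the slope over \<open>[x,t]\<close> as \<open>y\<close> decreases to \<open>x\<close>; the latter is close to the
  right derivative at \<open>x\<close> for \<open>t\<close> close to \<open>x\<close>.\<close>

lemma right_deriv_right_continuous:
  assumes h: "convex_on {0<..<1} h" and x: "0 < x" "x < 1"
  shows "continuous (at_right x) (right_deriv h)"
  unfolding continuous_within
proof (rule order_tendstoI)
  fix a assume "a < right_deriv h x"
  then have "a < right_deriv h y" if "x < y" "y < 1" for y
    using subgradient_selection_mono[OF subgradient_selection_right_deriv[OF h], of x y] x that
    by linarith
  then show "eventually (\<lambda>y. a < right_deriv h y) (at_right x)"
    using x by (auto simp: eventually_at_right[of x 1] intro!: exI[of _ 1])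
next
  fix a assume "right_deriv h x < a"
  then have "eventually (\<lambda>t. (h t - h x) / (t - x) < a) (at_right x)"
    using has_right_derivative_convex(1)[OF h x] order_tendstoD(2) by blast
  moreover have "eventually (\<lambda>t. x < t \<and> t < 1) (at_right x)"
    using x by (auto simp: eventually_at_right[of x 1] intro!: exI[of _ 1])
  ultimately have "eventually (\<lambda>t. (h t - h x) / (t - x) < a \<and> x < t \<and> t < 1) (at_right x)"
    by eventually_elim auto
  then obtain t where t: "(h t - h x) / (t - x) < a" "x < t" "t < 1"
    by (metis (mono_tags, lifting) eventually_happens trivial_limit_at_right_real)
  have "isCont h x"
    using convex_on_unit_continuous[OF h] x by (simp add: continuous_on_eq_continuous_at)
  then have "(h \<longlongrightarrow> h x) (at_right x)"
    unfolding isCont_def by (rule tendsto_within_subset) simp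
  then have "((\<lambda>y. (h t - h y) / (t - y)) \<longlongrightarrow> (h t - h x) / (t - x)) (at_right x)"
    using t by (intro tendsto_intros) auto
  then have "eventually (\<lambda>y. (h t - h y) / (t - y) < a) (at_right x)"
    using t(1) order_tendstoD(2) by blast
  moreover have "eventually (\<lambda>y. x < y \<and> y < t) (at_right x)"
    using t by (auto simp: eventually_at_right[of x t] intro!: exI[of _ t])
  ultimately show "eventually (\<lambda>y. right_deriv h y < a) (at_right x)"
  proof eventually_elim
    case (elim y)
    have "h y + right_deriv h y * (t - y) \<le> h t"
      using has_right_derivative_convex(2)[OF h, of y t] elim x t by auto
    then have "right_deriv h y \<le> (h t - h y) / (t - y)"
      using elim by (simp add: field_simps)
    then show ?case using elim by simp
  qed
qed

lemma subgradient_selection_const_imp_affine: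
  assumes "subgradient_selection h k" "0 < x" "x \<le> y" "y < 1" "k x = k y" "t \<in> {x..y}"
  shows "h t = h x + k x * (t - x)"
proof -
  have "k x \<le> k t" "k t \<le> k y"
    using assms(2-6) subgradient_selection_mono[OF assms(1), of x t]
      subgradient_selection_mono[OF assms(1), of t y] by auto
  then have "k t = k x" using assms by simp
  moreover have "h x + k x * (t - x) \<le> h t" "h t + k t * (x - t) \<le> h x"
    using assms(2-6) by (intro subgradient_selectionD[OF assms(1)]; simp)+
  ultimately show ?thesis by (simp add: algebra_simps)
qed

lemma subgradient_of_affine:
  assumes k: "subgradient_selection h k" and xy: "0 < x" "y < 1"
    and aff: "\<And>t. t \<in> {x..y} \<Longrightarrow> h t = a + b * t" and t: "x < t" "t < y"
  shows "k t = b"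
proof -
  have "h t + k t * (y - t) \<le> h y" "h t + k t * (x - t) \<le> h x"
    using xy t by (intro subgradient_selectionD[OF k]; simp)+
  then have "(k t - b) * (y - t) \<le> 0" "(k t - b) * (x - t) \<le> 0"
    using t aff[of t] aff[of x] aff[of y] by (auto simp: algebra_simps)
  then show ?thesis using t by (auto simp: mult_le_0_iff)
qed

section \<open>Integration against the third derivative\<close>

definition C2_on_unit :: "(real \<Rightarrow> real) \<Rightarrow> (real \<Rightarrow> real) \<Rightarrow> (real \<Rightarrow> real) \<Rightarrow> bool" where
  "C2_on_unit u u1 u2 \<longleftrightarrow>
     (\<forall>t\<in>{0<..<1}. (u has_real_derivative u1 t) (at t)) \<and>
     (\<forall>t\<in>{0<..<1}. (u1 has_real_derivative u2 t) (at t)) \<and>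
     continuous_on {0<..<1} u2"

text \<open>For a convex function \<open>h\<close> with subgradients \<open>k\<close> this is the Stieltjes integral of \<open>u\<close>
  with respect to \<open>k\<close> over \<open>[a,b]\<close>, integrated by parts twice. Only the continuous function
  \<open>h\<close> is integrated, so the values of \<open>k\<close> at its jumps do not matter inside the interval.\<close>

definition integral_dk ::
  "(real \<Rightarrow> real) \<Rightarrow> (real \<Rightarrow> real) \<Rightarrow> (real \<Rightarrow> real) \<Rightarrow> (real \<Rightarrow> real) \<Rightarrow> (real \<Rightarrow> real) \<Rightarrow>
   real \<Rightarrow> real \<Rightarrow> real" where
  "integral_dk h k u u1 u2 a b =
     (u b * k b - u1 b * h b) - (u a * k a - u1 a * h a) + integral {a..b} (\<lambda>t. u2 t * h t)"

lemma C2_on_unitD: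
  assumes "C2_on_unit u u1 u2"
  shows "\<And>t. 0 < t \<Longrightarrow> t < 1 \<Longrightarrow> (u has_real_derivative u1 t) (at t)"
    and "\<And>t. 0 < t \<Longrightarrow> t < 1 \<Longrightarrow> (u1 has_real_derivative u2 t) (at t)"
    and "continuous_on {0<..<1} u" "continuous_on {0<..<1} u1" "continuous_on {0<..<1} u2"
proof -
  show *: "\<And>t. 0 < t \<Longrightarrow> t < 1 \<Longrightarrow> (u has_real_derivative u1 t) (at t)"
    "\<And>t. 0 < t \<Longrightarrow> t < 1 \<Longrightarrow> (u1 has_real_derivative u2 t) (at t)"
    "continuous_on {0<..<1} u2"
    using assms by (auto simp: C2_on_unit_def)
  show "continuous_on {0<..<1} u" "continuous_on {0<..<1} u1"
    by (rule DERIV_continuous_on; rule has_field_derivative_at_within, rule *; simp)+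
qed

lemma C2_on_unit_diff:
  assumes "C2_on_unit u u1 u2" "C2_on_unit v v1 v2"
  shows "C2_on_unit (\<lambda>t. u t - v t) (\<lambda>t. u1 t - v1 t) (\<lambda>t. u2 t - v2 t)"
  using assms unfolding C2_on_unit_def by (blast intro: DERIV_diff continuous_on_diff)

lemma C2_on_unit_cmult:
  assumes "C2_on_unit u u1 u2"
  shows "C2_on_unit (\<lambda>t. c * u t) (\<lambda>t. c * u1 t) (\<lambda>t. c * u2 t)"
  using assms unfolding C2_on_unit_def
  by (blast intro: DERIV_cmult continuous_on_mult_left)

lemma integrable_continuous_unit:
  fixes f :: "real \<Rightarrow> real"
  assumes "continuous_on {0<..<1} f" "0 < a" "b < 1"
  shows "f integrable_on {a..b}"
  using assms by (intro integrable_continuous_real continuous_on_subset[OF assms(1)]) auto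

lemma integral_dk_combine:
  assumes "C2_on_unit u u1 u2" "continuous_on {0<..<1} h" "0 < a" "a \<le> b" "b \<le> c" "c < 1"
  shows "integral_dk h k u u1 u2 a c = integral_dk h k u u1 u2 a b + integral_dk h k u u1 u2 b c"
proof -
  have "continuous_on {0<..<1} (\<lambda>t. u2 t * h t)"
    using assms C2_on_unitD[OF assms(1)] by (intro continuous_intros)
  then have "(\<lambda>t. u2 t * h t) integrable_on {a..c}"
    using assms by (intro integrable_continuous_unit)
  then have "integral {a..c} (\<lambda>t. u2 t * h t) =
      integral {a..b} (\<lambda>t. u2 t * h t) + integral {b..c} (\<lambda>t. u2 t * h t)"
    using assms by (simp add: Henstock_Kurzweil_Integration.integral_combine)
  then show ?thesis by (simp add: integral_dk_def)
qed

lemma integral_dk_diff: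
  assumes "C2_on_unit u u1 u2" "C2_on_unit v v1 v2" "continuous_on {0<..<1} h" "0 < a" "b < 1"
  shows "integral_dk h k (\<lambda>t. u t - v t) (\<lambda>t. u1 t - v1 t) (\<lambda>t. u2 t - v2 t) a b =
    integral_dk h k u u1 u2 a b - integral_dk h k v v1 v2 a b"
proof -
  have "integral {a..b} (\<lambda>t. u2 t * h t - v2 t * h t) =
      integral {a..b} (\<lambda>t. u2 t * h t) - integral {a..b} (\<lambda>t. v2 t * h t)"
    using assms C2_on_unitD[OF assms(1)] C2_on_unitD[OF assms(2)]
    by (intro integral_diff integrable_continuous_unit continuous_intros)
  then show ?thesis by (simp add: integral_dk_def algebra_simps)
qed

lemma integral_dk_cmult:
  "integral_dk h k (\<lambda>t. c * u t) (\<lambda>t. c * u1 t) (\<lambda>t. c * u2 t) a b = c * integral_dk h k u u1 u2 a b"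
  unfolding integral_dk_def mult.assoc integral_mult_right by (simp add: algebra_simps)

text \<open>On a short interval the convex function differs from its tangent at the left end by at most
  the increment of the subgradient times the length. For the tangent itself the two integrations
  by parts are exact.\<close>

lemma integral_dk_local:
  assumes k: "subgradient_selection h k" and u: "C2_on_unit u u1 u2"
    and xy: "0 < x" "x \<le> y" "y < 1"
    and A: "\<And>t. t \<in> {x..y} \<Longrightarrow> \<bar>u1 t\<bar> \<le> A" "\<And>t. t \<in> {x..y} \<Longrightarrow> \<bar>u2 t\<bar> \<le> A"
  shows "\<bar>integral_dk h k u u1 u2 x y - u y * (k y - k x)\<bar> \<le> (k y - k x) * (A * ((y - x) + (y - x)\<^sup>2))"
proof -
  define L where "L t = h x + k x * (t - x)" for t
  define r where "r t = h t - L t" for t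
  define c where "c = k y - k x"
  have c: "0 \<le> c" using subgradient_selection_mono[OF k xy] by (simp add: c_def)
  have hc: "continuous_on {0<..<1} h"
    using subgradient_selection_imp_convex[OF k] by (rule convex_on_unit_continuous)
  have rc: "continuous_on {0<..<1} r" "continuous_on {0<..<1} L"
    unfolding r_def L_def by (intro continuous_intros hc)+
  have r: "0 \<le> r t" "r t \<le> c * (y - x)" if t: "t \<in> {x..y}" for t
  proof -
    show "0 \<le> r t" using subgradient_selectionD[OF k, of x t] t xy by (simp add: r_def L_def)
    have "h t + k t * (x - t) \<le> h x" using subgradient_selectionD[OF k, of t x] t xy by simp
    then have "r t \<le> (k t - k x) * (t - x)" by (simp add: r_def L_def algebra_simps)
    also have "\<dots> \<le> c * (y - x)"
      using t xy c subgradient_selection_mono[OF k, of t y] subgradient_selection_mono[OF k, of x t]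
      by (intro mult_mono) (auto simp: c_def)
    finally show "r t \<le> c * (y - x)" .
  qed
  have "((\<lambda>t. u2 t * L t) has_integral
      ((u1 y * L y - k x * u y) - (u1 x * L x - k x * u x))) {x..y}"
  proof (rule fundamental_theorem_of_calculus[OF xy(2)])
    fix t assume "t \<in> {x..y}"
    then have t: "0 < t" "t < 1" using xy by auto
    have "((\<lambda>t. u1 t * L t - k x * u t) has_real_derivative (u2 t * L t)) (at t)"
      unfolding L_def using t
      by (auto intro!: derivative_eq_intros C2_on_unitD(1)[OF u] C2_on_unitD(2)[OF u])
    then show "((\<lambda>t. u1 t * L t - k x * u t) has_vector_derivative u2 t * L t) (at t within {x..y})"
      by (simp add: has_real_derivative_iff_has_vector_derivative has_vector_derivative_at_within)
  qed
  then have "integral {x..y} (\<lambda>t. u2 t * L t) = (u1 y * L y - k x * u y) - (u1 x * L x - k x * u x)"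
    by (rule integral_unique)
  moreover have "integral {x..y} (\<lambda>t. u2 t * h t) =
      integral {x..y} (\<lambda>t. u2 t * L t) + integral {x..y} (\<lambda>t. u2 t * r t)"
    unfolding r_def right_diff_distrib using xy rc hc C2_on_unitD(5)[OF u]
    by (subst integral_diff) (auto intro!: integrable_continuous_unit continuous_intros)
  ultimately have "integral_dk h k u u1 u2 x y - u y * c = integral {x..y} (\<lambda>t. u2 t * r t) - u1 y * r y"
    by (simp add: integral_dk_def r_def L_def c_def algebra_simps)
  moreover have "\<bar>u1 y * r y\<bar> \<le> A * (c * (y - x))"
    using A(1)[of y] r[of y] xy c by (simp add: abs_mult mult_mono)
  moreover have "\<bar>integral {x..y} (\<lambda>t. u2 t * r t)\<bar> \<le> A * (c * (y - x)) * (y - x)"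
  proof -
    have "norm (integral {x..y} (\<lambda>t. u2 t * r t)) \<le> A * (c * (y - x)) * (y - x)"
    proof (rule integral_bound[OF xy(2)])
      show "continuous_on {x..y} (\<lambda>t. u2 t * r t)"
        using xy by (intro continuous_intros continuous_on_subset[OF rc(1)]
          continuous_on_subset[OF C2_on_unitD(5)[OF u]]) auto
      show "norm (u2 t * r t) \<le> A * (c * (y - x))" if "t \<in> {x..y}" for t
        using A(2)[OF that] r[OF that] by (simp add: abs_mult mult_mono)
    qed
    then show ?thesis by simp
  qed
  ultimately have "\<bar>integral_dk h k u u1 u2 x y - u y * c\<bar> \<le> A * (c * (y - x)) + A * (c * (y - x)) * (y - x)"
    by linarith
  then show ?thesis by (simp add: c_def power2_eq_square algebra_simps)
qed

text \<open>The Stieltjes measure of \<open>k\<close> lives on \<open>Z\<close> if \<open>k\<close> does not grow over intervals that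
  miss \<open>Z\<close>; hence only the sign of \<open>u\<close> on \<open>Z\<close> matters. Subintervals that are short enough
  contribute at most \<open>\<epsilon>\<close> times the increment of \<open>k\<close>, and the increments telescope.\<close>

lemma integral_dk_nonpos:
  assumes k: "subgradient_selection h k" and u: "C2_on_unit u u1 u2"
    and ab: "0 < a" "a \<le> b" "b < 1"
    and Z: "\<And>x y. a \<le> x \<Longrightarrow> x \<le> y \<Longrightarrow> y \<le> b \<Longrightarrow> {x..y} \<inter> Z = {} \<Longrightarrow> k x = k y"
    and uZ: "\<And>t. t \<in> {a..b} \<Longrightarrow> t \<in> Z \<Longrightarrow> u t \<le> 0"
  shows "integral_dk h k u u1 u2 a b \<le> 0"
proof -
  have hc: "continuous_on {0<..<1} h"
    using subgradient_selection_imp_convex[OF k] by (rule convex_on_unit_continuous)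
  have sub: "{a..b} \<subseteq> {0<..<1}" using ab by auto
  have "bounded (u1 ` {a..b})" "bounded (u2 ` {a..b})"
    using C2_on_unitD(4,5)[OF u] sub
    by (auto intro!: compact_imp_bounded compact_continuous_image intro: continuous_on_subset)
  then obtain A1 A2 where A12: "\<And>t. t \<in> {a..b} \<Longrightarrow> \<bar>u1 t\<bar> \<le> A1" "\<And>t. t \<in> {a..b} \<Longrightarrow> \<bar>u2 t\<bar> \<le> A2"
    unfolding bounded_iff real_norm_def by blast
  define A where "A = max 1 (max A1 A2)"
  have A: "\<bar>u1 t\<bar> \<le> A" "\<bar>u2 t\<bar> \<le> A" if "t \<in> {a..b}" for t
    using A12[OF that] by (auto simp: A_def)
  have A1: "1 \<le> A" by (simp add: A_def)
  have lip: "\<bar>u x - u y\<bar> \<le> A * \<bar>x - y\<bar>" if "x \<in> {a..b}" "y \<in> {a..b}" for x y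
  proof -
    have "norm (u x - u y) \<le> A * norm (x - y)"
    proof (rule field_differentiable_bound[of "{a..b}"])
      show "\<And>z. z \<in> {a..b} \<Longrightarrow> (u has_field_derivative u1 z) (at z within {a..b})"
        using ab by (auto intro: C2_on_unitD(1)[OF u, THEN has_field_derivative_at_within])
    qed (use A that in auto)
    then show ?thesis by simp
  qed
  let ?J = "integral_dk h k u u1 u2"
  have bound: "?J a b \<le> e * (k b - k a)" if e: "0 < e" for e
  proof -
    define d where "d = min 1 (e / (4 * A))"
    have d: "0 < d" using e A1 by (simp add: d_def)
    have "a \<le> b \<longrightarrow> a \<le> a \<and> b \<le> b \<longrightarrow> ?J a b \<le> e * (k b - k a)"
    proof (rule Bolzano[where P = "\<lambda>x y. x \<le> y \<longrightarrow> a \<le> x \<and> y \<le> b \<longrightarrow> ?J x y \<le> e * (k y - k x)"])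
      show "a \<le> b" by fact
    next
      fix x y z
      assume *: "x \<le> y \<longrightarrow> a \<le> x \<and> y \<le> b \<longrightarrow> ?J x y \<le> e * (k y - k x)"
        "y \<le> z \<longrightarrow> a \<le> y \<and> z \<le> b \<longrightarrow> ?J y z \<le> e * (k z - k y)" "x \<le> y" "y \<le> z"
      show "x \<le> z \<longrightarrow> a \<le> x \<and> z \<le> b \<longrightarrow> ?J x z \<le> e * (k z - k x)"
      proof (intro impI)
        assume "a \<le> x \<and> z \<le> b"
        then have "?J x y \<le> e * (k y - k x)" "?J y z \<le> e * (k z - k y)" "?J x z = ?J x y + ?J y z"
          using * ab by (auto intro!: integral_dk_combine[OF u hc])
        then show "?J x z \<le> e * (k z - k x)" by (simp add: algebra_simps)
      qed
    next
      fix p :: real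
      show "\<exists>d>0. \<forall>x y. x \<le> p \<and> p \<le> y \<and> y - x < d \<longrightarrow> x \<le> y \<longrightarrow> a \<le> x \<and> y \<le> b \<longrightarrow>
          ?J x y \<le> e * (k y - k x)"
      proof (intro exI conjI allI impI)
        show "0 < d" by fact
        fix x y assume xy: "x \<le> p \<and> p \<le> y \<and> y - x < d" "x \<le> y" "a \<le> x \<and> y \<le> b"
        have kk: "0 \<le> k y - k x" using subgradient_selection_mono[OF k, of x y] xy ab by simp
        have "A * (y - x) \<le> A * (e / (4 * A))"
          using xy A1 by (intro mult_left_mono) (auto simp: d_def)
        then have "A * (y - x) \<le> e / 4" using A1 by simp
        moreover have "(y - x)\<^sup>2 \<le> y - x"
          using xy mult_left_le[of "y - x" "y - x"] by (auto simp: d_def power2_eq_square)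
        then have "A * (y - x)\<^sup>2 \<le> A * (y - x)" using A1 by (intro mult_left_mono) auto
        ultimately have small: "A * (y - x) \<le> e / 4" "A * (y - x)\<^sup>2 \<le> A * (y - x)" by auto
        then have "A * ((y - x) + (y - x)\<^sup>2) \<le> e / 2" by (simp add: distrib_left)
        moreover have "\<bar>?J x y - u y * (k y - k x)\<bar> \<le> (k y - k x) * (A * ((y - x) + (y - x)\<^sup>2))"
          using xy ab by (intro integral_dk_local[OF k u] A) auto
        ultimately have J: "\<bar>?J x y - u y * (k y - k x)\<bar> \<le> (k y - k x) * (e / 2)"
          using kk by (meson mult_left_mono order_trans)
        show "?J x y \<le> e * (k y - k x)"
        proof (cases "{x..y} \<inter> Z = {}")
          case True
          then have "k x = k y" using xy by (intro Z) auto
          then show ?thesis using J by simp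
        next
          case False
          then obtain z where z: "z \<in> {x..y}" "z \<in> Z" by blast
          have "u y \<le> u z + A * \<bar>y - z\<bar>" using lip[of y z] z xy by auto
          also have "A * \<bar>y - z\<bar> \<le> A * (y - x)" using z A1 by (intro mult_left_mono) auto
          finally have "u y \<le> e / 2" using uZ[of z] z xy small e by auto
          then have "u y * (k y - k x) \<le> e / 2 * (k y - k x)" using kk by (rule mult_right_mono)
          moreover have "(k y - k x) * (e / 2) + e / 2 * (k y - k x) = e * (k y - k x)"
            by (simp add: field_simps)
          ultimately show ?thesis using abs_le_D1[OF J] by linarith
        qed
      qed
    qed
    then show ?thesis using ab by auto
  qed
  show ?thesis
  proof (rule field_le_epsilon)
    fix e :: real assume e: "0 < e"
    define K where "K = k b - k a + 1"
    have K: "0 < K" using subgradient_selection_mono[OF k ab] by (simp add: K_def)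
    have "?J a b \<le> e / K * (k b - k a)" using e K by (intro bound) simp
    also have "\<dots> \<le> e / K * K" using e K by (intro mult_left_mono) (auto simp: K_def)
    finally show "?J a b \<le> 0 + e" using K by simp
  qed
qed

lemma integral_dk_mono:
  assumes "subgradient_selection h k" "C2_on_unit u u1 u2" "C2_on_unit v v1 v2"
    and "0 < a" "a \<le> b" "b < 1"
    and "\<And>x y. a \<le> x \<Longrightarrow> x \<le> y \<Longrightarrow> y \<le> b \<Longrightarrow> {x..y} \<inter> Z = {} \<Longrightarrow> k x = k y"
    and "\<And>t. t \<in> {a..b} \<Longrightarrow> t \<in> Z \<Longrightarrow> u t \<le> v t"
  shows "integral_dk h k u u1 u2 a b \<le> integral_dk h k v v1 v2 a b"
proof -
  have "integral_dk h k (\<lambda>t. u t - v t) (\<lambda>t. u1 t - v1 t) (\<lambda>t. u2 t - v2 t) a b \<le> 0"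
    by (rule integral_dk_nonpos[OF assms(1) C2_on_unit_diff[OF assms(2,3)] assms(4-7)])
      (use assms(8) in auto)
  moreover have "continuous_on {0<..<1} h"
    using subgradient_selection_imp_convex[OF assms(1)] by (rule convex_on_unit_continuous)
  ultimately show ?thesis using assms(4,6) by (simp add: integral_dk_diff[OF assms(2,3)])
qed

section \<open>Behaviour of the second and third derivative at the end points\<close>

lemma DERIV_diff_nonneg:
  fixes f :: "real \<Rightarrow> real"
  assumes "x \<le> y" "\<And>s. x \<le> s \<Longrightarrow> s \<le> y \<Longrightarrow> (f has_real_derivative f' s) (at s)"
    and "\<And>s. x \<le> s \<Longrightarrow> s \<le> y \<Longrightarrow> 0 \<le> f' s"
  shows "f x \<le> f y"
  using assms by (intro DERIV_nonneg_imp_nondecreasing[of x y f]) auto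

text \<open>Comparing the increments of the continuous function \<open>H1\<close> over \<open>[t/2,t]\<close> and \<open>[t,2t]\<close>,
  which tend to 0, with the integrals of tangents and chords of its convex derivative bounds that
  derivative and its subgradients at \<open>t\<close> from both sides.\<close>

lemma convex_derivative_asymptotics:
  assumes k: "subgradient_selection h k"
    and H1: "\<And>t. 0 < t \<Longrightarrow> t < 1 \<Longrightarrow> (H1 has_real_derivative h t) (at t)"
    and lim: "(H1 \<longlongrightarrow> L) (at_right 0)"
  shows "((\<lambda>t. t * h t) \<longlongrightarrow> 0) (at_right 0)" "((\<lambda>t. t\<^sup>2 * k t) \<longlongrightarrow> 0) (at_right 0)"
proof -
  define p q where "p t = H1 (2 * t) - H1 t" and "q t = H1 t - H1 (t / 2)" for t
  have dbl: "filterlim (\<lambda>t::real. 2 * t) (at_right 0) (at_right 0)"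
    and hlf: "filterlim (\<lambda>t::real. t / 2) (at_right 0) (at_right 0)"
    by real_asymp+
  have p0: "(p \<longlongrightarrow> 0) (at_right 0)"
    using tendsto_diff[OF filterlim_compose[OF lim dbl] lim] by (simp add: p_def[abs_def])
  have q0: "(q \<longlongrightarrow> 0) (at_right 0)"
    using tendsto_diff[OF lim filterlim_compose[OF lim hlf]] by (simp add: q_def[abs_def])
  have hconv: "convex_on {0<..<1} h" using k by (rule subgradient_selection_imp_convex)
  have tangent: "h t * (y - x) + k t * ((y - t)\<^sup>2 - (x - t)\<^sup>2) / 2 \<le> H1 y - H1 x"
    if "0 < x" "x \<le> y" "y < 1" "0 < t" "t < 1" for x y t
  proof -
    have "H1 x - h t * x - k t * (x - t)\<^sup>2 / 2 \<le> H1 y - h t * y - k t * (y - t)\<^sup>2 / 2"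
    proof (rule DERIV_diff_nonneg[OF that(2)])
      fix s assume s: "x \<le> s" "s \<le> y"
      show "((\<lambda>s. H1 s - h t * s - k t * (s - t)\<^sup>2 / 2) has_real_derivative
          h s - h t - k t * (s - t)) (at s)"
        using s that by (auto intro!: derivative_eq_intros H1)
      show "0 \<le> h s - h t - k t * (s - t)"
        using subgradient_selectionD[OF k, of t s] s that by simp
    qed
    then show ?thesis by (simp add: algebra_simps diff_divide_distrib)
  qed
  have chord: "p t \<le> t * (h t + h (2 * t)) / 2" if t: "0 < t" "2 * t < 1" for t
  proof -
    define c where "c = (h (2 * t) - h t) / t"
    have "h t * t + c * (t - t)\<^sup>2 / 2 - H1 t \<le> h t * (2 * t) + c * (2 * t - t)\<^sup>2 / 2 - H1 (2 * t)"
    proof (rule DERIV_diff_nonneg[where f = "\<lambda>s. h t * s + c * (s - t)\<^sup>2 / 2 - H1 s"])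
      fix s assume s: "t \<le> s" "s \<le> 2 * t"
      show "((\<lambda>s. h t * s + c * (s - t)\<^sup>2 / 2 - H1 s) has_real_derivative
          h t + c * (s - t) - h s) (at s)"
        using s t by (auto intro!: derivative_eq_intros H1)
      have "convex_on {t..2 * t} h" using t by (intro convex_on_subset[OF hconv]) auto
      then have "h s \<le> (h (2 * t) - h t) / (2 * t - t) * (s - t) + h t"
        using s by (intro convex_onD_Icc') auto
      then show "0 \<le> h t + c * (s - t) - h s" by (simp add: c_def)
    qed (use t in simp)
    moreover have "c * (2 * t - t)\<^sup>2 = t * (h (2 * t) - h t)"
      using t by (simp add: c_def power2_eq_square)
    ultimately show ?thesis by (simp add: p_def algebra_simps)
  qed
  have b1: "t * h t + t\<^sup>2 * k t / 2 \<le> p t" if "0 < t" "t < 1/4" for t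
    using tangent[of t "2 * t" t] that by (simp add: p_def algebra_simps)
  have b2: "t * h t - t\<^sup>2 * k t / 4 \<le> 2 * q t" if "0 < t" "t < 1/4" for t
    using tangent[of "t / 2" t t] that by (simp add: q_def power2_eq_square field_simps)
  \<comment> \<open>The combination of the two tangent estimates in which \<open>k t\<close> cancels.\<close>
  define U where "U t = (p t + 4 * q t) / 3" for t
  have U0: "(U \<longlongrightarrow> 0) (at_right 0)"
    unfolding U_def[abs_def] using p0 q0 by (auto intro!: tendsto_eq_intros)
  have upper: "t * h t \<le> U t" if "0 < t" "t < 1/4" for t
    using b1[OF that] b2[OF that] by (simp add: U_def)
  have lower: "2 * p t - U (2 * t) / 2 \<le> t * h t" if "0 < t" "t < 1/8" for t
    using chord[of t] upper[of "2 * t"] that by (simp add: algebra_simps)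
  have ev: "eventually (\<lambda>t::real. 0 < t \<and> t < 1/8) (at_right 0)"
    by (auto simp: eventually_at_right[of 0 1] intro!: exI[of _ "1/8"])
  show a0: "((\<lambda>t. t * h t) \<longlongrightarrow> 0) (at_right 0)"
  proof (rule tendsto_sandwich)
    show "eventually (\<lambda>t. 2 * p t - U (2 * t) / 2 \<le> t * h t) (at_right 0)"
      "eventually (\<lambda>t. t * h t \<le> U t) (at_right 0)"
      using ev by (auto elim!: eventually_mono intro: lower upper)
    show "((\<lambda>t. 2 * p t - U (2 * t) / 2) \<longlongrightarrow> 0) (at_right 0)"
      using tendsto_diff[OF tendsto_mult[OF tendsto_const[of 2] p0]
        tendsto_divide[OF filterlim_compose[OF U0 dbl] tendsto_const[of 2]]] by simp
  qed (rule U0)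
  show "((\<lambda>t. t\<^sup>2 * k t) \<longlongrightarrow> 0) (at_right 0)"
  proof (rule tendsto_sandwich)
    show "eventually (\<lambda>t. 4 * (t * h t) - 8 * q t \<le> t\<^sup>2 * k t) (at_right 0)"
      using ev by eventually_elim (use b2 in \<open>force\<close>)
    show "eventually (\<lambda>t. t\<^sup>2 * k t \<le> 2 * p t - 2 * (t * h t)) (at_right 0)"
      using ev by eventually_elim (use b1 in \<open>force\<close>)
    show "((\<lambda>t. 4 * (t * h t) - 8 * q t) \<longlongrightarrow> 0) (at_right 0)"
      using tendsto_diff[OF tendsto_mult[OF tendsto_const[of 4] a0]
        tendsto_mult[OF tendsto_const[of 8] q0]] by simp
    show "((\<lambda>t. 2 * p t - 2 * (t * h t)) \<longlongrightarrow> 0) (at_right 0)"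
      using tendsto_diff[OF tendsto_mult[OF tendsto_const[of 2] p0]
        tendsto_mult[OF tendsto_const[of 2] a0]] by simp
  qed
qed

section \<open>Invelopes characterised by their contact set\<close>

text \<open>The integral condition is replaced by its local form: the second derivative is affine on every
  interval on which \<open>H\<close> stays above \<open>Y\<close>. This form mentions no choice of a third derivative, is
  symmetric under reflection of the unit interval, and is stable under uniform limits.\<close>

definition contact_invelope ::
  "(real \<Rightarrow> real) \<Rightarrow> (real \<Rightarrow> real) \<Rightarrow> (real \<Rightarrow> real) \<Rightarrow> (real \<Rightarrow> real) \<Rightarrow> (real \<Rightarrow> real) \<Rightarrow> bool" where
  "contact_invelope X Y H H1 H2 \<longleftrightarrow>
     (\<forall>t\<in>{0..1}. (H has_real_derivative H1 t) (at t within {0..1})) \<and>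
     continuous_on {0..1} H1 \<and>
     (\<forall>t\<in>{0..1}. Y t \<le> H t) \<and>
     (\<forall>t\<in>{0<..<1}. (H1 has_real_derivative H2 t) (at t)) \<and>
     convex_on {0<..<1} H2 \<and>
     H 0 = Y 0 \<and> H1 0 = X 0 \<and>
     H 1 = Y 1 \<and> H1 1 = X 1 \<and>
     (\<forall>x y. 0 < x \<longrightarrow> x < y \<longrightarrow> y < 1 \<longrightarrow> (\<forall>t\<in>{x..y}. Y t < H t) \<longrightarrow>
       (\<exists>a b. \<forall>t\<in>{x..y}. H2 t = a + b * t))"

definition primitive_on_unit :: "(real \<Rightarrow> real) \<Rightarrow> (real \<Rightarrow> real) \<Rightarrow> bool" where
  "primitive_on_unit X Y \<longleftrightarrow>
     continuous_on {0..1} X \<and> Y 0 = 0 \<and>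
     (\<forall>t\<in>{0..1}. (Y has_real_derivative X t) (at t within {0..1}))"

text \<open>Subtracting a cubic polynomial from both \<open>Y\<close> and \<open>H\<close> changes \<open>H2\<close> by an affine function
  only; paths with these boundary values are therefore general enough, and they have invelopes
  that vanish to first order at both end points.\<close>

definition clamped :: "(real \<Rightarrow> real) \<Rightarrow> (real \<Rightarrow> real) \<Rightarrow> bool" where
  "clamped X Y \<longleftrightarrow> primitive_on_unit X Y \<and> X 0 = 0 \<and> X 1 = 0 \<and> Y 1 = 0"

lemma primitive_on_unit_continuous: "primitive_on_unit X Y \<Longrightarrow> continuous_on {0..1} Y"
  unfolding primitive_on_unit_def by (auto intro: DERIV_continuous_on)

lemma has_derivative_interior:
  assumes "\<forall>t\<in>{0..1}. (H has_real_derivative H1 t) (at t within {0..1})" "0 < t" "t < 1"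
  shows "(H has_real_derivative H1 t) (at t)"
proof -
  have "(H has_real_derivative H1 t) (at t within {0..1})" using assms by auto
  then show ?thesis using assms(2,3) at_within_Icc_at[of 0 t 1] by simp
qed

lemma contact_invelopeD:
  assumes "contact_invelope X Y H H1 H2"
  shows "\<forall>t\<in>{0..1}. (H has_real_derivative H1 t) (at t within {0..1})"
    and "continuous_on {0..1} H1" "continuous_on {0..1} H"
    and "\<And>t. 0 \<le> t \<Longrightarrow> t \<le> 1 \<Longrightarrow> Y t \<le> H t"
    and "\<And>t. 0 < t \<Longrightarrow> t < 1 \<Longrightarrow> (H has_real_derivative H1 t) (at t)"
    and "\<And>t. 0 < t \<Longrightarrow> t < 1 \<Longrightarrow> (H1 has_real_derivative H2 t) (at t)"
    and "convex_on {0<..<1} H2"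
    and "H 0 = Y 0" "H1 0 = X 0" "H 1 = Y 1" "H1 1 = X 1"
    and "\<And>x y. 0 < x \<Longrightarrow> x < y \<Longrightarrow> y < 1 \<Longrightarrow> (\<And>t. t \<in> {x..y} \<Longrightarrow> Y t < H t) \<Longrightarrow>
      \<exists>a b. \<forall>t\<in>{x..y}. H2 t = a + b * t"
proof -
  show *: "\<forall>t\<in>{0..1}. (H has_real_derivative H1 t) (at t within {0..1})"
    using assms by (simp add: contact_invelope_def)
  show "continuous_on {0..1} H" using * by (auto intro: DERIV_continuous_on)
  show "\<And>t. 0 < t \<Longrightarrow> t < 1 \<Longrightarrow> (H has_real_derivative H1 t) (at t)"
    using has_derivative_interior[OF *] .
qed (use assms in \<open>auto simp: contact_invelope_def\<close>)

lemma C2_on_unit_contact_invelope: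
  assumes "contact_invelope X Y H H1 H2"
  shows "C2_on_unit H H1 H2"
  using contact_invelopeD[OF assms] convex_on_unit_continuous[OF contact_invelopeD(7)[OF assms]]
  by (auto simp: C2_on_unit_def)

lemma DERIV_reflect_within:
  assumes "\<forall>t\<in>{0..1}. (f has_real_derivative f' t) (at t within {0..1})" "t \<in> {0..1}"
  shows "((\<lambda>t. f (1 - t)) has_real_derivative - f' (1 - t)) (at t within {0..1})"
proof -
  have "(\<lambda>s::real. 1 - s) ` {0..1} = {0..1}" by (rule set_eqI) (auto intro: image_eqI[of _ _ "1 - x" for x])
  then have "(f has_real_derivative f' (1 - t)) (at (1 - t) within (\<lambda>s. 1 - s) ` {0..1})"
    using assms by auto
  moreover have "((\<lambda>s. 1 - s) has_real_derivative -1) (at t within {0..1})"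
    by (auto intro!: derivative_eq_intros)
  ultimately have "(f \<circ> (\<lambda>s. 1 - s) has_real_derivative f' (1 - t) * -1) (at t within {0..1})"
    by (rule DERIV_image_chain)
  then show ?thesis by (simp add: o_def)
qed

lemma DERIV_reflect:
  assumes "(f has_real_derivative d) (at (1 - t))"
  shows "((\<lambda>t. f (1 - t)) has_real_derivative - d) (at t)"
proof -
  have "((\<lambda>s. 1 - s) has_real_derivative -1) (at t)"
    by (auto intro!: derivative_eq_intros)
  from DERIV_chain2[where f = f and g = "\<lambda>t. 1 - t", OF assms this] show ?thesis by simp
qed

lemma clamped_reflect:
  assumes "clamped X Y"
  shows "clamped (\<lambda>t. - X (1 - t)) (\<lambda>t. Y (1 - t))"
  using assms unfolding clamped_def primitive_on_unit_def
  by (auto intro!: DERIV_reflect_within continuous_intros continuous_on_compose2[of "{0..1}" X])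

lemma convex_on_reflect:
  fixes h :: "real \<Rightarrow> real"
  assumes "convex_on {0<..<1} h"
  shows "convex_on {0<..<1} (\<lambda>t. h (1 - t))"
  using subgradient_selection_reflect[OF subgradient_selection_right_deriv[OF assms]]
  by (rule subgradient_selection_imp_convex)

lemma contact_invelope_reflect:
  assumes H: "contact_invelope X Y H H1 H2"
  shows "contact_invelope (\<lambda>t. - X (1 - t)) (\<lambda>t. Y (1 - t)) (\<lambda>t. H (1 - t))
    (\<lambda>t. - H1 (1 - t)) (\<lambda>t. H2 (1 - t))"
  unfolding contact_invelope_def
proof (intro conjI ballI allI impI)
  note D = contact_invelopeD[OF H]
  show "((\<lambda>t. H (1 - t)) has_real_derivative - H1 (1 - t)) (at t within {0..1})" if "t \<in> {0..1}" for t
    using DERIV_reflect_within[OF D(1) that] .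
  show "continuous_on {0..1} (\<lambda>t. - H1 (1 - t))"
    by (auto intro!: continuous_intros continuous_on_compose2[OF D(2)])
  show "Y (1 - t) \<le> H (1 - t)" if "t \<in> {0..1}" for t using D(4) that by simp
  show "((\<lambda>t. - H1 (1 - t)) has_real_derivative H2 (1 - t)) (at t)" if "t \<in> {0<..<1}" for t
    using DERIV_minus[OF DERIV_reflect[OF D(6)[of "1 - t"]]] that by simp
  show "convex_on {0<..<1} (\<lambda>t. H2 (1 - t))" using D(7) by (rule convex_on_reflect)
  fix x y :: real assume xy: "0 < x" "x < y" "y < 1" "\<forall>t\<in>{x..y}. Y (1 - t) < H (1 - t)"
  have "Y t < H t" if "t \<in> {1 - y..1 - x}" for t
    using xy(4)[rule_format, of "1 - t"] that by auto
  then obtain a b where ab: "\<And>t. t \<in> {1 - y..1 - x} \<Longrightarrow> H2 t = a + b * t"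
    using D(12)[of "1 - y" "1 - x"] xy by auto
  show "\<exists>a b. \<forall>t\<in>{x..y}. H2 (1 - t) = a + b * t"
    by (intro exI[of _ "a + b"] exI[of _ "- b"]) (auto simp: ab algebra_simps)
qed (use contact_invelopeD[OF H] in simp_all)

text \<open>Affinity on a closed interval says nothing about a subgradient at its end points, but
  the strict inequality persists on a slightly larger interval.\<close>

lemma contact_invelope_subgradient_eq:
  assumes H: "contact_invelope X Y H H1 H2" and Y: "continuous_on {0..1} Y"
    and k: "subgradient_selection H2 k"
    and xy: "0 < x" "x \<le> y" "y < 1" and gap: "\<And>t. t \<in> {x..y} \<Longrightarrow> Y t \<noteq> H t"
  shows "k x = k y"
proof -
  note D = contact_invelopeD[OF H]
  have nbhd: "\<exists>d>0. d < z \<and> d < 1 - z \<and> (\<forall>t. \<bar>t - z\<bar> \<le> d \<longrightarrow> Y t < H t)"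
    if z: "z \<in> {x..y}" for z
  proof -
    have "isCont H z" "isCont Y z"
      using D(3) Y z xy by (auto intro!: continuous_on_interior)
    then have "((\<lambda>t. H t - Y t) \<longlongrightarrow> H z - Y z) (at z)"
      unfolding isCont_def by (rule tendsto_diff)
    moreover have "0 < H z - Y z" using gap[OF z] D(4)[of z] z xy by auto
    ultimately have "eventually (\<lambda>t. 0 < H t - Y t) (at z)" by (rule order_tendstoD(1))
    then obtain d where d: "0 < d" "\<And>t. t \<noteq> z \<Longrightarrow> \<bar>t - z\<bar> < d \<Longrightarrow> Y t < H t"
      by (auto simp: eventually_at dist_real_def)
    with \<open>0 < H z - Y z\<close> have d: "0 < d" "\<And>t. \<bar>t - z\<bar> < d \<Longrightarrow> Y t < H t"
      by (metis diff_gt_0_iff_gt)+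
    show ?thesis
      using d z xy by (intro exI[of _ "min (d / 2) (min (z / 2) ((1 - z) / 2))"])
        (auto simp: min_def)
  qed
  \<comment> \<open>The interval without contact is extended by \<open>d\<close> to the left and by \<open>e\<close> to the right.\<close>
  obtain d where d: "0 < d" "d < x" "\<And>t. \<bar>t - x\<bar> \<le> d \<Longrightarrow> Y t < H t" using nbhd[of x] xy by auto
  obtain e where e: "0 < e" "e < 1 - y" "\<And>t. \<bar>t - y\<bar> \<le> e \<Longrightarrow> Y t < H t" using nbhd[of y] xy by auto
  have "Y t < H t" if t: "t \<in> {x - d..y + e}" for t
  proof -
    have "\<bar>t - x\<bar> \<le> d \<or> \<bar>t - y\<bar> \<le> e \<or> t \<in> {x..y}" using t d(1) e(1) xy(2) by auto
    then show ?thesis using d(3)[of t] e(3)[of t] gap[of t] D(4)[of t] xy by force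
  qed
  then obtain a b where "\<And>t. t \<in> {x - d..y + e} \<Longrightarrow> H2 t = a + b * t"
    using D(12)[of "x - d" "y + e"] d e xy by auto
  then have "k x = b" "k y = b"
    using d e xy by (auto intro!: subgradient_of_affine[OF k, of "x - d" "y + e" a b])
  then show ?thesis by simp
qed

section \<open>The weighted energy estimate\<close>

lemma has_integral_FTC_unit:
  assumes "a \<le> b" "0 < a" "b < 1"
    and "\<And>t. 0 < t \<Longrightarrow> t < 1 \<Longrightarrow> (F has_real_derivative f t) (at t)"
  shows "(f has_integral (F b - F a)) {a..b}"
proof (rule fundamental_theorem_of_calculus[OF assms(1)])
  fix t assume "t \<in> {a..b}"
  then have "(F has_real_derivative f t) (at t)" using assms by auto
  then show "(F has_vector_derivative f t) (at t within {a..b})"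
    by (simp add: has_real_derivative_iff_has_vector_derivative has_vector_derivative_at_within)
qed

text \<open>The boundary terms of the energy identity below, with \<open>\<kappa>\<close> in the role of a derivative of \<open>D2\<close>.\<close>

definition energy_boundary ::
  "(real \<Rightarrow> real) \<Rightarrow> (real \<Rightarrow> real) \<Rightarrow> (real \<Rightarrow> real) \<Rightarrow> (real \<Rightarrow> real) \<Rightarrow> real \<Rightarrow> real" where
  "energy_boundary D D1 D2 \<kappa> t =
     t * (1 - t) * D t * \<kappa> t - ((1 - 2 * t) * D t + t * (1 - t) * D1 t) * D2 t
     + (1 - 2 * t) * (D1 t)\<^sup>2 - 2 * D t * D1 t"

lemma C2_on_unit_weighted:
  assumes "C2_on_unit D D1 D2"
  shows "C2_on_unit (\<lambda>t. t * (1 - t) * D t)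
    (\<lambda>t. (1 - 2 * t) * D t + t * (1 - t) * D1 t)
    (\<lambda>t. - 2 * D t + 2 * (1 - 2 * t) * D1 t + t * (1 - t) * D2 t)"
  unfolding C2_on_unit_def
proof (intro conjI ballI)
  note D = C2_on_unitD[OF assms]
  show "continuous_on {0<..<1} (\<lambda>t. - 2 * D t + 2 * (1 - 2 * t) * D1 t + t * (1 - t) * D2 t)"
    by (intro continuous_intros D)
  fix t :: real assume t: "t \<in> {0<..<1}"
  have [derivative_intros]: "(D has_real_derivative D1 t) (at t)" "(D1 has_real_derivative D2 t) (at t)"
    using D t by auto
  show "((\<lambda>t. t * (1 - t) * D t) has_real_derivative (1 - 2 * t) * D t + t * (1 - t) * D1 t) (at t)"
    by (rule derivative_eq_intros refl | simp add: algebra_simps)+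
  show "((\<lambda>t. (1 - 2 * t) * D t + t * (1 - t) * D1 t) has_real_derivative
      - 2 * D t + 2 * (1 - 2 * t) * D1 t + t * (1 - t) * D2 t) (at t)"
    by (rule derivative_eq_intros refl | simp add: algebra_simps)+
qed

text \<open>The weight \<open>\<phi> t = t * (1 - t)\<close> is chosen with two properties in mind: \<open>\<phi>'' = -2\<close> is
  negative, so that the term with \<open>D1\<close> squared gets the good sign, and \<open>\<phi>'''\<close> vanishes, so
  that no term with \<open>D\<close> squared is left; moreover \<open>\<phi>\<close> vanishes at the end points, where \<open>D2\<close>
  may be unbounded.\<close>

lemma energy_identity:
  assumes D: "C2_on_unit D D1 D2" and ab: "0 < a" "a \<le> b" "b < 1"
  shows "integral_dk D2 \<kappa> (\<lambda>t. t * (1 - t) * D t)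
      (\<lambda>t. (1 - 2 * t) * D t + t * (1 - t) * D1 t)
      (\<lambda>t. - 2 * D t + 2 * (1 - 2 * t) * D1 t + t * (1 - t) * D2 t) a b =
    integral {a..b} (\<lambda>t. t * (1 - t) * (D2 t)\<^sup>2 + 4 * (D1 t)\<^sup>2)
      + (energy_boundary D D1 D2 \<kappa> b - energy_boundary D D1 D2 \<kappa> a)"
proof -
  note DD = C2_on_unitD[OF D]
  let ?e = "\<lambda>t. t * (1 - t) * (D2 t)\<^sup>2 + 4 * (D1 t)\<^sup>2"
  let ?B = "\<lambda>t. (1 - 2 * t) * (D1 t)\<^sup>2 - 2 * D t * D1 t"
  have int: "?e integrable_on {a..b}"
    using ab by (intro integrable_continuous_unit continuous_intros DD)
  have "((\<lambda>t. - 4 * (D1 t)\<^sup>2 + 2 * (1 - 2 * t) * D1 t * D2 t - 2 * D t * D2 t) has_integral (?B b - ?B a)) {a..b}"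
  proof (rule has_integral_FTC_unit)
    fix t :: real assume t: "0 < t" "t < 1"
    have [derivative_intros]: "(D has_real_derivative D1 t) (at t)" "(D1 has_real_derivative D2 t) (at t)"
      using DD t by auto
    show "(?B has_real_derivative - 4 * (D1 t)\<^sup>2 + 2 * (1 - 2 * t) * D1 t * D2 t - 2 * D t * D2 t) (at t)"
      by (rule derivative_eq_intros refl | simp add: algebra_simps power2_eq_square)+
  qed (use ab in auto)
  from has_integral_add[OF integrable_integral[OF int] this]
  have "integral {a..b} (\<lambda>t. (- 2 * D t + 2 * (1 - 2 * t) * D1 t + t * (1 - t) * D2 t) * D2 t)
      = integral {a..b} ?e + (?B b - ?B a)"
    by (intro integral_unique) (simp add: algebra_simps power2_eq_square)
  then show ?thesis
    by (simp add: integral_dk_def energy_boundary_def algebra_simps)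
qed

text \<open>The boundary terms of four integrations by parts of \<open>k\<close> against \<open>(t * (1 - t))\<^sup>2\<close>.\<close>

definition weight_boundary ::
  "(real \<Rightarrow> real) \<Rightarrow> (real \<Rightarrow> real) \<Rightarrow> (real \<Rightarrow> real) \<Rightarrow> (real \<Rightarrow> real) \<Rightarrow> real \<Rightarrow> real" where
  "weight_boundary H H1 h k t =
     (t * (1 - t))\<^sup>2 * k t - 2 * t * (1 - t) * (1 - 2 * t) * h t
     + (2 - 12 * t + 12 * t\<^sup>2) * H1 t + (12 - 24 * t) * H t"

lemma C2_on_unit_squared_weight:
  "C2_on_unit (\<lambda>t. (t * (1 - t))\<^sup>2) (\<lambda>t. 2 * t * (1 - t) * (1 - 2 * t)) (\<lambda>t. 2 - 12 * t + 12 * t\<^sup>2)"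
  unfolding C2_on_unit_def
proof (intro conjI ballI)
  fix t :: real
  show "((\<lambda>t. (t * (1 - t))\<^sup>2) has_real_derivative 2 * t * (1 - t) * (1 - 2 * t)) (at t)"
    by (rule derivative_eq_intros refl | simp add: algebra_simps power2_eq_square)+
  show "((\<lambda>t. 2 * t * (1 - t) * (1 - 2 * t)) has_real_derivative 2 - 12 * t + 12 * t\<^sup>2) (at t)"
    by (rule derivative_eq_intros refl | simp add: algebra_simps power2_eq_square)+
qed (intro continuous_intros)

text \<open>The weight \<open>\<phi>\<^sup>2\<close> decays fast enough at the end points to have a finite integral even
  against an infinite Stieltjes measure; its fourth derivative is the constant 24.\<close>

lemma integral_dk_squared_weight:
  assumes H: "C2_on_unit H H1 h" and ab: "0 < a" "a \<le> b" "b < 1"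
  shows "integral_dk h k (\<lambda>t. (t * (1 - t))\<^sup>2) (\<lambda>t. 2 * t * (1 - t) * (1 - 2 * t))
      (\<lambda>t. 2 - 12 * t + 12 * t\<^sup>2) a b =
    24 * integral {a..b} H + (weight_boundary H H1 h k b - weight_boundary H H1 h k a)"
proof -
  note D = C2_on_unitD[OF H]
  let ?B = "\<lambda>t. (2 - 12 * t + 12 * t\<^sup>2) * H1 t + (12 - 24 * t) * H t"
  have int: "H integrable_on {a..b}" using ab by (intro integrable_continuous_unit D)
  have "((\<lambda>t. (2 - 12 * t + 12 * t\<^sup>2) * h t - 24 * H t) has_integral (?B b - ?B a)) {a..b}"
  proof (rule has_integral_FTC_unit)
    fix t :: real assume t: "0 < t" "t < 1"
    have [derivative_intros]: "(H has_real_derivative H1 t) (at t)" "(H1 has_real_derivative h t) (at t)"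
      using D t by auto
    show "(?B has_real_derivative (2 - 12 * t + 12 * t\<^sup>2) * h t - 24 * H t) (at t)"
      by (rule derivative_eq_intros refl | simp add: algebra_simps power2_eq_square)+
  qed (use ab in auto)
  from has_integral_add[OF this has_integral_mult_right[OF integrable_integral[OF int], of 24]]
  have "integral {a..b} (\<lambda>t. (2 - 12 * t + 12 * t\<^sup>2) * h t) = (?B b - ?B a) + 24 * integral {a..b} H"
    by (intro integral_unique) simp
  then show ?thesis
    by (simp add: integral_dk_def weight_boundary_def algebra_simps)
qed

lemma continuous_on_unit_at_right:
  fixes f :: "real \<Rightarrow> real"
  assumes "continuous_on {0..1} f"
  shows "(f \<longlongrightarrow> f 0) (at_right 0)"
proof -
  have "(f \<longlongrightarrow> f 0) (at 0 within {0..1})" using assms by (simp add: continuous_on_def)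
  then show ?thesis by (simp add: at_within_Icc_at_right)
qed

lemma contact_invelope_limits:
  assumes H: "contact_invelope X Y H H1 H2" and XY: "clamped X Y"
    and k: "subgradient_selection H2 k"
  shows "(H1 \<longlongrightarrow> 0) (at_right 0)" "((\<lambda>t. H t / t) \<longlongrightarrow> 0) (at_right 0)"
    "((\<lambda>t. t * H2 t) \<longlongrightarrow> 0) (at_right 0)" "((\<lambda>t. t\<^sup>2 * k t) \<longlongrightarrow> 0) (at_right 0)"
proof -
  note D = contact_invelopeD[OF H]
  have Z: "Y 0 = 0" "X 0 = 0" using XY by (auto simp: clamped_def primitive_on_unit_def)
  show H1: "(H1 \<longlongrightarrow> 0) (at_right 0)"
    using continuous_on_unit_at_right[OF D(2)] D(9) Z by simp
  have "(H has_real_derivative H1 0) (at 0 within {0..1})" using D(1) by auto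
  then have "((\<lambda>t. (H t - H 0) / (t - 0)) \<longlongrightarrow> H1 0) (at 0 within {0..1})"
    by (simp add: has_field_derivative_iff)
  then show "((\<lambda>t. H t / t) \<longlongrightarrow> 0) (at_right 0)"
    using D(8,9) Z by (simp add: at_within_Icc_at_right)
  show "((\<lambda>t. t * H2 t) \<longlongrightarrow> 0) (at_right 0)" "((\<lambda>t. t\<^sup>2 * k t) \<longlongrightarrow> 0) (at_right 0)"
    using convex_derivative_asymptotics[OF k D(6) H1] by auto
qed

text \<open>Each boundary term is a product of bounded factors with at least one of \<open>D t / t\<close>, \<open>D1 t\<close>,
  \<open>t * D2 t\<close> and \<open>t\<^sup>2 * \<kappa> t\<close>, or of their analogues for \<open>H\<close>, and all of these tend to 0. The zeros of
  the weights at the end points compensate the growth of \<open>D2\<close> and \<open>\<kappa>\<close>.\<close>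

lemma boundary_terms_vanish_left:
  assumes H: "contact_invelope X Y H H1 H2" "clamped X Y" "subgradient_selection H2 k"
    and G: "contact_invelope X' Y' G G1 G2" "clamped X' Y'" "subgradient_selection G2 l"
  shows "(energy_boundary (\<lambda>t. H t - G t) (\<lambda>t. H1 t - G1 t) (\<lambda>t. H2 t - G2 t) (\<lambda>t. k t - l t) \<longlongrightarrow> 0)
      (at_right 0)"
    and "(weight_boundary H H1 H2 k \<longlongrightarrow> 0) (at_right 0)"
proof -
  note LH = contact_invelope_limits[OF H] and LG = contact_invelope_limits[OF G]
  define D D1 D2 \<kappa> where "D t = H t - G t" and "D1 t = H1 t - G1 t" and "D2 t = H2 t - G2 t"
    and "\<kappa> t = k t - l t" for t
  have ev: "eventually (\<lambda>t::real. 0 < t) (at_right 0)" by (simp add: eventually_at_filter)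
  have id: "((\<lambda>t::real. t) \<longlongrightarrow> 0) (at_right 0)" by (rule tendsto_ident_at)
  have L: "(D1 \<longlongrightarrow> 0) (at_right 0)" "((\<lambda>t. D t / t) \<longlongrightarrow> 0) (at_right 0)"
    "((\<lambda>t. t * D2 t) \<longlongrightarrow> 0) (at_right 0)" "((\<lambda>t. t\<^sup>2 * \<kappa> t) \<longlongrightarrow> 0) (at_right 0)"
    using tendsto_diff[OF LH(1) LG(1)] tendsto_diff[OF LH(2) LG(2)]
      tendsto_diff[OF LH(3) LG(3)] tendsto_diff[OF LH(4) LG(4)]
    by (simp_all add: D_def[abs_def] D1_def[abs_def] D2_def[abs_def] \<kappa>_def[abs_def]
        algebra_simps diff_divide_distrib)
  have "((\<lambda>t. (1 - t) * (D t / t) * (t\<^sup>2 * \<kappa> t)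
      - ((1 - 2 * t) * (D t / t) + (1 - t) * D1 t) * (t * D2 t)
      + (1 - 2 * t) * (D1 t)\<^sup>2 - 2 * (D t / t * t) * D1 t) \<longlongrightarrow>
      (1 - 0) * 0 * 0 - ((1 - 2 * 0) * 0 + (1 - 0) * 0) * 0 + (1 - 2 * 0) * 0\<^sup>2 - 2 * (0 * 0) * 0) (at_right 0)"
    by (intro tendsto_intros L id)
  moreover have "eventually (\<lambda>t. (1 - t) * (D t / t) * (t\<^sup>2 * \<kappa> t)
      - ((1 - 2 * t) * (D t / t) + (1 - t) * D1 t) * (t * D2 t)
      + (1 - 2 * t) * (D1 t)\<^sup>2 - 2 * (D t / t * t) * D1 t = energy_boundary D D1 D2 \<kappa> t) (at_right 0)"
    using ev
  proof eventually_elim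
    case (elim t)
    have "D t = D t / t * t" using elim by simp
    define r where "r = D t / t"
    have r: "D t = r * t" using elim by (simp add: r_def)
    show ?case
      unfolding energy_boundary_def r_def[symmetric] r by (simp add: algebra_simps power2_eq_square)
  qed
  ultimately have "(energy_boundary D D1 D2 \<kappa> \<longlongrightarrow> 0) (at_right 0)"
    by (simp add: tendsto_cong)
  then show "(energy_boundary (\<lambda>t. H t - G t) (\<lambda>t. H1 t - G1 t) (\<lambda>t. H2 t - G2 t) (\<lambda>t. k t - l t) \<longlongrightarrow> 0)
      (at_right 0)"
    by (simp add: D_def[abs_def] D1_def[abs_def] D2_def[abs_def] \<kappa>_def[abs_def])
  have "((\<lambda>t. (1 - t)\<^sup>2 * (t\<^sup>2 * k t) - 2 * (1 - t) * (1 - 2 * t) * (t * H2 t)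
      + (2 - 12 * t + 12 * t\<^sup>2) * H1 t + (12 - 24 * t) * H t) \<longlongrightarrow>
      (1 - 0)\<^sup>2 * 0 - 2 * (1 - 0) * (1 - 2 * 0) * 0 + (2 - 12 * 0 + 12 * 0\<^sup>2) * 0 + (12 - 24 * 0) * 0)
      (at_right 0)"
    using continuous_on_unit_at_right[OF contact_invelopeD(3)[OF H(1)]] contact_invelopeD(8)[OF H(1)] H(2)
    by (intro tendsto_intros LH id) (simp add: clamped_def primitive_on_unit_def)
  moreover have "weight_boundary H H1 H2 k = (\<lambda>t. (1 - t)\<^sup>2 * (t\<^sup>2 * k t)
      - 2 * (1 - t) * (1 - 2 * t) * (t * H2 t) + (2 - 12 * t + 12 * t\<^sup>2) * H1 t + (12 - 24 * t) * H t)"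
    by (rule ext) (simp add: weight_boundary_def power_mult_distrib)
  ultimately show "(weight_boundary H H1 H2 k \<longlongrightarrow> 0) (at_right 0)" by simp
qed

lemma boundary_terms_vanish_right:
  assumes H: "contact_invelope X Y H H1 H2" "clamped X Y" "subgradient_selection H2 k"
    and G: "contact_invelope X' Y' G G1 G2" "clamped X' Y'" "subgradient_selection G2 l"
  shows "(energy_boundary (\<lambda>t. H t - G t) (\<lambda>t. H1 t - G1 t) (\<lambda>t. H2 t - G2 t) (\<lambda>t. k t - l t) \<longlongrightarrow> 0)
      (at_left 1)"
    and "(weight_boundary H H1 H2 k \<longlongrightarrow> 0) (at_left 1)"
proof -
  note R = boundary_terms_vanish_left[OF
      contact_invelope_reflect[OF H(1)] clamped_reflect[OF H(2)] subgradient_selection_reflect[OF H(3)]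
      contact_invelope_reflect[OF G(1)] clamped_reflect[OF G(2)] subgradient_selection_reflect[OF G(3)]]
  have refl: "filterlim (\<lambda>t::real. 1 - t) (at_right 0) (at_left 1)" by real_asymp
  let ?E = "energy_boundary (\<lambda>t. H t - G t) (\<lambda>t. H1 t - G1 t) (\<lambda>t. H2 t - G2 t) (\<lambda>t. k t - l t)"
  have "((\<lambda>t. - ?E t) \<longlongrightarrow> 0) (at_left 1)"
    using filterlim_compose[OF R(1) refl] by (simp add: energy_boundary_def algebra_simps power2_eq_square)
  from tendsto_minus[OF this] show "(?E \<longlongrightarrow> 0) (at_left 1)" by simp
  have "((\<lambda>t. - weight_boundary H H1 H2 k t) \<longlongrightarrow> 0) (at_left 1)"
    using filterlim_compose[OF R(2) refl] by (simp add: weight_boundary_def algebra_simps power2_eq_square)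
  from tendsto_minus[OF this] show "(weight_boundary H H1 H2 k \<longlongrightarrow> 0) (at_left 1)" by simp
qed

text \<open>On the contact set of \<open>H\<close> the difference \<open>H - G\<close> is at most \<open>Y - Y'\<close>, on that of \<open>G\<close>
  it is at least \<open>Y - Y'\<close>; as the Stieltjes measures of the third derivatives live on the
  contact sets, \<open>integral_dk\<close> of \<open>\<phi> * (H - G)\<close> against the difference of the two measures is
  small. By the energy identity it is, up to boundary terms, the left-hand side.\<close>

lemma energy_estimate:
  assumes H: "contact_invelope X Y H H1 H2" "clamped X Y"
    and G: "contact_invelope X' Y' G G1 G2" "clamped X' Y'"
    and e: "\<And>t. 0 \<le> t \<Longrightarrow> t \<le> 1 \<Longrightarrow> \<bar>Y t - Y' t\<bar> \<le> e * (t * (1 - t))" "0 \<le> e"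
    and ab: "0 < a" "a \<le> b" "b < 1"
  shows "integral {a..b} (\<lambda>t. t * (1 - t) * (H2 t - G2 t)\<^sup>2 + 4 * (H1 t - G1 t)\<^sup>2) \<le>
    24 * e * (integral {0..1} (\<lambda>t. \<bar>H t\<bar>) + integral {0..1} (\<lambda>t. \<bar>G t\<bar>))"
proof -
  note HD = contact_invelopeD[OF H(1)] and GD = contact_invelopeD[OF G(1)]
  note HC = C2_on_unit_contact_invelope[OF H(1)] and GC = C2_on_unit_contact_invelope[OF G(1)]
  note DC = C2_on_unit_diff[OF HC GC]
  note DC' = C2_on_unit_diff[OF GC HC]
  have Yc: "continuous_on {0..1} Y" "continuous_on {0..1} Y'"
    using H(2) G(2) by (auto simp: clamped_def intro: primitive_on_unit_continuous)
  obtain k l where k: "subgradient_selection H2 k" and l: "subgradient_selection G2 l"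
    using HD(7) GD(7) subgradient_selection_right_deriv by blast
  define E where "E a b = integral {a..b} (\<lambda>t. t * (1 - t) * (H2 t - G2 t)\<^sup>2 + 4 * (H1 t - G1 t)\<^sup>2)" for a b
  define \<Phi> where "\<Phi> = energy_boundary (\<lambda>t. H t - G t) (\<lambda>t. H1 t - G1 t) (\<lambda>t. H2 t - G2 t) (\<lambda>t. k t - l t)"
  define \<Psi> where "\<Psi> = weight_boundary H H1 H2 k"
  define \<Psi>' where "\<Psi>' = weight_boundary G G1 G2 l"
  define R where "R t = e * (\<Psi> t + \<Psi>' t) - \<Phi> t" for t
  define C where "C = 24 * e * (integral {0..1} (\<lambda>t. \<bar>H t\<bar>) + integral {0..1} (\<lambda>t. \<bar>G t\<bar>))"
  \<comment> \<open>The estimate on a compact subinterval, with boundary terms; the subinterval is enlarged afterwards.\<close>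
  have main: "E a b \<le> C + (R b - R a)" if ab: "0 < a" "a \<le> b" "b < 1" for a b
  proof -
    let ?u = "\<lambda>t. t * (1 - t) * (H t - G t)"
    let ?u1 = "\<lambda>t. (1 - 2 * t) * (H t - G t) + t * (1 - t) * (H1 t - G1 t)"
    let ?u2 = "\<lambda>t. - 2 * (H t - G t) + 2 * (1 - 2 * t) * (H1 t - G1 t) + t * (1 - t) * (H2 t - G2 t)"
    let ?w = "\<lambda>t::real. (t * (1 - t))\<^sup>2" and ?w1 = "\<lambda>t. 2 * t * (1 - t) * (1 - 2 * t)"
      and ?w2 = "\<lambda>t::real. 2 - 12 * t + 12 * t\<^sup>2"
    note uC = C2_on_unit_weighted[OF DC]
    have c2: "continuous_on {0<..<1} H2" "continuous_on {0<..<1} G2"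
      using C2_on_unitD(5)[OF HC] C2_on_unitD(5)[OF GC] by auto
    have "integral {a..b} (\<lambda>t. ?u2 t * (H2 t - G2 t)) =
        integral {a..b} (\<lambda>t. ?u2 t * H2 t) - integral {a..b} (\<lambda>t. ?u2 t * G2 t)"
      unfolding right_diff_distrib[of "?u2 _"] using ab C2_on_unitD(5)[OF uC] c2
      by (intro integral_diff integrable_continuous_unit continuous_on_mult)
    then have split: "integral_dk (\<lambda>t. H2 t - G2 t) (\<lambda>t. k t - l t) ?u ?u1 ?u2 a b =
        integral_dk H2 k ?u ?u1 ?u2 a b - integral_dk G2 l ?u ?u1 ?u2 a b"
      unfolding integral_dk_def by (simp add: algebra_simps)
    have IH: "integral_dk H2 k ?u ?u1 ?u2 a b \<le>
        integral_dk H2 k (\<lambda>t. e * ?w t) (\<lambda>t. e * ?w1 t) (\<lambda>t. e * ?w2 t) a b"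
    proof (rule integral_dk_mono[OF k uC C2_on_unit_cmult[OF C2_on_unit_squared_weight] ab,
          where Z = "{t. Y t = H t}"])
      show "k x = k y" if "a \<le> x" "x \<le> y" "y \<le> b" "{x..y} \<inter> {t. Y t = H t} = {}" for x y
        using that ab by (intro contact_invelope_subgradient_eq[OF H(1) Yc(1) k]) auto
      fix t assume t: "t \<in> {a..b}" "t \<in> {t. Y t = H t}"
      have "H t - G t \<le> e * (t * (1 - t))" using e(1)[of t] GD(4)[of t] t ab by auto
      then have "t * (1 - t) * (H t - G t) \<le> t * (1 - t) * (e * (t * (1 - t)))"
        using t ab by (intro mult_left_mono) auto
      then show "?u t \<le> e * ?w t" by (simp add: power2_eq_square algebra_simps)
    qed
    have IG: "integral_dk G2 l (\<lambda>t. -1 * ?u t) (\<lambda>t. -1 * ?u1 t) (\<lambda>t. -1 * ?u2 t) a b \<le>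
        integral_dk G2 l (\<lambda>t. e * ?w t) (\<lambda>t. e * ?w1 t) (\<lambda>t. e * ?w2 t) a b"
    proof (rule integral_dk_mono[OF l C2_on_unit_cmult[OF uC]
          C2_on_unit_cmult[OF C2_on_unit_squared_weight] ab, where Z = "{t. Y' t = G t}"])
      show "l x = l y" if "a \<le> x" "x \<le> y" "y \<le> b" "{x..y} \<inter> {t. Y' t = G t} = {}" for x y
        using that ab by (intro contact_invelope_subgradient_eq[OF G(1) Yc(2) l]) auto
      fix t assume t: "t \<in> {a..b}" "t \<in> {t. Y' t = G t}"
      have "G t - H t \<le> e * (t * (1 - t))" using e(1)[of t] HD(4)[of t] t ab by auto
      then have "t * (1 - t) * (G t - H t) \<le> t * (1 - t) * (e * (t * (1 - t)))"
        using t ab by (intro mult_left_mono) auto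
      then show "-1 * ?u t \<le> e * ?w t" by (simp add: power2_eq_square algebra_simps)
    qed
    have abs_int: "integral {a..b} F \<le> integral {0..1} (\<lambda>t. \<bar>F t\<bar>)"
      if F: "continuous_on {0..1} F" for F :: "real \<Rightarrow> real"
    proof -
      have i: "(\<lambda>t. \<bar>F t\<bar>) integrable_on {0..1}" "F integrable_on {a..b}" "(\<lambda>t. \<bar>F t\<bar>) integrable_on {a..b}"
        using ab by (auto intro!: integrable_continuous_real continuous_intros F continuous_on_subset[OF F])
      have "integral {a..b} F \<le> integral {a..b} (\<lambda>t. \<bar>F t\<bar>)"
        using i by (intro integral_le) auto
      also have "\<dots> \<le> integral {0..1} (\<lambda>t. \<bar>F t\<bar>)"
        using ab i by (intro integral_subset_le) auto
      finally show ?thesis .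
    qed
    have "E a b + (\<Phi> b - \<Phi> a) \<le>
        e * (24 * integral {a..b} H + (\<Psi> b - \<Psi> a)) + e * (24 * integral {a..b} G + (\<Psi>' b - \<Psi>' a))"
      using IH IG split energy_identity[OF DC ab, of "\<lambda>t. k t - l t"]
      unfolding integral_dk_cmult integral_dk_squared_weight[OF HC ab] integral_dk_squared_weight[OF GC ab]
      by (simp add: E_def \<Phi>_def \<Psi>_def \<Psi>'_def)
    moreover have "e * (24 * integral {a..b} H) + e * (24 * integral {a..b} G) \<le> C"
      using mult_left_mono[OF abs_int[OF HD(3)], of "24 * e"]
        mult_left_mono[OF abs_int[OF GD(3)], of "24 * e"] e(2)
      by (simp add: C_def algebra_simps)
    ultimately show ?thesis by (simp add: R_def algebra_simps)
  qed
  have R0: "(R \<longlongrightarrow> 0) (at_right 0)"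
  proof -
    have "((\<lambda>t. e * (\<Psi> t + \<Psi>' t) - \<Phi> t) \<longlongrightarrow> e * (0 + 0) - 0) (at_right 0)"
      unfolding \<Phi>_def \<Psi>_def \<Psi>'_def
      using boundary_terms_vanish_left[OF H k G l] boundary_terms_vanish_left(2)[OF G l H k]
      by (intro tendsto_intros)
    then show ?thesis by (simp add: R_def[abs_def])
  qed
  have R1: "(R \<longlongrightarrow> 0) (at_left 1)"
  proof -
    have "((\<lambda>t. e * (\<Psi> t + \<Psi>' t) - \<Phi> t) \<longlongrightarrow> e * (0 + 0) - 0) (at_left 1)"
      unfolding \<Phi>_def \<Psi>_def \<Psi>'_def
      using boundary_terms_vanish_right[OF H k G l] boundary_terms_vanish_right(2)[OF G l H k]
      by (intro tendsto_intros)
    then show ?thesis by (simp add: R_def[abs_def])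
  qed
  have E_mono: "E a b \<le> E a' b'" if "0 < a'" "a' \<le> a" "b \<le> b'" "b' < 1" for a' b'
  proof -
    have c: "continuous_on {0<..<1} (\<lambda>t. t * (1 - t) * (H2 t - G2 t)\<^sup>2 + 4 * (H1 t - G1 t)\<^sup>2)"
      using C2_on_unitD[OF HC] C2_on_unitD[OF GC] by (intro continuous_intros)
    show ?thesis
      unfolding E_def using that ab
      by (intro integral_subset_le integrable_continuous_unit[OF c]) (auto intro!: add_nonneg_nonneg)
  qed
  have step: "E a b \<le> C + R b'" if b': "b \<le> b'" "b' < 1" for b'
  proof -
    have "((\<lambda>a'. C + (R b' - R a')) \<longlongrightarrow> C + (R b' - 0)) (at_right 0)"
      by (intro tendsto_intros R0)
    moreover have "eventually (\<lambda>a'. E a b \<le> C + (R b' - R a')) (at_right 0)"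
      unfolding eventually_at_right[OF ab(1)]
    proof (intro exI[of _ a] conjI allI impI)
      fix a' assume "0 < a'" "a' < a"
      then show "E a b \<le> C + (R b' - R a')"
        using E_mono[of a' b'] main[of a' b'] b' ab by linarith
    qed (use ab in auto)
    ultimately have "E a b \<le> C + (R b' - 0)" by (intro tendsto_lowerbound) auto
    then show ?thesis by simp
  qed
  have "((\<lambda>b'. C + R b') \<longlongrightarrow> C + 0) (at_left 1)" by (intro tendsto_intros R1)
  moreover have "eventually (\<lambda>b'. E a b \<le> C + R b') (at_left 1)"
    unfolding eventually_at_left[OF ab(3)] using step ab by (intro exI[of _ b]) auto
  ultimately have "E a b \<le> C + 0" by (intro tendsto_lowerbound) auto
  then show ?thesis by (simp add: E_def C_def)
qed

lemma clamped_abs_le: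
  assumes XY: "clamped X Y" and c: "\<And>t. 0 \<le> t \<Longrightarrow> t \<le> 1 \<Longrightarrow> \<bar>X t\<bar> \<le> c"
    and t: "0 \<le> t" "t \<le> 1"
  shows "\<bar>Y t\<bar> \<le> 2 * c * (t * (1 - t))"
proof -
  have Y: "\<forall>t\<in>{0..1}. (Y has_real_derivative X t) (at t within {0..1})" "Y 0 = 0" "Y 1 = 0"
    using XY by (auto simp: clamped_def primitive_on_unit_def)
  have lip: "\<bar>Y x - Y y\<bar> \<le> c * \<bar>x - y\<bar>" if "x \<in> {0..1}" "y \<in> {0..1}" for x y
  proof -
    have "norm (Y x - Y y) \<le> c * norm (x - y)"
      by (rule field_differentiable_bound[of "{0..1}" Y X]) (use Y c that in auto)
    then show ?thesis by simp
  qed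
  have c0: "0 \<le> c" using c[of 0] by linarith
  show ?thesis
  proof (cases "t \<le> 1/2")
    case True
    have "\<bar>Y t\<bar> \<le> c * t" using lip[of t 0] Y t by simp
    also have "\<dots> \<le> c * (2 * (1 - t) * t)" using c0 t True by (intro mult_left_mono mult_right_le_one_le) (auto simp: mult_le_cancel_right1)
    finally show ?thesis by (simp add: algebra_simps)
  next
    case False
    have "\<bar>Y t\<bar> \<le> c * (1 - t)" using lip[of t 1] Y t by simp
    also have "\<dots> \<le> c * (2 * t * (1 - t))" using c0 t False by (intro mult_left_mono) (auto simp: mult_le_cancel_right1)
    finally show ?thesis by (simp add: algebra_simps)
  qed
qed

text \<open>A version of the Cauchy-Schwarz inequality, as the arithmetic-geometric mean
  \<open>\<bar>D1\<bar> \<le> (D1\<^sup>2 / r + r) / 2\<close> integrated over \<open>[0,t]\<close>.\<close>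

lemma sup_le_energy:
  fixes D :: "real \<Rightarrow> real"
  assumes D: "\<forall>t\<in>{0..1}. (D has_real_derivative D1 t) (at t within {0..1})"
    and D1: "continuous_on {0..1} D1" and D0: "D 0 = 0" and r: "0 < r"
    and N: "\<And>a b. 0 < a \<Longrightarrow> a \<le> b \<Longrightarrow> b < 1 \<Longrightarrow> integral {a..b} (\<lambda>t. (D1 t)\<^sup>2) \<le> N"
    and t: "0 \<le> t" "t \<le> 1"
  shows "\<bar>D t\<bar> \<le> (N / r + r) / 2"
proof -
  have N': "\<bar>D y - D x\<bar> \<le> (N / r + r) / 2" if xy: "0 < x" "x \<le> y" "y < 1" for x y
  proof -
    have c: "continuous_on {x..y} D1" using xy by (intro continuous_on_subset[OF D1]) auto
    have "(D1 has_integral (D y - D x)) {x..y}"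
      by (rule has_integral_FTC_unit) (use xy has_derivative_interior[OF D] in auto)
    then have "\<bar>D y - D x\<bar> = norm (integral {x..y} D1)" by (simp add: integral_unique)
    also have "\<dots> \<le> integral {x..y} (\<lambda>s. ((D1 s)\<^sup>2 / r + r) / 2)"
    proof (rule integral_norm_bound_integral)
      show "D1 integrable_on {x..y}" "(\<lambda>s. ((D1 s)\<^sup>2 / r + r) / 2) integrable_on {x..y}"
        using r by (auto intro!: integrable_continuous_real continuous_intros c)
      fix s
      have "0 \<le> (\<bar>D1 s\<bar> - r)\<^sup>2" by simp
      then show "norm (D1 s) \<le> ((D1 s)\<^sup>2 / r + r) / 2"
        using r by (simp add: power2_eq_square field_simps)
    qed
    also have "\<dots> = (integral {x..y} (\<lambda>s. (D1 s)\<^sup>2) / r + r * (y - x)) / 2"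
    proof -
      have "((\<lambda>s. ((D1 s)\<^sup>2 / r + r) / 2) has_integral
          (integral {x..y} (\<lambda>s. (D1 s)\<^sup>2) / r + r * (y - x)) / 2) {x..y}"
        using r xy c has_integral_const_real[of r x y]
        by (intro has_integral_divide has_integral_add integrable_integral integrable_continuous_real
            continuous_intros) (auto simp: mult.commute)
      then show ?thesis by (rule integral_unique)
    qed
    also have "\<dots> \<le> (N / r + r) / 2"
      using N[OF xy] r xy by (intro divide_right_mono add_mono) (auto simp: divide_right_mono)
    finally show ?thesis .
  qed
  have Dc: "continuous_on {0..1} D" using D by (auto intro: DERIV_continuous_on)
  have cl: "\<bar>D y\<bar> \<le> (N / r + r) / 2" if y: "0 < y" "y < 1" for y
  proof -
    have "((\<lambda>x. \<bar>D y - D x\<bar>) \<longlongrightarrow> \<bar>D y - D 0\<bar>) (at_right 0)"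
      by (intro tendsto_intros continuous_on_unit_at_right Dc)
    moreover have "eventually (\<lambda>x. \<bar>D y - D x\<bar> \<le> (N / r + r) / 2) (at_right 0)"
      unfolding eventually_at_right[OF y(1)] using N' y by (intro exI[of _ y]) auto
    ultimately have "\<bar>D y - D 0\<bar> \<le> (N / r + r) / 2" by (intro tendsto_upperbound) auto
    then show ?thesis using D0 by simp
  qed
  have "\<bar>D s\<bar> \<le> (N / r + r) / 2" if "s \<in> closure {0<..<1}" for s
  proof -
    have "closed {s\<in>{0..1}. \<bar>D s\<bar> \<le> (N / r + r) / 2}"
      by (intro continuous_on_closed_Collect_le continuous_intros Dc) auto
    moreover have "{0<..<1} \<subseteq> {s\<in>{0..1}. \<bar>D s\<bar> \<le> (N / r + r) / 2}" using cl by auto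
    ultimately show ?thesis using that closure_minimal by blast
  qed
  then show ?thesis using t by simp
qed

section \<open>A priori bounds and stability\<close>

lemma contact_invelope_zero: "contact_invelope (\<lambda>t. 0) (\<lambda>t. 0) (\<lambda>t. 0) (\<lambda>t. 0) (\<lambda>t. 0)"
  by (auto simp: contact_invelope_def convex_on_const)

lemma clamped_zero: "clamped (\<lambda>t. 0) (\<lambda>t. 0)"
  by (auto simp: clamped_def primitive_on_unit_def)

lemma energy_parts:
  assumes H: "contact_invelope X Y H H1 H2" and G: "contact_invelope X' Y' G G1 G2"
    and ab: "0 < a" "a \<le> b" "b < 1"
    and le: "integral {a..b} (\<lambda>t. t * (1 - t) * (H2 t - G2 t)\<^sup>2 + 4 * (H1 t - G1 t)\<^sup>2) \<le> K"
  shows "integral {a..b} (\<lambda>t. (H1 t - G1 t)\<^sup>2) \<le> K / 4"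
    and "integral {a..b} (\<lambda>t. t * (1 - t) * (H2 t - G2 t)\<^sup>2) \<le> K"
proof -
  note HC = C2_on_unitD[OF C2_on_unit_contact_invelope[OF H]]
    and GC = C2_on_unitD[OF C2_on_unit_contact_invelope[OF G]]
  have i: "(\<lambda>t. t * (1 - t) * (H2 t - G2 t)\<^sup>2) integrable_on {a..b}"
    "(\<lambda>t. 4 * (H1 t - G1 t)\<^sup>2) integrable_on {a..b}"
    using ab by (intro integrable_continuous_unit continuous_intros HC GC; simp)+
  have "0 \<le> integral {a..b} (\<lambda>t. t * (1 - t) * (H2 t - G2 t)\<^sup>2)"
    "0 \<le> integral {a..b} (\<lambda>t. 4 * (H1 t - G1 t)\<^sup>2)"
    using ab i by (auto intro!: integral_nonneg mult_nonneg_nonneg)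
  then show "integral {a..b} (\<lambda>t. (H1 t - G1 t)\<^sup>2) \<le> K / 4"
    "integral {a..b} (\<lambda>t. t * (1 - t) * (H2 t - G2 t)\<^sup>2) \<le> K"
    using le integral_add[OF i] by simp_all
qed

text \<open>The zero path has the invelope 0. Comparison with it bounds the mean square of \<open>H1\<close> by a multiple
  of the mean of \<open>\<bar>H\<bar>\<close>, which is itself controlled by \<open>H1\<close>; as the one side is quadratic and the other
  linear, this gives an absolute bound.\<close>

lemma contact_invelope_bound:
  assumes H: "contact_invelope X Y H H1 H2" and XY: "clamped X Y"
    and c: "0 < c" "\<And>t. 0 \<le> t \<Longrightarrow> t \<le> 1 \<Longrightarrow> \<bar>X t\<bar> \<le> c" and t: "0 \<le> t" "t \<le> 1"
  shows "\<bar>H t\<bar> \<le> 12 * c"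
proof -
  note D = contact_invelopeD[OF H]
  define S where "S = integral {0..1} (\<lambda>t. \<bar>H t\<bar>)"
  have H0: "H 0 = 0" using XY D(8) by (simp add: clamped_def primitive_on_unit_def)
  have "integral {a..b} (\<lambda>t. (H1 t)\<^sup>2) \<le> 12 * c * S" if "0 < a" "a \<le> b" "b < 1" for a b
  proof -
    have "integral {a..b} (\<lambda>t. t * (1 - t) * (H2 t - 0)\<^sup>2 + 4 * (H1 t - 0)\<^sup>2) \<le>
        24 * (2 * c) * (integral {0..1} (\<lambda>t. \<bar>H t\<bar>) + integral {0..1} (\<lambda>t::real. \<bar>0\<bar>))"
      using clamped_abs_le[OF XY c(2)] c that
      by (intro energy_estimate[OF H XY contact_invelope_zero clamped_zero]) auto
    from energy_parts(1)[OF H contact_invelope_zero that this] show ?thesis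
      by (simp add: S_def)
  qed
  \<comment> \<open>The weight \<open>r = 12 * c\<close> makes the coefficient of \<open>S\<close> equal to 1/2, so that \<open>S\<close> can be absorbed.\<close>
  then have sup: "\<bar>H t\<bar> \<le> (12 * c * S / (12 * c) + 12 * c) / 2" if "0 \<le> t" "t \<le> 1" for t
    using c that by (intro sup_le_energy[OF D(1,2) H0]) auto
  have "S \<le> integral {0..1} (\<lambda>t::real. (S + 12 * c) / 2)"
    unfolding S_def using sup c
    by (intro integral_le integrable_continuous_real continuous_intros D(3)) (auto simp: S_def)
  then have "S \<le> 12 * c" by simp
  then show ?thesis using sup[OF t] c by simp
qed

lemma clamped_diff:
  assumes "clamped X Y" "clamped X' Y'"
  shows "clamped (\<lambda>t. X t - X' t) (\<lambda>t. Y t - Y' t)"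
  using assms unfolding clamped_def primitive_on_unit_def
  by (auto intro!: continuous_on_diff DERIV_diff)

text \<open>The energy of the difference is bounded linearly by the distance of the paths; the supremum of the
  difference is of the order of the square root of the energy.\<close>

lemma contact_invelope_stability:
  assumes H: "contact_invelope X Y H H1 H2" "clamped X Y"
    and G: "contact_invelope X' Y' G G1 G2" "clamped X' Y'"
    and c: "0 < c" "\<And>t. 0 \<le> t \<Longrightarrow> t \<le> 1 \<Longrightarrow> \<bar>X t\<bar> \<le> c" "\<And>t. 0 \<le> t \<Longrightarrow> t \<le> 1 \<Longrightarrow> \<bar>X' t\<bar> \<le> c"
    and d: "0 < d" "\<And>t. 0 \<le> t \<Longrightarrow> t \<le> 1 \<Longrightarrow> \<bar>X t - X' t\<bar> \<le> d"
  shows "0 < a \<Longrightarrow> a \<le> b \<Longrightarrow> b < 1 \<Longrightarrow>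
      integral {a..b} (\<lambda>t. t * (1 - t) * (H2 t - G2 t)\<^sup>2) \<le> 1152 * c * d"
    and "0 \<le> t \<Longrightarrow> t \<le> 1 \<Longrightarrow> \<bar>H t - G t\<bar> \<le> (288 * c + 1) * sqrt d"
proof -
  note HD = contact_invelopeD[OF H(1)] and GD = contact_invelopeD[OF G(1)]
  note diff = clamped_diff[OF H(2) G(2)]
  have int12: "integral {0..1} (\<lambda>t. \<bar>F t\<bar>) \<le> 12 * c"
    if "continuous_on {0..1} F" "\<And>t. 0 \<le> t \<Longrightarrow> t \<le> 1 \<Longrightarrow> \<bar>F t\<bar> \<le> 12 * c" for F :: "real \<Rightarrow> real"
  proof -
    have "integral {0..1} (\<lambda>t. \<bar>F t\<bar>) \<le> integral {0..1} (\<lambda>t::real. 12 * c)"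
      using that by (intro integral_le integrable_continuous_real continuous_intros) auto
    then show ?thesis by simp
  qed
  have en: "integral {a..b} (\<lambda>t. t * (1 - t) * (H2 t - G2 t)\<^sup>2 + 4 * (H1 t - G1 t)\<^sup>2) \<le> 1152 * c * d"
    if "0 < a" "a \<le> b" "b < 1" for a b
  proof -
    have "integral {a..b} (\<lambda>t. t * (1 - t) * (H2 t - G2 t)\<^sup>2 + 4 * (H1 t - G1 t)\<^sup>2) \<le>
        24 * (2 * d) * (integral {0..1} (\<lambda>t. \<bar>H t\<bar>) + integral {0..1} (\<lambda>t. \<bar>G t\<bar>))"
      using clamped_abs_le[OF diff d(2)] d that by (intro energy_estimate[OF H G]) auto
    also have "\<dots> \<le> 24 * (2 * d) * (12 * c + 12 * c)"
      using d(1) contact_invelope_bound[OF H c(1,2)] contact_invelope_bound[OF G c(1,3)]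
      by (intro mult_left_mono add_mono int12 HD GD) auto
    finally show ?thesis by (simp add: mult_ac)
  qed
  show "integral {a..b} (\<lambda>t. t * (1 - t) * (H2 t - G2 t)\<^sup>2) \<le> 1152 * c * d"
    if "0 < a" "a \<le> b" "b < 1" for a b
    using energy_parts(2)[OF H(1) G(1) that en[OF that]] .
  assume t: "0 \<le> t" "t \<le> 1"
  \<comment> \<open>The energy is of order \<open>d\<close>, so the weight \<open>sqrt d\<close> balances the two terms.\<close>
  have "\<bar>H t - G t\<bar> \<le> (1152 * c * d / 4 / sqrt d + sqrt d) / 2"
  proof (rule sup_le_energy[where D = "\<lambda>t. H t - G t" and ?D1.0 = "\<lambda>t. H1 t - G1 t"])
    show "\<forall>t\<in>{0..1}. ((\<lambda>t. H t - G t) has_real_derivative H1 t - G1 t) (at t within {0..1})"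
      using HD(1) GD(1) by (auto intro: DERIV_diff)
    show "continuous_on {0..1} (\<lambda>t. H1 t - G1 t)" by (intro continuous_intros HD GD)
    show "H 0 - G 0 = 0" using HD(8) GD(8) H(2) G(2) by (simp add: clamped_def primitive_on_unit_def)
    show "integral {a..b} (\<lambda>t. (H1 t - G1 t)\<^sup>2) \<le> 1152 * c * d / 4"
      if "0 < a" "a \<le> b" "b < 1" for a b
      using energy_parts(1)[OF H(1) G(1) that en[OF that]] .
  qed (use d t in auto)
  also have "\<dots> = (288 * c * sqrt d + sqrt d) / 2"
  proof -
    have "1152 * c * d / 4 / sqrt d = 288 * c * (d / sqrt d)" by simp
    then show ?thesis using real_div_sqrt[of d] d(1) by simp
  qed
  also have "\<dots> \<le> (288 * c + 1) * sqrt d"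
    using c(1) d(1) by (simp add: algebra_simps)
  finally show "\<bar>H t - G t\<bar> \<le> (288 * c + 1) * sqrt d" .
qed

lemma continuous_on_unit_bounded:
  fixes X :: "real \<Rightarrow> real"
  assumes "continuous_on {0..1} X"
  obtains c where "0 < c" "\<And>t. 0 \<le> t \<Longrightarrow> t \<le> 1 \<Longrightarrow> \<bar>X t\<bar> \<le> c"
proof -
  have "bounded (X ` {0..1})"
    using assms by (intro compact_imp_bounded compact_continuous_image) auto
  then obtain c where "\<And>t. t \<in> {0..1} \<Longrightarrow> \<bar>X t\<bar> \<le> c" unfolding bounded_iff real_norm_def by blast
  then show thesis by (intro that[of "max 1 c"]) force+
qed

lemma contact_invelope_tendsto:
  assumes H: "\<And>n. contact_invelope (Xs n) (Ys n) (Hs n) (Hs1 n) (Hs2 n)" "\<And>n. clamped (Xs n) (Ys n)"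
    and G: "contact_invelope X Y G G1 G2" "clamped X Y"
    and lim: "uniform_limit {0..1} Xs X sequentially"
    and t: "0 \<le> t" "t \<le> 1"
  shows "(\<lambda>n. Hs n t) \<longlonglongrightarrow> G t"
proof -
  obtain c where c: "0 < c" "\<And>t. 0 \<le> t \<Longrightarrow> t \<le> 1 \<Longrightarrow> \<bar>X t\<bar> \<le> c"
    using G(2) continuous_on_unit_bounded[of X] by (auto simp: clamped_def primitive_on_unit_def)
  define K where "K = 288 * (c + 1) + 1"
  have K: "0 < K" using c by (simp add: K_def)
  show ?thesis
  proof (rule LIMSEQ_I)
    fix r :: real assume r: "0 < r"
    define d where "d = min 1 ((r / (2 * K))\<^sup>2)"
    have d: "0 < d" using r K by (simp add: d_def)
    have "sqrt d \<le> sqrt ((r / (2 * K))\<^sup>2)" unfolding d_def by (intro real_sqrt_le_mono) simp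
    also have "\<dots> = r / (2 * K)" using r K by (subst real_sqrt_abs) simp
    finally have sq: "K * sqrt d < r" using K r by (simp add: field_simps)
    from uniform_limitD[OF lim d] obtain N where
      N: "\<And>n t. N \<le> n \<Longrightarrow> 0 \<le> t \<Longrightarrow> t \<le> 1 \<Longrightarrow> \<bar>Xs n t - X t\<bar> < d"
      unfolding eventually_sequentially dist_real_def by force
    show "\<exists>N. \<forall>n\<ge>N. norm (Hs n t - G t) < r"
    proof (intro exI allI impI)
      fix n assume n: "N \<le> n"
      have "d \<le> 1" by (simp add: d_def)
      then have "\<bar>Xs n s\<bar> \<le> c + 1" if "0 \<le> s" "s \<le> 1" for s
        using N[OF n that] c(2)[OF that] by linarith
      then have "\<bar>Hs n t - G t\<bar> \<le> (288 * (c + 1) + 1) * sqrt d"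
        using c(1) d t less_imp_le[OF N[OF n]]
        by (intro contact_invelope_stability(2)[OF H G]) (auto intro: order_trans[OF c(2)])
      then show "norm (Hs n t - G t) < r" using sq by (simp add: K_def)
    qed
  qed
qed

section \<open>Limits of convex functions\<close>

lemma exists_small_value:
  fixes D :: "real \<Rightarrow> real"
  assumes "p < q" "continuous_on {p..q} D" "0 < e" "integral {p..q} (\<lambda>t. (D t)\<^sup>2) < e\<^sup>2 * (q - p)"
  shows "\<exists>x\<in>{p..q}. \<bar>D x\<bar> < e"
proof (rule ccontr)
  assume "\<not> ?thesis"
  then have "e\<^sup>2 \<le> (D x)\<^sup>2" if "x \<in> {p..q}" for x
    using that assms(3) by (intro abs_le_square_iff[THEN iffD1]) (force simp: not_less)
  then have "integral {p..q} (\<lambda>t. e\<^sup>2) \<le> integral {p..q} (\<lambda>t. (D t)\<^sup>2)"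
    using assms(2) by (intro integral_le integrable_continuous_real continuous_intros) auto
  then show False using assms by (simp add: mult.commute)
qed

lemma le_divide_of_mult_le:
  fixes a c d r :: real
  assumes "a * d \<le> c" "0 \<le> c" "0 < r" "r \<le> d"
  shows "a \<le> c / r"
proof (cases "0 \<le> a")
  case True
  then have "a * r \<le> a * d" using assms by (intro mult_left_mono) auto
  then show ?thesis using assms by (simp add: pos_le_divide_eq)
next
  case False
  moreover have "0 \<le> c / r" using assms by simp
  ultimately show ?thesis by linarith
qed

text \<open>Bounds at four points control the slopes between the middle two.\<close>

lemma convex_lipschitz_four_points:
  assumes k: "subgradient_selection h k"
    and x: "0 < x1" "x1 + r \<le> x2" "x2 \<le> u" "u \<le> v" "v \<le> x3" "x3 + r \<le> x4" "x4 < 1" "0 < r"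
    and B: "\<bar>h x1\<bar> \<le> B" "\<bar>h x2\<bar> \<le> B" "\<bar>h x3\<bar> \<le> B" "\<bar>h x4\<bar> \<le> B"
  shows "\<bar>h v - h u\<bar> \<le> 2 * B / r * (v - u)"
proof -
  have "k v \<le> k x3" using x by (intro subgradient_selection_mono[OF k]) auto
  also have "k x3 \<le> 2 * B / r"
  proof -
    have "k x3 * (x4 - x3) \<le> 2 * B" using subgradient_selectionD[OF k, of x3 x4] x B by auto
    moreover have "0 \<le> 2 * B" using B by linarith
    ultimately show ?thesis by (rule le_divide_of_mult_le) (use x in simp_all)
  qed
  finally have 1: "k v \<le> 2 * B / r" .
  have "- (2 * B / r) \<le> k x2"
  proof -
    have "- k x2 * (x2 - x1) \<le> 2 * B" using subgradient_selectionD[OF k, of x2 x1] x B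
      by (auto simp: algebra_simps)
    moreover have "0 \<le> 2 * B" using B by linarith
    ultimately have "- k x2 \<le> 2 * B / r" by (rule le_divide_of_mult_le) (use x in simp_all)
    then show ?thesis by simp
  qed
  also have "k x2 \<le> k u" using x by (intro subgradient_selection_mono[OF k]) auto
  finally have 2: "- (2 * B / r) \<le> k u" .
  have "h v - h u \<le> k v * (v - u)" using subgradient_selectionD[OF k, of v u] x by (auto simp: algebra_simps)
  also have "\<dots> \<le> 2 * B / r * (v - u)" using 1 x by (intro mult_right_mono) auto
  finally have "h v - h u \<le> 2 * B / r * (v - u)" .
  moreover have "- (2 * B / r) * (v - u) \<le> k u * (v - u)" using 2 x by (intro mult_right_mono) auto
  then have "- (2 * B / r * (v - u)) \<le> h v - h u"
    using subgradient_selectionD[OF k, of u v] x by auto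
  ultimately show ?thesis by linarith
qed

text \<open>Mean-square convergence produces points near \<open>t\<close> at which two members of the sequence are
  close. It also bounds the members at suitable points on both sides of \<open>t\<close>, so that convexity
  makes them equi-Lipschitz near \<open>t\<close>.\<close>

lemma convex_L2_Cauchy_imp_Cauchy:
  fixes f :: "nat \<Rightarrow> real \<Rightarrow> real"
  assumes f: "\<And>n. convex_on {0<..<1} (f n)"
    and C: "\<And>a b e. 0 < a \<Longrightarrow> a \<le> b \<Longrightarrow> b < 1 \<Longrightarrow> 0 < e \<Longrightarrow>
      \<exists>N. \<forall>m\<ge>N. \<forall>n\<ge>N. integral {a..b} (\<lambda>t. (f m t - f n t)\<^sup>2) < e"
    and t: "0 < t" "t < 1"
  shows "Cauchy (\<lambda>n. f n t)"
proof -
  have fc: "continuous_on {0<..<1} (f n)" for n using convex_on_unit_continuous[OF f] .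
  have close: "\<exists>N. \<forall>m\<ge>N. \<forall>n\<ge>N. \<exists>x\<in>{p..q}. \<bar>f m x - f n x\<bar> < e"
    if pq: "0 < p" "p < q" "q < 1" "0 < e" for p q e
  proof -
    obtain N where N: "\<And>m n. N \<le> m \<Longrightarrow> N \<le> n \<Longrightarrow>
        integral {p..q} (\<lambda>t. (f m t - f n t)\<^sup>2) < e\<^sup>2 * (q - p)"
      using C[of p q "e\<^sup>2 * (q - p)"] pq by auto
    have "continuous_on {p..q} (\<lambda>t. f m t - f n t)" for m n
      using pq by (intro continuous_intros continuous_on_subset[OF fc]) auto
    then show ?thesis using N pq exists_small_value[of p q "\<lambda>t. f m t - f n t" e for m n] by blast
  qed
  \<comment> \<open>Four intervals of length \<open>r\<close>, two on each side of \<open>t\<close> and separated by \<open>r\<close>, fit into the unit interval.\<close>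
  define r where "r = min t (1 - t) / 5"
  have r: "0 < r" "5 * r \<le> t" "5 * r \<le> 1 - t" using t by (auto simp: r_def)
  obtain N1 where N1: "\<And>m n. N1 \<le> m \<Longrightarrow> N1 \<le> n \<Longrightarrow> \<exists>x\<in>{t - 4 * r..t - 3 * r}. \<bar>f m x - f n x\<bar> < 1"
    using close[of "t - 4 * r" "t - 3 * r" 1] r t by auto
  obtain N2 where N2: "\<And>m n. N2 \<le> m \<Longrightarrow> N2 \<le> n \<Longrightarrow> \<exists>x\<in>{t - 2 * r..t - r}. \<bar>f m x - f n x\<bar> < 1"
    using close[of "t - 2 * r" "t - r" 1] r t by auto
  obtain N3 where N3: "\<And>m n. N3 \<le> m \<Longrightarrow> N3 \<le> n \<Longrightarrow> \<exists>x\<in>{t + r..t + 2 * r}. \<bar>f m x - f n x\<bar> < 1"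
    using close[of "t + r" "t + 2 * r" 1] r t by auto
  obtain N4 where N4: "\<And>m n. N4 \<le> m \<Longrightarrow> N4 \<le> n \<Longrightarrow> \<exists>x\<in>{t + 3 * r..t + 4 * r}. \<bar>f m x - f n x\<bar> < 1"
    using close[of "t + 3 * r" "t + 4 * r" 1] r t by auto
  define N0 where "N0 = max (max N1 N2) (max N3 N4)"
  have "bounded (f N0 ` {t - 4 * r..t + 4 * r})"
    using r by (intro compact_imp_bounded compact_continuous_image continuous_on_subset[OF fc]) auto
  then obtain B0 where B0: "\<And>x. x \<in> {t - 4 * r..t + 4 * r} \<Longrightarrow> \<bar>f N0 x\<bar> \<le> B0"
    unfolding bounded_iff real_norm_def by blast
  define B where "B = B0 + 1"
  have lip: "\<bar>f n v - f n u\<bar> \<le> 2 * B / r * (v - u)"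
    if n: "N0 \<le> n" and uv: "t - r \<le> u" "u \<le> v" "v \<le> t + r" for n u v
  proof -
    have "N1 \<le> N0" "N2 \<le> N0" "N3 \<le> N0" "N4 \<le> N0" by (auto simp: N0_def)
    with n N1[of n N0] N2[of n N0] N3[of n N0] N4[of n N0]
    obtain x1 x2 x3 x4 where x: "x1 \<in> {t - 4 * r..t - 3 * r}" "x2 \<in> {t - 2 * r..t - r}"
        "x3 \<in> {t + r..t + 2 * r}" "x4 \<in> {t + 3 * r..t + 4 * r}"
      and d: "\<bar>f n x1 - f N0 x1\<bar> < 1" "\<bar>f n x2 - f N0 x2\<bar> < 1"
        "\<bar>f n x3 - f N0 x3\<bar> < 1" "\<bar>f n x4 - f N0 x4\<bar> < 1"
      by (meson order_trans)
    have "\<bar>f N0 x1\<bar> \<le> B0" "\<bar>f N0 x2\<bar> \<le> B0" "\<bar>f N0 x3\<bar> \<le> B0" "\<bar>f N0 x4\<bar> \<le> B0"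
      using x r by (auto intro!: B0)
    moreover have "\<bar>f n x\<bar> \<le> B" if "\<bar>f N0 x\<bar> \<le> B0" "\<bar>f n x - f N0 x\<bar> < 1" for x
      using that unfolding B_def by linarith
    ultimately have "\<bar>f n x1\<bar> \<le> B" "\<bar>f n x2\<bar> \<le> B" "\<bar>f n x3\<bar> \<le> B" "\<bar>f n x4\<bar> \<le> B"
      using d by blast+
    then show ?thesis
      using x uv r
      by (intro convex_lipschitz_four_points[OF subgradient_selection_right_deriv[OF f],
          of x1 r x2 u v x3 x4]) auto
  qed
  have B: "0 < B" using B0[of t] r by (auto simp: B_def)
  show ?thesis
  proof (rule CauchyI)
    fix e :: real assume e: "0 < e"
    define s where "s = min r (e * r / (8 * B))"
    have s: "0 < s" "s \<le> r" using e r B by (auto simp: s_def)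
    have "2 * B / r * s \<le> 2 * B / r * (e * r / (8 * B))"
      using B r by (intro mult_left_mono) (auto simp: s_def)
    then have s4: "2 * B / r * s \<le> e / 4" using B r by simp
    obtain N5 where N5: "\<And>m n. N5 \<le> m \<Longrightarrow> N5 \<le> n \<Longrightarrow> \<exists>x\<in>{t..t + s}. \<bar>f m x - f n x\<bar> < e / 4"
      using close[of t "t + s" "e / 4"] s r t e by auto
    show "\<exists>M. \<forall>m\<ge>M. \<forall>n\<ge>M. norm (f m t - f n t) < e"
    proof (intro exI[of _ "max N0 N5"] allI impI)
      fix m n assume mn: "max N0 N5 \<le> m" "max N0 N5 \<le> n"
      then obtain x where x: "x \<in> {t..t + s}" "\<bar>f m x - f n x\<bar> < e / 4" using N5[of m n] by auto
      have "\<bar>f j x - f j t\<bar> \<le> e / 4" if "N0 \<le> j" for j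
      proof -
        have "\<bar>f j x - f j t\<bar> \<le> 2 * B / r * (x - t)" using that x s r by (intro lip) auto
        also have "\<dots> \<le> 2 * B / r * s" using x B r by (intro mult_left_mono) auto
        finally show ?thesis using s4 by linarith
      qed
      from this[of m] this[of n] have "\<bar>f m x - f m t\<bar> \<le> e / 4" "\<bar>f n x - f n t\<bar> \<le> e / 4"
        using mn by auto
      then have "\<bar>f m t - f n t\<bar> < e" using x(2) e by linarith
      then show "norm (f m t - f n t) < e" by simp
    qed
  qed
qed

lemma convex_on_pointwise_limit:
  fixes f :: "nat \<Rightarrow> real \<Rightarrow> real"
  assumes "\<And>n. convex_on {0<..<1} (f n)" "\<And>t. 0 < t \<Longrightarrow> t < 1 \<Longrightarrow> (\<lambda>n. f n t) \<longlonglongrightarrow> h t"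
  shows "convex_on {0<..<1} h"
proof (rule convex_onI)
  fix t x y :: real assume t: "0 < t" "t < 1" and xy: "x \<in> {0<..<1}" "y \<in> {0<..<1}"
  have c: "(1 - t) *\<^sub>R x + t *\<^sub>R y \<in> {0<..<1}"
    using convexD_alt[of "{0<..<1::real}" x y t] t xy by simp
  have "(\<lambda>n. (1 - t) * f n x + t * f n y) \<longlonglongrightarrow> (1 - t) * h x + t * h y"
    using xy by (intro tendsto_intros assms(2)) auto
  moreover have "(\<lambda>n. f n ((1 - t) *\<^sub>R x + t *\<^sub>R y)) \<longlonglongrightarrow> h ((1 - t) *\<^sub>R x + t *\<^sub>R y)"
    using c by (intro assms(2)) auto
  moreover have "f n ((1 - t) *\<^sub>R x + t *\<^sub>R y) \<le> (1 - t) * f n x + t * f n y" for n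
    using convex_onD[OF assms(1), of t x y n] t xy by simp
  ultimately show "h ((1 - t) *\<^sub>R x + t *\<^sub>R y) \<le> (1 - t) * h x + t * h y"
    by (intro LIMSEQ_le) auto
qed simp

text \<open>Convexity bounds the functions on \<open>[a,b]\<close> from above by the values at the end points, and
  from below by reflection at the midpoint.\<close>

lemma convex_pointwise_limit_bounded:
  fixes f :: "nat \<Rightarrow> real \<Rightarrow> real"
  assumes f: "\<And>n. convex_on {0<..<1} (f n)"
    and lim: "\<And>t. 0 < t \<Longrightarrow> t < 1 \<Longrightarrow> (\<lambda>n. f n t) \<longlonglongrightarrow> h t"
    and ab: "0 < a" "a \<le> b" "b < 1"
  obtains B where "\<And>n t. t \<in> {a..b} \<Longrightarrow> \<bar>f n t\<bar> \<le> B"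
proof -
  define c where "c = (a + b) / 2"
  have "\<exists>B. \<forall>n. \<bar>f n s\<bar> \<le> B" if "0 < s" "s < 1" for s
    using convergent_imp_Bseq[OF convergentI[OF lim[OF that]]] unfolding Bseq_def by auto
  from this[of a] this[of b] this[of c]
  obtain Ba Bb Bc where B: "\<And>n. \<bar>f n a\<bar> \<le> Ba" "\<And>n. \<bar>f n b\<bar> \<le> Bb" "\<And>n. \<bar>f n c\<bar> \<le> Bc"
    using ab by (auto simp: c_def)
  have up: "f n t \<le> max Ba Bb" if t: "t \<in> {a..b}" for n t
  proof -
    have "convex_on {a..b} (f n)" using ab by (intro convex_on_subset[OF f]) auto
    then have "f n t \<le> max (f n a) (f n b)" using t ab by (intro convex_on_le_max) auto
    also have "\<dots> \<le> max Ba Bb" using B(1)[of n] B(2)[of n] by (auto simp: max_def)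
    finally show ?thesis .
  qed
  have "\<bar>f n t\<bar> \<le> 2 * Bc + max Ba Bb + max Ba Bb" if t: "t \<in> {a..b}" for n t
  proof -
    have "a + b - t \<in> {a..b}" using t by auto
    moreover have "f n c \<le> (1 - 1/2) * f n t + 1/2 * f n (a + b - t)"
      using convex_onD[OF f, of "1/2" t "a + b - t" n] t ab by (simp add: c_def field_simps)
    ultimately have "2 * f n c - max Ba Bb \<le> f n t" using up[of "a + b - t" n] by simp
    moreover have "\<bar>f n a\<bar> \<le> max Ba Bb" "\<bar>f n c\<bar> \<le> Bc" using B(1)[of n] B(3)[of n] by auto
    ultimately show ?thesis using up[OF t, of n] by linarith
  qed
  then show thesis by (rule that)
qed

section \<open>Square-integrable functions on the open unit interval\<close>

abbreviation unit_measure :: "real measure" where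
  "unit_measure \<equiv> lebesgue_on {0<..<1}"

definition square_integrable :: "(real \<Rightarrow> real) \<Rightarrow> bool" where
  "square_integrable f \<longleftrightarrow> f \<in> borel_measurable unit_measure \<and> integrable unit_measure (\<lambda>t. (f t)\<^sup>2)"

lemma measurable_unit_continuous:
  fixes f :: "real \<Rightarrow> real"
  shows "continuous_on {0<..<1} f \<Longrightarrow> f \<in> borel_measurable unit_measure"
  by (rule continuous_imp_measurable_on_sets_lebesgue) auto

lemma finite_unit_measure: "finite_measure unit_measure"
  by (intro finite_measure_lebesgue_on) simp

lemma square_integrable_mult:
  assumes "square_integrable f" "square_integrable g"
  shows "integrable unit_measure (\<lambda>t. f t * g t)"
proof (rule Bochner_Integration.integrable_bound)
  show "integrable unit_measure (\<lambda>t. (f t)\<^sup>2 + (g t)\<^sup>2)"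
    using assms by (auto simp: square_integrable_def)
  show "(\<lambda>t. f t * g t) \<in> borel_measurable unit_measure"
    using assms by (auto simp: square_integrable_def)
  have "\<bar>x * y\<bar> \<le> x\<^sup>2 + y\<^sup>2" for x y :: real
  proof -
    have "2 * (\<bar>x\<bar> * \<bar>y\<bar>) \<le> x\<^sup>2 + y\<^sup>2" using sum_squares_bound[of "\<bar>x\<bar>" "\<bar>y\<bar>"] by (simp add: mult.assoc)
    moreover have "0 \<le> \<bar>x\<bar> * \<bar>y\<bar>" by simp
    ultimately show ?thesis unfolding abs_mult by linarith
  qed
  then show "AE t in unit_measure. norm (f t * g t) \<le> norm ((f t)\<^sup>2 + (g t)\<^sup>2)"
    by (intro AE_I2) (simp add: abs_of_nonneg)
qed

lemma square_integrable_add: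
  assumes "square_integrable f" "square_integrable g"
  shows "square_integrable (\<lambda>t. f t + g t)"
proof -
  have "integrable unit_measure (\<lambda>t. (f t)\<^sup>2 + (g t)\<^sup>2 + 2 * (f t * g t))"
    using assms square_integrable_mult[OF assms] by (auto simp: square_integrable_def)
  then show ?thesis
    using assms by (auto simp: square_integrable_def power2_sum mult.assoc)
qed

lemma square_integrable_cmult:
  assumes "square_integrable f"
  shows "square_integrable (\<lambda>t. c * f t)"
  using assms by (auto simp: square_integrable_def power_mult_distrib)

lemma square_integrable_diff:
  assumes "square_integrable f" "square_integrable g"
  shows "square_integrable (\<lambda>t. f t - g t)"
  using square_integrable_add[OF assms(1) square_integrable_cmult[OF assms(2), of "-1"]] by simp

lemma square_integrable_bounded:
  fixes f :: "real \<Rightarrow> real"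
  assumes "continuous_on {0<..<1} f" "\<And>t. 0 < t \<Longrightarrow> t < 1 \<Longrightarrow> \<bar>f t\<bar> \<le> B"
  shows "square_integrable f"
  unfolding square_integrable_def
proof
  show m: "f \<in> borel_measurable unit_measure" using assms by (intro measurable_unit_continuous)
  have "(f t)\<^sup>2 \<le> B\<^sup>2" if "0 < t" "t < 1" for t
    using assms(2)[OF that] by (simp add: abs_le_square_iff[symmetric] abs_of_nonneg order_trans[OF abs_ge_zero])
  then show "integrable unit_measure (\<lambda>t. (f t)\<^sup>2)"
    using m by (intro finite_measure.integrable_const_bound[OF finite_unit_measure, of _ "B\<^sup>2"])
      (auto intro!: AE_I2)
qed

lemma square_integrable_continuous:
  fixes f :: "real \<Rightarrow> real"
  assumes "continuous_on {0..1} f"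
  shows "square_integrable f"
proof -
  obtain B where "\<And>t. 0 \<le> t \<Longrightarrow> t \<le> 1 \<Longrightarrow> \<bar>f t\<bar> \<le> B" using continuous_on_unit_bounded[OF assms] by metis
  then show ?thesis
    by (intro square_integrable_bounded[of _ B] continuous_on_subset[OF assms]) auto
qed

lemma square_integrable_imp_integrable:
  assumes "square_integrable f"
  shows "integrable unit_measure f"
  using square_integrable_mult[OF assms square_integrable_continuous[of "\<lambda>_. 1"]] by simp

lemma integral_unit_measure:
  fixes f :: "real \<Rightarrow> real"
  assumes "integrable unit_measure f"
  shows "integral\<^sup>L unit_measure f = integral {0..1} f" "f integrable_on {0..1}"
  using lebesgue_integral_eq_integral[OF assms] integrable_on_lebesgue_on[OF assms]
  by (auto simp: integral_open_interval_real integrable_on_open_interval_real)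

section \<open>Projection onto the convex functions\<close>

definition L2_dist_sq :: "(real \<Rightarrow> real) \<Rightarrow> (real \<Rightarrow> real) \<Rightarrow> real" where
  "L2_dist_sq f g = integral\<^sup>L unit_measure (\<lambda>t. (f t - g t)\<^sup>2)"

lemma L2_dist_sq_integrable:
  "square_integrable f \<Longrightarrow> square_integrable g \<Longrightarrow> integrable unit_measure (\<lambda>t. (f t - g t)\<^sup>2)"
  using square_integrable_diff[of f g] by (simp add: square_integrable_def)

lemma L2_dist_sq_nonneg: "0 \<le> L2_dist_sq f g"
  by (simp add: L2_dist_sq_def)

lemma L2_parallelogram:
  assumes "square_integrable f" "square_integrable g" "square_integrable y"
  shows "L2_dist_sq f g =
    2 * L2_dist_sq f y + 2 * L2_dist_sq g y - 4 * L2_dist_sq (\<lambda>t. 1/2 * f t + 1/2 * g t) y"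
proof -
  note i = L2_dist_sq_integrable[OF assms(1,3)] L2_dist_sq_integrable[OF assms(2,3)]
    L2_dist_sq_integrable[OF square_integrable_add[OF square_integrable_cmult[OF assms(1)]
      square_integrable_cmult[OF assms(2)]] assms(3), of "1/2" "1/2"]
  have "L2_dist_sq f g = integral\<^sup>L unit_measure (\<lambda>t. 2 * (f t - y t)\<^sup>2 + 2 * (g t - y t)\<^sup>2
      - 4 * ((1/2 * f t + 1/2 * g t) - y t)\<^sup>2)"
    unfolding L2_dist_sq_def
    by (intro Bochner_Integration.integral_cong) (auto simp: power2_eq_square algebra_simps)
  also have "\<dots> = 2 * L2_dist_sq f y + 2 * L2_dist_sq g y - 4 * L2_dist_sq (\<lambda>t. 1/2 * f t + 1/2 * g t) y"
    unfolding L2_dist_sq_def using i by simp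
  finally show ?thesis .
qed

lemma integral_Icc_le_unit:
  fixes f :: "real \<Rightarrow> real"
  assumes "integrable unit_measure f" "\<And>t. 0 \<le> f t" "0 < a" "a \<le> b" "b < 1" "continuous_on {0<..<1} f"
  shows "integral {a..b} f \<le> integral\<^sup>L unit_measure f"
proof -
  have "integral {a..b} f \<le> integral {0..1} f"
    using assms(2-5)
    by (intro integral_subset_le integrable_continuous_unit[OF assms(6)]
        integral_unit_measure(2)[OF assms(1)]) auto
  then show ?thesis using integral_unit_measure[OF assms(1)] by simp
qed

text \<open>The squared distance from \<open>y\<close> is minimised along a sequence that is Cauchy in mean square
  by the parallelogram identity. For convex functions this gives pointwise convergence, and Fatou's
  lemma shows that the limit attains the minimum.\<close>

lemma convex_projection_exists:
  assumes y: "square_integrable y"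
  obtains h where "convex_on {0<..<1} h" "square_integrable h"
    "\<And>g. convex_on {0<..<1} g \<Longrightarrow> square_integrable g \<Longrightarrow> L2_dist_sq h y \<le> L2_dist_sq g y"
proof -
  define \<C> where "\<C> = {g. convex_on {0<..<1} g \<and> square_integrable g}"
  define J where "J g = L2_dist_sq g y" for g
  define d where "d = Inf (J ` \<C>)"
  have "(\<lambda>_. 0) \<in> \<C>"
    by (auto simp: \<C>_def convex_on_const intro: square_integrable_continuous)
  then have ne: "J ` \<C> \<noteq> {}" by blast
  have bdd: "bdd_below (J ` \<C>)" by (auto simp: J_def L2_dist_sq_nonneg intro!: bdd_belowI[of _ 0])
  have dle: "d \<le> J g" if "g \<in> \<C>" for g
    using that bdd by (auto simp: d_def intro: cInf_lower)
  have "\<exists>g\<in>\<C>. J g < d + 1 / real (Suc n)" for n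
    using cInf_lessD[OF ne, of "d + 1 / real (Suc n)"] by (auto simp: d_def)
  then obtain f where f: "\<And>n. f n \<in> \<C>" "\<And>n. J (f n) < d + 1 / real (Suc n)" by metis
  have fconv: "convex_on {0<..<1} (f n)" and fsq: "square_integrable (f n)" for n
    using f(1)[of n] by (auto simp: \<C>_def)
  have dist: "L2_dist_sq (f m) (f n) < 2 / real (Suc m) + 2 / real (Suc n)" for m n
  proof -
    have "(\<lambda>t. 1/2 * f m t + 1/2 * f n t) \<in> \<C>"
      unfolding \<C>_def by (intro CollectI conjI convex_on_add convex_on_cmul
        square_integrable_add square_integrable_cmult fconv fsq) simp_all
    then have "d \<le> L2_dist_sq (\<lambda>t. 1/2 * f m t + 1/2 * f n t) y" using dle by (simp add: J_def)
    then show ?thesis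
      using f(2)[of m] f(2)[of n] unfolding L2_parallelogram[OF fsq fsq y, of m n] J_def by simp
  qed
  have "\<exists>N. \<forall>m\<ge>N. \<forall>n\<ge>N. integral {a..b} (\<lambda>t. (f m t - f n t)\<^sup>2) < e"
    if ab: "0 < a" "a \<le> b" "b < 1" "0 < e" for a b e :: real
  proof -
    obtain N where N: "4 / e < real (Suc N)" using reals_Archimedean2[of "4 / e"] less_trans
      by (metis lessI of_nat_less_iff)
    show ?thesis
    proof (intro exI allI impI)
      fix m n assume mn: "N \<le> m" "N \<le> n"
      have "integral {a..b} (\<lambda>t. (f m t - f n t)\<^sup>2) \<le> L2_dist_sq (f m) (f n)"
        unfolding L2_dist_sq_def using ab
        by (intro integral_Icc_le_unit L2_dist_sq_integrable fsq continuous_intros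
            convex_on_unit_continuous[OF fconv]) auto
      also have "\<dots> < 2 / real (Suc m) + 2 / real (Suc n)" by (rule dist)
      also have "\<dots> \<le> 2 / real (Suc N) + 2 / real (Suc N)"
        using mn by (intro add_mono divide_left_mono) auto
      also have "\<dots> = 4 / real (Suc N)" by (simp only: add_divide_distrib[symmetric]) simp
      also have "\<dots> < e" using N ab(4) by (simp only: pos_divide_less_eq of_nat_0_less_iff zero_less_Suc mult.commute)
      finally show "integral {a..b} (\<lambda>t. (f m t - f n t)\<^sup>2) < e" .
    qed
  qed
  then have "Cauchy (\<lambda>n. f n t)" if "0 < t" "t < 1" for t
    by (intro convex_L2_Cauchy_imp_Cauchy fconv that)
  then have "convergent (\<lambda>n. f n t)" if "0 < t" "t < 1" for t
    using that by (simp add: Cauchy_convergent_iff)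
  then have h: "(\<lambda>n. f n t) \<longlonglongrightarrow> lim (\<lambda>n. f n t)" if "0 < t" "t < 1" for t
    using that by (simp add: convergent_LIMSEQ_iff)
  define h where "h t = lim (\<lambda>n. f n t)" for t
  note h = h[folded h_def]
  have hconv: "convex_on {0<..<1} h" using convex_on_pointwise_limit[OF fconv h] .
  have ym: "y \<in> borel_measurable unit_measure" and hm: "h \<in> borel_measurable unit_measure"
    and fm: "f n \<in> borel_measurable unit_measure" for n
    using y fsq measurable_unit_continuous[OF convex_on_unit_continuous[OF hconv]]
    by (auto simp: square_integrable_def)
  have "(\<integral>\<^sup>+t. ennreal ((h t - y t)\<^sup>2) \<partial>unit_measure) =
      (\<integral>\<^sup>+t. liminf (\<lambda>n. ennreal ((f n t - y t)\<^sup>2)) \<partial>unit_measure)"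
  proof (rule nn_integral_cong)
    fix t assume "t \<in> space unit_measure"
    then have "(\<lambda>n. ennreal ((f n t - y t)\<^sup>2)) \<longlonglongrightarrow> ennreal ((h t - y t)\<^sup>2)"
      by (intro tendsto_intros h) auto
    then show "ennreal ((h t - y t)\<^sup>2) = liminf (\<lambda>n. ennreal ((f n t - y t)\<^sup>2))"
      by (rule lim_imp_Liminf[OF trivial_limit_sequentially, symmetric])
  qed
  also have "\<dots> \<le> liminf (\<lambda>n. \<integral>\<^sup>+t. ennreal ((f n t - y t)\<^sup>2) \<partial>unit_measure)"
    using ym fm by (intro nn_integral_liminf) auto
  also have "\<dots> = liminf (\<lambda>n. ennreal (J (f n)))"
    unfolding J_def L2_dist_sq_def
    by (simp add: nn_integral_eq_integral[OF L2_dist_sq_integrable[OF fsq y]])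
  also have "\<dots> = ennreal d"
  proof (rule lim_imp_Liminf)
    have "(\<lambda>n. J (f n)) \<longlonglongrightarrow> d"
    proof (rule tendsto_sandwich)
      show "eventually (\<lambda>n. d \<le> J (f n)) sequentially" using dle f by simp
      show "eventually (\<lambda>n. J (f n) \<le> d + 1 / real (Suc n)) sequentially"
        by (intro always_eventually allI less_imp_le f(2))
      show "(\<lambda>n. d + 1 / real (Suc n)) \<longlonglongrightarrow> d"
        using tendsto_add[OF tendsto_const LIMSEQ_Suc[OF lim_1_over_n]] by simp
    qed simp
    then show "(\<lambda>n. ennreal (J (f n))) \<longlonglongrightarrow> ennreal d" by (rule tendsto_ennrealI)
  qed simp
  finally have fatou: "(\<integral>\<^sup>+t. ennreal ((h t - y t)\<^sup>2) \<partial>unit_measure) \<le> ennreal d" .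
  have d0: "0 \<le> d" unfolding d_def using ne by (intro cInf_greatest) (auto simp: J_def L2_dist_sq_nonneg)
  have "integrable unit_measure (\<lambda>t. (h t - y t)\<^sup>2)"
    using fatou hm ym by (intro integrableI_bounded) (auto simp: abs_of_nonneg le_less_trans)
  then have hy: "square_integrable (\<lambda>t. h t - y t)" using hm ym by (simp add: square_integrable_def)
  then have hsq: "square_integrable h" using square_integrable_add[OF hy y] by simp
  have "L2_dist_sq h y \<le> d"
    using fatou d0 nn_integral_eq_integral[OF L2_dist_sq_integrable[OF hsq y]]
    by (simp add: L2_dist_sq_def)
  then show thesis
    using hconv hsq dle by (intro that[of h]) (auto simp: J_def \<C>_def intro: order_trans)
qed

lemma nonneg_of_quadratic:
  fixes p q :: real
  assumes "\<And>e. 0 < e \<Longrightarrow> e \<le> 1 \<Longrightarrow> 0 \<le> 2 * e * p + e\<^sup>2 * q" "0 \<le> q"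
  shows "0 \<le> p"
proof (rule ccontr)
  assume "\<not> 0 \<le> p"
  then have p: "p < 0" by simp
  define e where "e = min 1 (- p / (q + 1))"
  have e: "0 < e" "e \<le> 1" using p assms(2) by (auto simp: e_def intro: divide_neg_pos)
  have "e * q \<le> - p / (q + 1) * q" using assms(2) by (intro mult_right_mono) (auto simp: e_def)
  also have "\<dots> \<le> - p" using p assms(2) by (simp add: field_simps)
  finally have "e * (2 * p + e * q) < 0" using p e by (intro mult_pos_neg) auto
  then show False using assms(1)[OF e] by (simp add: power2_eq_square algebra_simps)
qed

text \<open>The first variation of the squared distance at the minimum, in a direction in which one can move
  within the convex functions.\<close>

lemma convex_projection_variational:
  assumes h: "square_integrable h" and y: "square_integrable y"
    and min: "\<And>g. convex_on {0<..<1} g \<Longrightarrow> square_integrable g \<Longrightarrow> L2_dist_sq h y \<le> L2_dist_sq g y"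
    and g: "square_integrable g"
    and conv: "\<And>e. 0 < e \<Longrightarrow> e \<le> 1 \<Longrightarrow> convex_on {0<..<1} (\<lambda>t. h t + e * g t)"
  shows "0 \<le> integral\<^sup>L unit_measure (\<lambda>t. (h t - y t) * g t)"
proof (rule nonneg_of_quadratic)
  fix e :: real assume e: "0 < e" "e \<le> 1"
  have hy: "square_integrable (\<lambda>t. h t - y t)" using h y by (rule square_integrable_diff)
  have i: "integrable unit_measure (\<lambda>t. (h t - y t)\<^sup>2)" "integrable unit_measure (\<lambda>t. (h t - y t) * g t)"
    "integrable unit_measure (\<lambda>t. (g t)\<^sup>2)"
    using L2_dist_sq_integrable[OF h y] square_integrable_mult[OF hy g] g
    by (auto simp: square_integrable_def)
  have "L2_dist_sq (\<lambda>t. h t + e * g t) y =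
      integral\<^sup>L unit_measure (\<lambda>t. (h t - y t)\<^sup>2 + 2 * e * ((h t - y t) * g t) + e\<^sup>2 * (g t)\<^sup>2)"
    unfolding L2_dist_sq_def
    by (intro Bochner_Integration.integral_cong) (auto simp: power2_eq_square algebra_simps)
  also have "\<dots> = L2_dist_sq h y + 2 * e * integral\<^sup>L unit_measure (\<lambda>t. (h t - y t) * g t)
      + e\<^sup>2 * integral\<^sup>L unit_measure (\<lambda>t. (g t)\<^sup>2)"
    unfolding L2_dist_sq_def using i by simp
  finally show "0 \<le> 2 * e * integral\<^sup>L unit_measure (\<lambda>t. (h t - y t) * g t)
      + e\<^sup>2 * integral\<^sup>L unit_measure (\<lambda>t. (g t)\<^sup>2)"
    using min[OF conv[OF e] square_integrable_add[OF h square_integrable_cmult[OF g]]] by simp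
qed simp

section \<open>Existence for smooth paths\<close>

text \<open>Slopes increase across \<open>c\<close>, since the subgradient inequality at \<open>c\<close> holds on both sides.\<close>

lemma subgradient_glue:
  fixes g k :: "real \<Rightarrow> real"
  assumes left: "\<And>x t. x \<in> S \<Longrightarrow> t \<in> S \<Longrightarrow> x \<le> c \<Longrightarrow> t \<le> c \<Longrightarrow> g x + k x * (t - x) \<le> g t"
    and right: "\<And>x t. x \<in> S \<Longrightarrow> t \<in> S \<Longrightarrow> c \<le> x \<Longrightarrow> c \<le> t \<Longrightarrow> g x + k x * (t - x) \<le> g t"
    and c: "c \<in> S" and xt: "x \<in> S" "t \<in> S"
  shows "g x + k x * (t - x) \<le> g t"
proof -
  have mono: "k u \<le> k v" if "g u + k u * (v - u) \<le> g v" "g v + k v * (u - v) \<le> g u" "u < v" for u v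
  proof -
    have "k u * (v - u) \<le> k v * (v - u)" using that by (simp add: algebra_simps)
    then show ?thesis using that by simp
  qed
  consider "x \<le> c" "t \<le> c" | "c \<le> x" "c \<le> t" | "x < c" "c < t" | "t < c" "c < x" by linarith
  then show ?thesis
  proof cases
    case 3
    have "g x + k x * (c - x) \<le> g c" "g c + k c * (t - c) \<le> g t" "g c + k c * (x - c) \<le> g x"
      using 3 xt c left[of x c] right[of c t] left[of c x] by auto
    moreover from this have "k x * (t - c) \<le> k c * (t - c)"
      using 3 by (intro mult_right_mono mono) auto
    ultimately show ?thesis by (simp add: algebra_simps)
  next
    case 4
    have "g x + k x * (c - x) \<le> g c" "g c + k c * (t - c) \<le> g t" "g c + k c * (x - c) \<le> g x"
      using 4 xt c right[of x c] left[of c t] right[of c x] by auto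
    moreover from this have "k c * (c - t) \<le> k x * (c - t)"
      using 4 by (intro mult_right_mono mono) auto
    ultimately show ?thesis by (simp add: algebra_simps)
  qed (use xt left right in auto)
qed

text \<open>The part of \<open>h\<close> whose second derivative, a measure, is that of \<open>h\<close> on \<open>(p,q]\<close> and 0 elsewhere.\<close>

definition convex_part :: "(real \<Rightarrow> real) \<Rightarrow> (real \<Rightarrow> real) \<Rightarrow> real \<Rightarrow> real \<Rightarrow> real \<Rightarrow> real" where
  "convex_part h k p q t =
     (if t \<le> p then 0
      else if t \<le> q then h t - h p - k p * (t - p)
      else h q - h p - k p * (q - p) + (k q - k p) * (t - q))"

text \<open>Removing a fraction of the curvature on \<open>[p,q]\<close> leaves a convex function. Hence minus
  that part is an admissible direction in the variational inequality, although it is not convex itself.\<close>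

lemma convex_diff_part:
  assumes k: "subgradient_selection h k" and pq: "0 < p" "p \<le> q" "q < 1" and e: "0 \<le> e" "e \<le> 1"
  shows "convex_on {0<..<1} (\<lambda>t. h t - e * convex_part h k p q t)"
proof -
  define g where "g t = h t - e * convex_part h k p q t" for t
  define l where "l t = k t - e * (if t \<le> p then 0 else if t \<le> q then k t - k p else k q - k p)" for t
  have sub: "h x + k x * (t - x) \<le> h t" if "x \<in> {0<..<1}" "t \<in> {0<..<1}" for x t
    using that subgradient_selectionD[OF k] by auto
  have left: "g x + l x * (t - x) \<le> g t" if "x \<in> {0<..<1}" "t \<in> {0<..<1}" "x \<le> p" "t \<le> p" for x t
    using sub[of x t] that by (simp add: g_def l_def convex_part_def)
  have mid: "g x + l x * (t - x) \<le> g t"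
    if xt: "x \<in> {0<..<1}" "t \<in> {0<..<1}" "x \<le> q" "t \<le> q" "p \<le> x" "p \<le> t" for x t
  proof -
    have gm: "g s = (1 - e) * h s + e * (h p + k p * (s - p))"
      and lm: "l s = (1 - e) * k s + e * k p" if "p \<le> s" "s \<le> q" for s
      using that by (auto simp: g_def l_def convex_part_def algebra_simps)
    have "(1 - e) * (h x + k x * (t - x)) \<le> (1 - e) * h t" using sub[OF xt(1,2)] e by (intro mult_left_mono) auto
    then show ?thesis using xt by (simp add: gm lm algebra_simps)
  qed
  have right: "g x + l x * (t - x) \<le> g t" if xt: "x \<in> {0<..<1}" "t \<in> {0<..<1}" "q \<le> x" "q \<le> t" for x t
  proof -
    have gm: "g s = h s - e * (h q - h p - k p * (q - p) + (k q - k p) * (s - q))"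
      and lm: "l s = k s - e * (k q - k p)" if "q \<le> s" for s
      using that pq by (auto simp: g_def l_def convex_part_def)
    show ?thesis using sub[OF xt(1,2)] xt by (simp add: gm lm algebra_simps)
  qed
  have "g x + l x * (t - x) \<le> g t" if xt: "x \<in> {0<..<1}" "t \<in> {0<..<1}" for x t
  proof (rule subgradient_glue[where S = "{0<..<1}" and c = q])
    fix x t :: real assume xt: "x \<in> {0<..<1}" "t \<in> {0<..<1}" "x \<le> q" "t \<le> q"
    show "g x + l x * (t - x) \<le> g t"
      by (rule subgradient_glue[where S = "{0<..<1} \<inter> {..q}" and c = p])
        (use left mid xt pq in auto)
  qed (use right xt pq in auto)
  then have "subgradient_selection g l" by (simp add: subgradient_selection_def)
  then show ?thesis unfolding g_def by (rule subgradient_selection_imp_convex)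
qed

lemma convex_part_continuous:
  assumes h: "continuous_on {0<..<1} h" and pq: "0 < p" "p \<le> q" "q < 1"
  shows "continuous_on {0<..<1} (convex_part h k p q)"
proof -
  have "convex_part h k p q = (\<lambda>t. h (max p (min q t)) - h p - k p * (max p (min q t) - p)
      + (k q - k p) * max 0 (t - q))"
    using pq by (intro ext) (auto simp: convex_part_def max_def min_def)
  moreover have "continuous_on {0<..<1} (\<lambda>t. h (max p (min q t)))"
    using pq by (intro continuous_on_compose2[OF h] continuous_intros) (auto simp: max_def min_def)
  ultimately show ?thesis by (auto intro!: continuous_intros)
qed

lemma convex_part_square_integrable:
  assumes h: "continuous_on {0<..<1} h" and pq: "0 < p" "p \<le> q" "q < 1"
  shows "square_integrable (convex_part h k p q)"
proof -
  have "bounded (h ` {p..q})"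
    using pq by (intro compact_imp_bounded compact_continuous_image continuous_on_subset[OF h]) auto
  then obtain B where B: "\<And>t. t \<in> {p..q} \<Longrightarrow> \<bar>h t\<bar> \<le> B" unfolding bounded_iff real_norm_def by blast
  have B0: "0 \<le> B" using B[of p] pq by simp
  have "\<bar>convex_part h k p q t\<bar> \<le> 2 * B + \<bar>k p\<bar> + \<bar>k q - k p\<bar>" if t: "0 < t" "t < 1" for t
  proof -
    have sm: "\<bar>c * x\<bar> \<le> \<bar>c\<bar>" if "0 \<le> x" "x \<le> 1" for c x :: real
      using that by (simp add: abs_mult mult_left_le)
    consider "t \<le> p" | "p < t" "t \<le> q" | "q < t" by linarith
    then show ?thesis
    proof cases
      case 1
      then show ?thesis using B0 by (simp add: convex_part_def)
    next
      case 2
      then have "\<bar>h t\<bar> \<le> B" "\<bar>h p\<bar> \<le> B" "\<bar>k p * (t - p)\<bar> \<le> \<bar>k p\<bar>" using pq t by (auto intro!: B sm)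
      then show ?thesis using 2 by (simp add: convex_part_def)
    next
      case 3
      then have "\<bar>h q\<bar> \<le> B" "\<bar>h p\<bar> \<le> B" "\<bar>k p * (q - p)\<bar> \<le> \<bar>k p\<bar>"
        "\<bar>(k q - k p) * (t - q)\<bar> \<le> \<bar>k q - k p\<bar>"
        using pq t by (auto intro!: B sm)
      then show ?thesis using 3 pq by (simp add: convex_part_def)
    qed
  qed
  then show ?thesis by (intro square_integrable_bounded convex_part_continuous h pq)
qed

lemma has_integral_FTC_continuous:
  fixes F :: "real \<Rightarrow> real"
  assumes "a \<le> b" "0 \<le> a" "b \<le> 1" "continuous_on {0..1} F"
    and "\<And>t. 0 < t \<Longrightarrow> t < 1 \<Longrightarrow> (F has_real_derivative f t) (at t)"
  shows "(f has_integral (F b - F a)) {a..b}"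
proof (rule fundamental_theorem_of_calculus_interior[OF assms(1)])
  show "continuous_on {a..b} F" using assms by (auto intro: continuous_on_subset)
  show "(F has_vector_derivative f t) (at t)" if "t \<in> {a<..<b}" for t
    using assms that by (auto simp: has_real_derivative_iff_has_vector_derivative[symmetric])
qed

text \<open>If \<open>X\<close> has a continuous derivative \<open>y\<close>, then the projection \<open>h\<close> of \<open>y\<close> onto the convex
  functions is the second derivative of the invelope. With \<open>D\<close> the second primitive of \<open>h - y\<close>,
  testing the variational inequality with \<open>\<plusminus>1\<close> and \<open>\<plusminus>t\<close> gives the conditions at the end point 1,
  testing with \<open>max 0 (t - s)\<close> gives \<open>D s \<ge> 0\<close>, and testing with minus the part of \<open>h\<close> that
  belongs to an interval with \<open>D > 0\<close> shows that \<open>h\<close> is affine there.\<close>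

lemma contact_invelope_exists_smooth:
  assumes XY: "clamped X Y"
    and y: "continuous_on {0..1} y" "\<And>t. t \<in> {0..1} \<Longrightarrow> (X has_real_derivative y t) (at t within {0..1})"
  shows "\<exists>H H1 H2. contact_invelope X Y H H1 H2"
proof -
  have X: "continuous_on {0..1} X" "X 0 = 0" "X 1 = 0"
    and Y: "\<forall>t\<in>{0..1}. (Y has_real_derivative X t) (at t within {0..1})" "Y 0 = 0" "Y 1 = 0"
    using XY by (auto simp: clamped_def primitive_on_unit_def)
  have ysq: "square_integrable y" using y(1) by (rule square_integrable_continuous)
  obtain h where h: "convex_on {0<..<1} h" and hsq: "square_integrable h"
    and min: "\<And>g. convex_on {0<..<1} g \<Longrightarrow> square_integrable g \<Longrightarrow> L2_dist_sq h y \<le> L2_dist_sq g y"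
    using convex_projection_exists[OF ysq] by metis
  obtain k where k: "subgradient_selection h k" using subgradient_selection_right_deriv[OF h] by blast
  note hc = convex_on_unit_continuous[OF h]
  define v where "v t = h t - y t" for t
  have vsq: "square_integrable v" unfolding v_def by (intro square_integrable_diff hsq ysq)
  have vc: "continuous_on {0<..<1} v"
    unfolding v_def by (intro continuous_intros hc continuous_on_subset[OF y(1)]) auto
  have test: "0 \<le> integral {0..1} (\<lambda>t. v t * g t)" "(\<lambda>t. v t * g t) integrable_on {0..1}"
    if g: "square_integrable g"
      and "\<And>e. 0 < e \<Longrightarrow> e \<le> 1 \<Longrightarrow> convex_on {0<..<1} (\<lambda>t. h t + e * g t)" for g
    using convex_projection_variational[OF hsq ysq min that]
      integral_unit_measure[OF square_integrable_mult[OF vsq g]]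
    by (simp_all add: v_def)
  have hint: "h integrable_on {0..1}"
    using integral_unit_measure(2)[OF square_integrable_imp_integrable[OF hsq]] .
  have prim: "((\<lambda>t. integral {0..t} f) has_real_derivative f t) (at t)"
    if "f integrable_on {0..1}" "continuous_on {0<..<1} f" "0 < t" "t < 1" for f and t :: real
  proof -
    have "((\<lambda>t. integral {0..t} f) has_vector_derivative f t) (at t within {0..1})"
      using integral_has_vector_derivative_continuous_at[of f 0 1 t "{}"] that
      by (simp add: continuous_on_eq_continuous_at continuous_at_imp_continuous_within)
    then show ?thesis using that at_within_Icc_at[of 0 t 1]
      by (simp add: has_real_derivative_iff_has_vector_derivative)
  qed
  define H1 where "H1 t = integral {0..t} h" for t
  define H where "H t = integral {0..t} H1" for t
  have H1c: "continuous_on {0..1} H1"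
    unfolding H1_def by (rule indefinite_integral_continuous_1[OF hint])
  have H1d: "(H1 has_real_derivative h t) (at t)" if "0 < t" "t < 1" for t
    unfolding H1_def by (rule prim[OF hint hc that])
  have Hd: "\<forall>t\<in>{0..1}. (H has_real_derivative H1 t) (at t within {0..1})"
    unfolding H_def has_real_derivative_iff_has_vector_derivative
    using integral_has_vector_derivative[OF H1c] by auto
  define D D1 where "D t = H t - Y t" and "D1 t = H1 t - X t" for t
  have D1c: "continuous_on {0..1} D1" unfolding D1_def by (intro continuous_intros H1c X)
  have Dd: "\<forall>t\<in>{0..1}. (D has_real_derivative D1 t) (at t within {0..1})"
    unfolding D_def D1_def using Hd Y(1) by (auto intro: DERIV_diff)
  have Dc: "continuous_on {0..1} D" using Dd by (auto intro: DERIV_continuous_on)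
  have Dd': "(D has_real_derivative D1 t) (at t)" if "0 < t" "t < 1" for t
    using has_derivative_interior[OF Dd that] .
  have D1d: "(D1 has_real_derivative v t) (at t)" if "0 < t" "t < 1" for t
    unfolding D1_def v_def using that y(2) has_derivative_interior[of X y t]
    by (intro DERIV_diff H1d) auto
  have D0: "D 0 = 0" "D1 0 = 0" using X Y by (simp_all add: D_def D1_def H_def H1_def)
  have by_parts: "((\<lambda>t. v t * (\<alpha> + \<beta> * t)) has_integral
      ((D1 b * (\<alpha> + \<beta> * b) - \<beta> * D b) - (D1 a * (\<alpha> + \<beta> * a) - \<beta> * D a))) {a..b}"
    if "0 \<le> a" "a \<le> b" "b \<le> 1" for a b \<alpha> \<beta> :: real
  proof (rule has_integral_FTC_continuous[where F = "\<lambda>t. D1 t * (\<alpha> + \<beta> * t) - \<beta> * D t"])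
    show "continuous_on {0..1} (\<lambda>t. D1 t * (\<alpha> + \<beta> * t) - \<beta> * D t)"
      by (intro continuous_intros D1c Dc)
    fix t :: real assume t: "0 < t" "t < 1"
    have [derivative_intros]: "(D has_real_derivative D1 t) (at t)" "(D1 has_real_derivative v t) (at t)"
      using Dd' D1d t by auto
    show "((\<lambda>t. D1 t * (\<alpha> + \<beta> * t) - \<beta> * D t) has_real_derivative v t * (\<alpha> + \<beta> * t)) (at t)"
      by (rule derivative_eq_intros refl | simp add: algebra_simps)+
  qed (use that in auto)
  have affine: "0 \<le> D1 1 * (\<alpha> + \<beta>) - \<beta> * D 1" for \<alpha> \<beta>
  proof -
    have "convex_on {0<..<1} (\<lambda>t. h t + e * (\<alpha> + \<beta> * t))" for e
    proof -
      have "convex_on {0<..<1} (\<lambda>t. h t - (- e * \<alpha> + - e * \<beta> * t))"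
        by (rule subgradient_selection_imp_convex[OF subgradient_selection_diff_affine[OF k]])
      then show ?thesis by (simp add: algebra_simps)
    qed
    then have "0 \<le> integral {0..1} (\<lambda>t. v t * (\<alpha> + \<beta> * t))"
      by (intro test square_integrable_continuous continuous_intros)
    also have "\<dots> = D1 1 * (\<alpha> + \<beta>) - \<beta> * D 1"
      using by_parts[of 0 1 \<alpha> \<beta>] D0 by (simp add: integral_unique)
    finally show ?thesis .
  qed
  have D1_1: "D1 1 = 0" using affine[of 1 0] affine[of "-1" 0] by simp
  have D_1: "D 1 = 0" using affine[of 0 1] affine[of 0 "-1"] D1_1 by simp
  have D_nonneg: "0 \<le> D s" if s: "s \<in> {0..1}" for s
  proof -
    have ramp: "convex_on {0<..<1} (\<lambda>t. max 0 (t - s))"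
      by (rule subgradient_selection_imp_convex[where k = "\<lambda>t. if t \<le> s then 0 else 1"])
        (auto simp: subgradient_selection_def)
    have "0 \<le> integral {0..1} (\<lambda>t. v t * max 0 (t - s))"
      by (intro test square_integrable_continuous continuous_intros convex_on_add h convex_on_cmul ramp) simp
    also have "\<dots> = D s"
    proof (rule integral_unique)
      have "((\<lambda>t. v t * max 0 (t - s)) has_integral 0) {0..s}"
        by (rule has_integral_is_0) auto
      moreover have "((\<lambda>t. v t * max 0 (t - s)) has_integral D s) {s..1}"
        by (rule has_integral_eq[rotated], rule has_integral_eq_rhs[OF by_parts[of s 1 "- s" 1]])
          (use s D_1 D1_1 in auto)
      ultimately show "((\<lambda>t. v t * max 0 (t - s)) has_integral D s) {0..1}"
        using has_integral_combine[of 0 s 1 "\<lambda>t. v t * max 0 (t - s)" 0 "D s"] s by auto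
    qed
    finally show ?thesis .
  qed
  have contact: "k p = k q" if pq: "0 < p" "p \<le> q" "q < 1" "\<And>t. t \<in> {p..q} \<Longrightarrow> 0 < D t" for p q
  proof -
    let ?g = "convex_part h k p q"
    \<comment> \<open>The constant term of the affine function \<open>?g\<close> on \<open>[q,1]\<close>.\<close>
    define \<alpha> where "\<alpha> = h q - h p - k p * (q - p) - (k q - k p) * q"
    have gsq: "square_integrable (\<lambda>t. -1 * ?g t)"
      by (intro square_integrable_cmult convex_part_square_integrable hc pq)
    have t: "0 \<le> integral {0..1} (\<lambda>t. v t * (-1 * ?g t))" "(\<lambda>t. v t * (-1 * ?g t)) integrable_on {0..1}"
      using test[OF gsq] convex_diff_part[OF k pq(1-3)] by auto
    have DC: "C2_on_unit D D1 v" using Dd' D1d vc by (auto simp: C2_on_unit_def)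
    have vh: "(\<lambda>t. v t * h t) integrable_on {p..q}"
      using pq by (intro integrable_continuous_unit continuous_intros vc hc) auto
    have 1: "((\<lambda>t. v t * ?g t) has_integral 0) {0..p}"
      by (rule has_integral_is_0) (auto simp: convex_part_def)
    have 2: "((\<lambda>t. v t * ?g t) has_integral
        integral {p..q} (\<lambda>t. v t * h t)
        - ((D1 q * ((h p - k p * p) + k p * q) - k p * D q) - (D1 p * ((h p - k p * p) + k p * p) - k p * D p)))
        {p..q}"
    proof (rule has_integral_eq[OF _ has_integral_diff[OF integrable_integral[OF vh]
            by_parts[of p q "h p - k p * p" "k p"]]])
      show "v t * h t - v t * ((h p - k p * p) + k p * t) = v t * ?g t" if "t \<in> {p..q}" for t
        using that by (auto simp: convex_part_def algebra_simps)
    qed (use pq in auto)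
    have 3: "((\<lambda>t. v t * ?g t) has_integral (- (D1 q * (\<alpha> + (k q - k p) * q) - (k q - k p) * D q))) {q..1}"
      by (rule has_integral_eq[rotated], rule has_integral_eq_rhs[OF by_parts[of q 1 \<alpha> "k q - k p"]])
        (use pq D_1 D1_1 in \<open>auto simp: convex_part_def \<alpha>_def algebra_simps\<close>)
    have "((\<lambda>t. v t * ?g t) has_integral integral_dk h k D D1 v p q) {0..1}"
      using has_integral_combine[OF _ _ has_integral_combine[OF _ _ 1 2] 3] pq
      by (simp add: integral_dk_def \<alpha>_def algebra_simps)
    then have "integral {0..1} (\<lambda>t. v t * (-1 * ?g t)) = - integral_dk h k D D1 v p q"
      by (simp add: integral_unique)
    with t have le0: "integral_dk h k D D1 v p q \<le> 0" by simp
    have "\<exists>x\<in>{p..q}. \<forall>t\<in>{p..q}. D x \<le> D t"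
      using pq by (intro continuous_attains_inf continuous_on_subset[OF Dc]) auto
    then obtain m where m: "0 < m" "\<And>t. t \<in> {p..q} \<Longrightarrow> m \<le> D t" using pq(4) by blast
    have "integral_dk h k (\<lambda>_. m) (\<lambda>_. 0) (\<lambda>_. 0) p q \<le> integral_dk h k D D1 v p q"
      by (rule integral_dk_mono[OF k _ DC pq(1-3), where Z = UNIV])
        (use m in \<open>auto simp: C2_on_unit_def\<close>)
    then have "m * (k q - k p) \<le> 0" using le0 by (simp add: integral_dk_def algebra_simps)
    moreover have "0 \<le> k q - k p" using subgradient_selection_mono[OF k pq(1-3)] by simp
    ultimately show ?thesis using m(1) by (auto simp: mult_le_0_iff)
  qed
  have "contact_invelope X Y H H1 h"
    unfolding contact_invelope_def
  proof (intro conjI ballI allI impI)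
    show "Y t \<le> H t" if "t \<in> {0..1}" for t using D_nonneg[OF that] by (simp add: D_def)
    show "H 0 = Y 0" "H1 0 = X 0" "H 1 = Y 1" "H1 1 = X 1"
      using D0 D_1 D1_1 by (auto simp: D_def D1_def)
    fix x z :: real assume xz: "0 < x" "x < z" "z < 1" "\<forall>t\<in>{x..z}. Y t < H t"
    then have "k x = k z" by (intro contact) (auto simp: D_def)
    then have "h t = (h x - k x * x) + k x * t" if "t \<in> {x..z}" for t
      using subgradient_selection_const_imp_affine[OF k, of x z t] xz that by (simp add: algebra_simps)
    then show "\<exists>a b. \<forall>t\<in>{x..z}. h t = a + b * t" by blast
  qed (use Hd H1c H1d h in auto)
  then show ?thesis by blast
qed

section \<open>Existence for continuous paths\<close>

text \<open>At a point of contact the nonnegative function \<open>H - Y\<close> has a minimum.\<close>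

lemma contact_derivative:
  assumes H: "contact_invelope X Y H H1 H2" and XY: "primitive_on_unit X Y"
    and z: "0 \<le> z" "z < 1" "H z = Y z"
  shows "H1 z = X z"
proof (cases "z = 0")
  case True
  then show ?thesis using contact_invelopeD(9)[OF H] by simp
next
  case False
  then have z': "0 < z" using z by simp
  have "((\<lambda>t. H t - Y t) has_real_derivative H1 z - X z) (at z)"
    using contact_invelopeD(5)[OF H z' z(2)] XY has_derivative_interior[of Y X z] z' z(2)
    by (auto simp: primitive_on_unit_def intro: DERIV_diff)
  moreover have "0 < min z (1 - z)" using z z' by simp
  moreover have "\<forall>y. \<bar>z - y\<bar> < min z (1 - z) \<longrightarrow> H z - Y z \<le> H y - Y y"
    using contact_invelopeD(4)[OF H] z by auto
  ultimately have "H1 z - X z = 0" by (rule DERIV_local_min)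
  then show ?thesis by simp
qed

lemma DERIV_increment_le:
  fixes f :: "real \<Rightarrow> real"
  assumes "x \<le> y" "continuous_on {x..y} f"
    and "\<And>s. x < s \<Longrightarrow> s < y \<Longrightarrow> (f has_real_derivative f' s) (at s)"
    and "\<And>s. x < s \<Longrightarrow> s < y \<Longrightarrow> f' s \<le> c"
  shows "f y - f x \<le> c * (y - x)"
proof -
  have "(f y - c * y) \<le> f x - c * x"
  proof (rule DERIV_nonpos_imp_decreasing_open[OF assms(1)])
    show "continuous_on {x..y} (\<lambda>s. f s - c * s)" by (intro continuous_intros assms)
    show "\<exists>d. ((\<lambda>s. f s - c * s) has_real_derivative d) (at s) \<and> d \<le> 0" if "x < s" "s < y" for s
      using assms(3,4)[OF that]
      by (intro exI[of _ "f' s - c"] conjI) (auto intro!: derivative_eq_intros)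
  qed
  then show ?thesis by (simp add: algebra_simps)
qed

text \<open>As \<open>H2\<close> is bounded below,
  \<open>H1 t + C * t\<close> is nondecreasing, and at the next point of contact \<open>H1\<close> equals \<open>X\<close>. If there is no
  contact in \<open>[t,\<delta>]\<close>, then \<open>H2\<close> is affine from the last point of contact before \<open>t\<close> up to \<open>\<delta>\<close>, and
  therefore bounded by its values on \<open>[\<delta>/2,\<delta>]\<close>.\<close>

lemma derivative_near_zero:
  assumes H: "contact_invelope X Y H H1 H2" and XY: "clamped X Y"
    and C: "\<And>s. 0 < s \<Longrightarrow> s \<le> \<delta> \<Longrightarrow> - C \<le> H2 s" "0 \<le> C"
    and B: "\<And>s. s \<in> {\<delta> / 2..\<delta>} \<Longrightarrow> \<bar>H2 s\<bar> \<le> B"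
    and \<epsilon>: "\<And>s. 0 \<le> s \<Longrightarrow> s \<le> \<delta> \<Longrightarrow> \<bar>X s\<bar> \<le> \<epsilon>"
    and \<delta>: "\<delta> < 1" and t: "0 < t" "t < \<delta> / 2"
  shows "\<bar>H1 t\<bar> \<le> \<epsilon> + C * \<delta> + 3 * B * t"
proof -
  note D = contact_invelopeD[OF H]
  have Z: "X 0 = 0" "Y 0 = 0" and Yc: "continuous_on {0..1} Y" and prim: "primitive_on_unit X Y"
    using XY by (auto simp: clamped_def primitive_on_unit_def intro: primitive_on_unit_continuous)
  have \<delta>0: "0 < \<delta>" using t by simp
  have B0: "0 \<le> B" using B[of \<delta>] \<delta>0 by simp
  have e0: "0 \<le> \<epsilon>" using \<epsilon>[of 0] \<delta>0 by simp
  have mono: "H1 x + C * x \<le> H1 y + C * y" if xy: "0 \<le> x" "x \<le> y" "y \<le> \<delta>" for x y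
  proof -
    have "- H1 y - - H1 x \<le> C * (y - x)"
    proof (rule DERIV_increment_le[where f' = "\<lambda>s. - H2 s"])
      show "continuous_on {x..y} (\<lambda>s. - H1 s)"
        using xy \<delta> by (intro continuous_intros continuous_on_subset[OF D(2)]) auto
      show "((\<lambda>s. - H1 s) has_real_derivative - H2 s) (at s)" if "x < s" "s < y" for s
        using that xy \<delta> by (intro DERIV_minus D(6)) auto
      show "- H2 s \<le> C" if "x < s" "s < y" for s
        using C(1)[of s] that xy by auto
    qed (use xy in auto)
    then show ?thesis by (simp add: algebra_simps)
  qed
  have "- (C * t) \<le> H1 t" using mono[of 0 t] D(9) Z t by simp
  moreover have "C * t \<le> C * \<delta>" using C t by (intro mult_left_mono) auto
  ultimately have lower: "- (C * \<delta>) \<le> H1 t" by linarith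
  have upper: "H1 t \<le> \<epsilon> + C * \<delta> + 3 * B * t"
  proof (cases "\<exists>z\<in>{t..\<delta>}. H z = Y z")
    case True
    then obtain z where z: "z \<in> {t..\<delta>}" "H z = Y z" by blast
    have "H1 z = X z" using z t \<delta> by (intro contact_derivative[OF H prim]) auto
    then have "H1 t + C * t \<le> \<epsilon> + C * \<delta>"
      using mono[of t z] \<epsilon>[of z] z t C(2) mult_left_mono[of z \<delta> C] by auto
    moreover have "0 \<le> C * t" "0 \<le> 3 * B * t" using C B0 t by auto
    ultimately show ?thesis by linarith
  next
    case False
    \<comment> \<open>The last point of contact before \<open>t\<close> exists since 0 is one.\<close>
    define S where "S = {s\<in>{0..t}. H s = Y s}"
    have "compact S"
    proof -
      have "closed {s\<in>{0..t}. H s - Y s = 0}"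
        using t \<delta> by (intro continuous_closed_preimage_constant continuous_intros
          continuous_on_subset[OF D(3)] continuous_on_subset[OF Yc]) auto
      moreover have "bounded S" unfolding S_def by (rule bounded_subset[OF bounded_closed_interval]) auto
      ultimately show ?thesis by (simp add: compact_eq_bounded_closed S_def)
    qed
    moreover have "0 \<in> S" using D(8) t by (simp add: S_def)
    ultimately obtain z where z: "z \<in> S" "\<And>s. s \<in> S \<Longrightarrow> s \<le> z"
      using compact_attains_sup[of S] by auto
    then have z': "0 \<le> z" "z \<le> t" "H z = Y z" by (auto simp: S_def)
    have gap: "Y s < H s" if s: "z < s" "s \<le> \<delta>" for s
    proof -
      have "H s \<noteq> Y s"
      proof (cases "s \<le> t")
        case True
        then show ?thesis using z(2)[of s] s z' by (auto simp: S_def)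
      next
        case F: False
        then show ?thesis using False s by auto
      qed
      then show ?thesis using D(4)[of s] s z' \<delta> by auto
    qed
    have bound: "H2 s \<le> 3 * B" if s: "z < s" "s < t" for s
    proof -
      have "\<exists>a b. \<forall>r\<in>{s..\<delta>}. H2 r = a + b * r"
        using s z' t \<delta> gap by (intro D(12)) auto
      then obtain a b where ab: "\<And>r. r \<in> {s..\<delta>} \<Longrightarrow> H2 r = a + b * r" by blast
      have h: "\<bar>a + b * (\<delta> / 2)\<bar> \<le> B" "\<bar>a + b * \<delta>\<bar> \<le> B"
        using B[of "\<delta> / 2"] B[of \<delta>] ab[of "\<delta> / 2"] ab[of \<delta>] s t \<delta>0 by auto
      have "\<bar>b\<bar> * (\<delta> / 2 - s) \<le> \<bar>b\<bar> * (\<delta> / 2)" using s z' by (intro mult_left_mono) auto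
      moreover have "\<bar>b\<bar> * (\<delta> / 2) = \<bar>(a + b * \<delta>) - (a + b * (\<delta> / 2))\<bar>"
        using \<delta>0 by (simp add: abs_mult[symmetric] algebra_simps abs_mult)
      moreover have "- b * (\<delta> / 2 - s) \<le> \<bar>b\<bar> * (\<delta> / 2 - s)"
        using s t by (intro mult_right_mono) auto
      ultimately have "- b * (\<delta> / 2 - s) \<le> 2 * B" using h by linarith
      moreover have "H2 s = (a + b * (\<delta> / 2)) + - b * (\<delta> / 2 - s)"
        using ab[of s] s t by (simp add: algebra_simps)
      ultimately show ?thesis using h by linarith
    qed
    have "H1 t - H1 z \<le> 3 * B * (t - z)"
      using z' t \<delta> bound
      by (intro DERIV_increment_le[where f' = H2] continuous_on_subset[OF D(2)] D(6)) auto
    also have "\<dots> \<le> 3 * B * t" using z' B0 by (intro mult_left_mono) auto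
    finally have "H1 t - H1 z \<le> 3 * B * t" .
    moreover have "H1 z = X z" using z' t \<delta> by (intro contact_derivative[OF H prim]) auto
    moreover have "X z \<le> \<epsilon>" using \<epsilon>[of z] z' t by auto
    moreover have "0 \<le> C * \<delta>" using C \<delta>0 by simp
    ultimately show ?thesis by linarith
  qed
  have "0 \<le> 3 * B * t" using B0 t by simp
  with lower upper e0 show ?thesis by linarith
qed

text \<open>Pointwise convergence bounds the convex functions \<open>Hs2 n\<close> on compact subintervals uniformly in
  \<open>n\<close>, so the bounds \<open>B\<close> and \<open>C\<close> of the previous lemma can be chosen for all \<open>n\<close> at once.\<close>

lemma derivatives_uniformly_small:
  fixes Hs2 :: "nat \<Rightarrow> real \<Rightarrow> real"
  assumes H: "\<And>n. contact_invelope (Xs n) (Ys n) (Hs n) (Hs1 n) (Hs2 n)" "\<And>n. clamped (Xs n) (Ys n)"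
    and X: "continuous_on {0..1} X" "X 0 = 0"
    and close: "\<And>n t. 0 \<le> t \<Longrightarrow> t \<le> 1 \<Longrightarrow> \<bar>Xs n t - X t\<bar> \<le> 1 / real (Suc n)"
    and lim: "\<And>t. 0 < t \<Longrightarrow> t < 1 \<Longrightarrow> (\<lambda>n. Hs2 n t) \<longlonglongrightarrow> h t"
    and \<eta>: "0 < \<eta>"
  shows "\<exists>\<delta>>0. \<delta> < 1 \<and> (\<exists>N. \<forall>n\<ge>N. \<forall>t. 0 < t \<longrightarrow> t < \<delta> \<longrightarrow> \<bar>Hs1 n t\<bar> \<le> \<eta>)"
proof -
  have conv: "convex_on {0<..<1} (Hs2 n)" for n using contact_invelopeD(7)[OF H(1)] .
  obtain B where B: "\<And>n t. t \<in> {1/4..1/2} \<Longrightarrow> \<bar>Hs2 n t\<bar> \<le> B"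
    using convex_pointwise_limit_bounded[OF conv lim, of "1/4" "1/2"] by auto
  have B0: "0 \<le> B" using B[of "1/2" 0] by simp
  have below: "- (3 * B) \<le> Hs2 n t" if t: "0 < t" "t \<le> 1/4" for n t
  proof -
    note k = subgradient_selection_right_deriv[OF conv, of n]
    let ?k = "right_deriv (Hs2 n) (1/4)"
    have "Hs2 n (1/4) + ?k * (1/2 - 1/4) \<le> Hs2 n (1/2)" "Hs2 n (1/4) + ?k * (t - 1/4) \<le> Hs2 n t"
      using subgradient_selectionD[OF k, of "1/4" "1/2"] subgradient_selectionD[OF k, of "1/4" t] t
      by auto
    moreover have "\<bar>Hs2 n (1/4)\<bar> \<le> B" "\<bar>Hs2 n (1/2)\<bar> \<le> B" by (auto intro!: B)
    ultimately have 1: "?k \<le> 8 * B" and 2: "- B + ?k * (t - 1/4) \<le> Hs2 n t" by auto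
    have "?k * (1/4 - t) \<le> 8 * B * (1/4 - t)" using 1 t by (intro mult_right_mono) auto
    also have "\<dots> \<le> 8 * B * (1/4)" using B0 t by (intro mult_left_mono) auto
    finally show ?thesis using 2 by (simp add: algebra_simps)
  qed
  have "(X \<longlongrightarrow> 0) (at_right 0)" using continuous_on_unit_at_right[OF X(1)] X(2) by simp
  then have "eventually (\<lambda>t. \<bar>X t\<bar> < \<eta> / 8) (at_right 0)"
    using order_tendstoD(2)[OF tendsto_rabs_zero, of X "at_right 0" "\<eta> / 8"] \<eta> by simp
  then obtain b where b: "0 < b" "\<And>t. 0 < t \<Longrightarrow> t < b \<Longrightarrow> \<bar>X t\<bar> < \<eta> / 8"
    by (auto simp: eventually_at_right[of 0 1])
  define \<delta> where "\<delta> = min (b / 2) (min (1/4) (\<eta> / (4 * (3 * B + 1))))"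
  have "0 < \<eta> / (4 * (3 * B + 1))" using \<eta> B0 by simp
  then have \<delta>: "0 < \<delta>" using b by (simp add: \<delta>_def)
  have "\<delta> \<le> b / 2" "\<delta> \<le> 1/4" by (simp_all only: \<delta>_def min.cobounded1 min.coboundedI2)
  with \<delta> b(1) have \<delta>: "0 < \<delta>" "\<delta> \<le> 1/4" "\<delta> < b" by auto
  have cancel: "x * (\<eta> / (4 * x)) = \<eta> / 4" if "0 < x" for x using that by simp
  have "3 * B * \<delta> \<le> (3 * B + 1) * \<delta>" using \<delta> by simp
  also have "\<dots> \<le> (3 * B + 1) * (\<eta> / (4 * (3 * B + 1)))"
    using B0 by (intro mult_left_mono) (auto simp: \<delta>_def)
  also have "\<dots> = \<eta> / 4" using B0 by (intro cancel) simp
  finally have C\<delta>: "3 * B * \<delta> \<le> \<eta> / 4" .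
  obtain B' where B': "\<And>n t. t \<in> {\<delta> / 2..\<delta>} \<Longrightarrow> \<bar>Hs2 n t\<bar> \<le> B'"
    using convex_pointwise_limit_bounded[OF conv lim, of "\<delta> / 2" \<delta>] \<delta> by auto
  have B'0: "0 \<le> B'" using B'[of \<delta> 0] \<delta> by simp
  obtain N where N: "8 / \<eta> < real (Suc N)" using reals_Archimedean2[of "8 / \<eta>"]
    by (metis less_trans lessI of_nat_less_iff)
  define \<delta>' where "\<delta>' = min (\<delta> / 2) (\<eta> / (4 * (3 * B' + 1)))"
  have \<delta>': "0 < \<delta>'" "\<delta>' < 1" using \<delta> \<eta> B'0 by (auto simp: \<delta>'_def)
  show ?thesis
  proof (intro exI[of _ \<delta>'] conjI exI[of _ N] allI impI \<delta>')
    fix n t assume n: "N \<le> n" and t: "0 < t" "t < \<delta>'"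
    have "1 / real (Suc n) \<le> 1 / real (Suc N)" using n by (intro divide_left_mono) auto
    also have "\<dots> \<le> \<eta> / 8" using N \<eta> by (simp add: field_simps)
    finally have n8: "1 / real (Suc n) \<le> \<eta> / 8" .
    have Xs: "\<bar>Xs n s\<bar> \<le> \<eta> / 4" if s: "0 \<le> s" "s \<le> \<delta>" for s
    proof -
      have "\<bar>X s\<bar> \<le> \<eta> / 8" using b(2)[of s] s \<delta> X(2) \<eta> by (cases "s = 0") auto
      moreover have "\<bar>Xs n s - X s\<bar> \<le> \<eta> / 8" using close[of s n] s \<delta> n8 by auto
      ultimately show ?thesis by linarith
    qed
    have "3 * B' * t \<le> (3 * B' + 1) * t" using t by simp
    also have "\<dots> \<le> (3 * B' + 1) * (\<eta> / (4 * (3 * B' + 1)))"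
      using B'0 t by (intro mult_left_mono) (auto simp: \<delta>'_def)
    also have "\<dots> = \<eta> / 4" using B'0 by (intro cancel) simp
    finally have "3 * B' * t \<le> \<eta> / 4" .
    moreover have "\<bar>Hs1 n t\<bar> \<le> \<eta> / 4 + 3 * B * \<delta> + 3 * B' * t"
      using t \<delta> B0 below[of _ n]
      by (intro derivative_near_zero[OF H(1)[of n] H(2)[of n] _ _ B' Xs]) (auto simp: \<delta>'_def)
    ultimately show "\<bar>Hs1 n t\<bar> \<le> \<eta>" using C\<delta> \<eta> by linarith
  qed
qed

text \<open>The derivatives converge pointwise inside the interval only, so a priori the derivative of the
  limit could jump at 0. The uniform smallness near 0 excludes this.\<close>

lemma limit_end_point:
  fixes Hs2 :: "nat \<Rightarrow> real \<Rightarrow> real"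
  assumes H: "\<And>n. contact_invelope (Xs n) (Ys n) (Hs n) (Hs1 n) (Hs2 n)" "\<And>n. clamped (Xs n) (Ys n)"
    and X: "continuous_on {0..1} X" "X 0 = 0"
    and close: "\<And>n t. 0 \<le> t \<Longrightarrow> t \<le> 1 \<Longrightarrow> \<bar>Xs n t - X t\<bar> \<le> 1 / real (Suc n)"
    and lim: "\<And>t. 0 < t \<Longrightarrow> t < 1 \<Longrightarrow> (\<lambda>n. Hs2 n t) \<longlonglongrightarrow> h t"
    and lim0: "\<And>t. 0 \<le> t \<Longrightarrow> t \<le> 1 \<Longrightarrow> (\<lambda>n. Hs n t) \<longlonglongrightarrow> H t"
    and lim1: "\<And>t. 0 < t \<Longrightarrow> t < 1 \<Longrightarrow> (\<lambda>n. Hs1 n t) \<longlonglongrightarrow> H1 t"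
  shows "(H1 \<longlongrightarrow> 0) (at_right 0)" "(H has_real_derivative 0) (at 0 within {0..1})"
proof -
  have small: "\<exists>\<delta>>0. \<delta> < 1 \<and> (\<exists>N. \<forall>n\<ge>N. \<forall>t. 0 < t \<longrightarrow> t < \<delta> \<longrightarrow> \<bar>Hs1 n t\<bar> \<le> e)"
    if "0 < e" for e
    by (rule derivatives_uniformly_small[OF H X close lim that])
  have Hs0: "Hs n 0 = 0" "Hs1 n 0 = 0" for n
    using contact_invelopeD(8,9)[OF H(1)[of n]] H(2)[of n] by (auto simp: clamped_def primitive_on_unit_def)
  have H0: "H 0 = 0" using lim0[of 0] Hs0 by (simp add: LIMSEQ_const_iff)
  have ev: "eventually (\<lambda>t. \<bar>H1 t\<bar> \<le> e \<and> \<bar>H t / t\<bar> \<le> e) (at_right 0)" if e: "0 < e" for e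
  proof -
    obtain \<delta> N where \<delta>: "0 < \<delta>" "\<delta> < 1"
      and N: "\<And>n t. N \<le> n \<Longrightarrow> 0 < t \<Longrightarrow> t < \<delta> \<Longrightarrow> \<bar>Hs1 n t\<bar> \<le> e"
      using small[OF e] by blast
    have "\<bar>H1 t\<bar> \<le> e \<and> \<bar>H t / t\<bar> \<le> e" if t: "0 < t" "t < \<delta>" for t
    proof
      have "(\<lambda>n. \<bar>Hs1 n t\<bar>) \<longlonglongrightarrow> \<bar>H1 t\<bar>" using t \<delta> by (intro tendsto_intros lim1) auto
      then show "\<bar>H1 t\<bar> \<le> e" using N t by (intro LIMSEQ_le_const2) auto
      have "(\<lambda>n. \<bar>Hs n t\<bar>) \<longlonglongrightarrow> \<bar>H t\<bar>" using t \<delta> by (intro tendsto_intros lim0) auto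
      moreover have "\<bar>Hs n t\<bar> \<le> e * t" if n: "N \<le> n" for n
      proof -
        have "norm (Hs n t - Hs n 0) \<le> e * norm (t - 0)"
        proof (rule field_differentiable_bound[of "{0..t}" "Hs n" "Hs1 n"])
          fix s assume s: "s \<in> {0..t}"
          have "(Hs n has_real_derivative Hs1 n s) (at s within {0..1})"
            using contact_invelopeD(1)[OF H(1)[of n]] s t \<delta> by auto
          then show "(Hs n has_field_derivative Hs1 n s) (at s within {0..t})"
            by (rule has_field_derivative_subset) (use t \<delta> in auto)
          show "norm (Hs1 n s) \<le> e" using N[OF n, of s] Hs0 s t e by (cases "s = 0") auto
        qed (use t in auto)
        then show ?thesis using Hs0 t by simp
      qed
      ultimately have "\<bar>H t\<bar> \<le> e * t" by (intro LIMSEQ_le_const2) auto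
      then show "\<bar>H t / t\<bar> \<le> e" using t by (simp add: field_simps)
    qed
    then show ?thesis using \<delta> by (auto simp: eventually_at_right[of 0 1])
  qed
  have zero: "(f \<longlongrightarrow> 0) (at_right 0)"
    if "\<And>e. 0 < e \<Longrightarrow> eventually (\<lambda>t. \<bar>f t\<bar> \<le> e) (at_right 0)" for f :: "real \<Rightarrow> real"
  proof (rule tendstoI)
    fix e :: real assume "0 < e"
    then have "eventually (\<lambda>t. \<bar>f t\<bar> \<le> e / 2) (at_right 0)" by (intro that) simp
    then show "eventually (\<lambda>t. dist (f t) 0 < e) (at_right 0)"
      by eventually_elim (use \<open>0 < e\<close> in \<open>simp add: dist_real_def\<close>)
  qed
  show "(H1 \<longlongrightarrow> 0) (at_right 0)"
    by (rule zero, drule ev, erule eventually_mono) blast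
  have "((\<lambda>t. H t / t) \<longlongrightarrow> 0) (at_right 0)"
    by (rule zero, drule ev, erule eventually_mono) blast
  then show "(H has_real_derivative 0) (at 0 within {0..1})"
    using H0 by (simp add: has_field_derivative_iff at_within_Icc_at_right)
qed

text \<open>Dominated convergence in Taylor's formula with base point \<open>a\<close>: pointwise convergence
  of the functions and of their second derivatives carries the first derivatives along.\<close>

lemma limit_interior:
  fixes Hs Hs1 Hs2 :: "nat \<Rightarrow> real \<Rightarrow> real"
  assumes d: "\<And>n. C2_on_unit (Hs n) (Hs1 n) (Hs2 n)"
    and conv: "\<And>n. convex_on {0<..<1} (Hs2 n)"
    and lim2: "\<And>t. 0 < t \<Longrightarrow> t < 1 \<Longrightarrow> (\<lambda>n. Hs2 n t) \<longlonglongrightarrow> h t"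
    and lim0: "\<And>t. 0 < t \<Longrightarrow> t < 1 \<Longrightarrow> (\<lambda>n. Hs n t) \<longlonglongrightarrow> H t"
    and ab: "0 < a" "a < b" "b < 1"
  obtains K where "\<And>t. t \<in> {a..b} \<Longrightarrow> (\<lambda>n. Hs1 n t) \<longlonglongrightarrow> K t"
    "\<And>t. a < t \<Longrightarrow> t < b \<Longrightarrow> (H has_real_derivative K t) (at t)"
    "\<And>t. a < t \<Longrightarrow> t < b \<Longrightarrow> (K has_real_derivative h t) (at t)"
proof -
  note D = C2_on_unitD[OF d]
  have hconv: "convex_on {0<..<1} h" using convex_on_pointwise_limit[OF conv lim2] .
  have hc: "continuous_on {a..b} h"
    using ab by (intro continuous_on_subset[OF convex_on_unit_continuous[OF hconv]]) auto
  obtain B where B: "\<And>n t. t \<in> {a..b} \<Longrightarrow> \<bar>Hs2 n t\<bar> \<le> B"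
    using convex_pointwise_limit_bounded[OF conv lim2, of a b] ab by auto
  have int1: "(Hs2 n has_integral (Hs1 n t - Hs1 n a)) {a..t}" if "t \<in> {a..b}" for n t
    using that ab by (intro has_integral_FTC_unit D) auto
  define I where "I t = integral {a..t} h" for t
  have I: "(\<lambda>n. Hs1 n t - Hs1 n a) \<longlonglongrightarrow> I t" if t: "t \<in> {a..b}" for t
  proof -
    have "(\<lambda>n. integral {a..t} (Hs2 n)) \<longlonglongrightarrow> integral {a..t} h"
    proof (rule dominated_convergence(2)[where h = "\<lambda>_. B"])
      show "Hs2 n integrable_on {a..t}" for n using int1[OF t] by (rule has_integral_integrable)
      show "norm (Hs2 n s) \<le> B" if "s \<in> {a..t}" for n s using B[of s n] that t by auto
      show "(\<lambda>n. Hs2 n s) \<longlonglongrightarrow> h s" if "s \<in> {a..t}" for s using that t ab by (intro lim2) auto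
    qed auto
    then show ?thesis by (simp add: integral_unique[OF int1[OF t]] I_def)
  qed
  have Ib: "\<bar>Hs1 n t - Hs1 n a\<bar> \<le> B * (b - a)" if t: "t \<in> {a..b}" for n t
  proof -
    have "0 \<le> B" using B[OF t, of n] by linarith
    have "norm (Hs1 n t - Hs1 n a) \<le> B * measure lborel (cbox a t)"
      using B t int1[OF t, of n] \<open>0 \<le> B\<close>
      by (intro has_integral_bound[of B "Hs2 n"]) (auto simp: cbox_interval)
    also have "\<dots> \<le> B * (b - a)" using t \<open>0 \<le> B\<close> by (intro mult_left_mono) auto
    finally show ?thesis by simp
  qed
  have int2: "((\<lambda>t. Hs1 n t - Hs1 n a) has_integral (Hs n t - Hs n a - Hs1 n a * (t - a))) {a..t}"
    if "t \<in> {a..b}" for n t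
  proof -
    have "((\<lambda>t. Hs1 n t - Hs1 n a) has_integral
        ((Hs n t - Hs1 n a * t) - (Hs n a - Hs1 n a * a))) {a..t}"
      using that ab by (intro has_integral_FTC_unit) (auto intro!: derivative_eq_intros D)
    then show ?thesis by (simp add: algebra_simps)
  qed
  have Ic: "continuous_on {a..b} I"
    unfolding I_def by (intro indefinite_integral_continuous_1 integrable_continuous_real hc)
  define J where "J t = integral {a..t} I" for t
  have J: "(\<lambda>n. Hs n t - Hs n a - Hs1 n a * (t - a)) \<longlonglongrightarrow> J t" if t: "t \<in> {a..b}" for t
  proof -
    have "(\<lambda>n. integral {a..t} (\<lambda>s. Hs1 n s - Hs1 n a)) \<longlonglongrightarrow> integral {a..t} I"
    proof (rule dominated_convergence(2)[where h = "\<lambda>_. B * (b - a)"])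
      show "(\<lambda>s. Hs1 n s - Hs1 n a) integrable_on {a..t}" for n
        using int2[OF t] by (rule has_integral_integrable)
      show "norm (Hs1 n s - Hs1 n a) \<le> B * (b - a)" if "s \<in> {a..t}" for n s
        using Ib[of s n] that t by auto
      show "(\<lambda>n. Hs1 n s - Hs1 n a) \<longlonglongrightarrow> I s" if "s \<in> {a..t}" for s
        using that t by (intro I) auto
    qed auto
    then show ?thesis by (simp add: integral_unique[OF int2[OF t]] J_def)
  qed
  define A where "A = (H b - H a - J b) / (b - a)"
  have A: "(\<lambda>n. Hs1 n a) \<longlonglongrightarrow> A"
  proof -
    have "(\<lambda>n. (Hs n b - Hs n a - (Hs n b - Hs n a - Hs1 n a * (b - a))) / (b - a)) \<longlonglongrightarrow> A"
      unfolding A_def using ab by (intro tendsto_intros lim0 J) auto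
    then show ?thesis using ab by simp
  qed
  have Hform: "H t = H a + A * (t - a) + J t" if t: "t \<in> {a..b}" for t
  proof (rule LIMSEQ_unique)
    show "(\<lambda>n. Hs n t) \<longlonglongrightarrow> H t" using t ab by (intro lim0) auto
    have "(\<lambda>n. Hs n a + Hs1 n a * (t - a) + (Hs n t - Hs n a - Hs1 n a * (t - a))) \<longlonglongrightarrow>
        H a + A * (t - a) + J t"
      using t ab by (intro tendsto_intros lim0 A J) auto
    then show "(\<lambda>n. Hs n t) \<longlonglongrightarrow> H a + A * (t - a) + J t" by simp
  qed
  have prim: "((\<lambda>t. integral {a..t} f) has_real_derivative f t) (at t)"
    if "continuous_on {a..b} f" "a < t" "t < b" for f t
    using integral_has_real_derivative[OF that(1), of t] that at_within_Icc_at[of a t b] by simp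
  show thesis
  proof (rule that[of "\<lambda>t. A + I t"])
    show "(\<lambda>n. Hs1 n t) \<longlonglongrightarrow> A + I t" if "t \<in> {a..b}" for t
      using tendsto_add[OF A I[OF that]] by simp
    fix t assume t: "a < t" "t < b"
    have "((\<lambda>t. H a + A * (t - a) + J t) has_real_derivative A + I t) (at t)"
      using prim[OF Ic t] unfolding J_def by (auto intro!: derivative_eq_intros)
    then show "(H has_real_derivative A + I t) (at t)"
    proof (rule has_field_derivative_transform_within_open[where S = "{a<..<b}"])
      show "H a + A * (s - a) + J s = H s" if "s \<in> {a<..<b}" for s using Hform[of s] that by simp
    qed (use t in auto)
    show "((\<lambda>t. A + I t) has_real_derivative h t) (at t)"
      using prim[OF hc t] unfolding I_def by (auto intro!: derivative_eq_intros)
  qed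
qed

text \<open>By stability the functions \<open>Hs n\<close> are uniformly Cauchy and their second derivatives are Cauchy
  in mean square on compact subintervals. The local form of the complementarity condition passes to the
  limit: if \<open>H > Y\<close> on a compact interval, then \<open>Hs n > Ys n\<close> there for all large \<open>n\<close>.\<close>

lemma contact_invelope_limit:
  assumes H: "\<And>n. contact_invelope (Xs n) (Ys n) (Hs n) (Hs1 n) (Hs2 n)" "\<And>n. clamped (Xs n) (Ys n)"
    and XY: "clamped X Y"
    and close: "\<And>n t. 0 \<le> t \<Longrightarrow> t \<le> 1 \<Longrightarrow> \<bar>Xs n t - X t\<bar> \<le> 1 / real (Suc n)"
  shows "\<exists>H H1 H2. contact_invelope X Y H H1 H2"
proof -
  have X: "continuous_on {0..1} X" "X 0 = 0" "X 1 = 0" "primitive_on_unit X Y" "Y 0 = 0" "Y 1 = 0"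
    using XY by (auto simp: clamped_def primitive_on_unit_def)
  have Yc: "continuous_on {0..1} Y" using X(4) by (rule primitive_on_unit_continuous)
  have end0: "Hs n 0 = 0" "Hs1 n 0 = 0" "Hs n 1 = 0" "Hs1 n 1 = 0" for n
    using contact_invelopeD(8-11)[OF H(1)[of n]] H(2)[of n] by (auto simp: clamped_def primitive_on_unit_def)
  obtain c0 where c0: "0 < c0" "\<And>t. 0 \<le> t \<Longrightarrow> t \<le> 1 \<Longrightarrow> \<bar>X t\<bar> \<le> c0"
    using continuous_on_unit_bounded[OF X(1)] by metis
  \<comment> \<open>A common bound for all the paths, as each of them is within distance 1 of \<open>X\<close>.\<close>
  define c where "c = c0 + 1"
  have c: "0 < c" "\<bar>Xs n t\<bar> \<le> c" if "0 \<le> t" "t \<le> 1" for n t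
  proof -
    have "1 / real (Suc n) \<le> 1" by simp
    then show "0 < c" "\<bar>Xs n t\<bar> \<le> c"
      using close[OF that, of n] c0(2)[OF that] c0(1) unfolding c_def by linarith+
  qed
  have c': "0 < c" using c0 by (simp add: c_def)
  define d where "d m n = 1 / real (Suc m) + 1 / real (Suc n)" for m n
  have d: "0 < d m n" for m n by (simp add: d_def add_pos_pos)
  have dX: "\<bar>Xs m t - Xs n t\<bar> \<le> d m n" if "0 \<le> t" "t \<le> 1" for m n t
    using close[OF that, of m] close[OF that, of n] by (simp add: d_def abs_le_iff)
  have dsmall: "\<exists>N. \<forall>m\<ge>N. \<forall>n\<ge>N. d m n < e" if e: "0 < e" for e
  proof -
    obtain N where N: "2 / e < real (Suc N)" using reals_Archimedean2[of "2 / e"]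
      by (metis less_trans lessI of_nat_less_iff)
    show ?thesis
    proof (intro exI allI impI)
      fix m n assume "N \<le> m" "N \<le> n"
      then have "d m n \<le> 1 / real (Suc N) + 1 / real (Suc N)"
        unfolding d_def by (intro add_mono divide_left_mono) auto
      also have "\<dots> = 2 / real (Suc N)" by (simp only: add_divide_distrib[symmetric]) simp
      also have "\<dots> < e" using N e by (simp only: pos_divide_less_eq of_nat_0_less_iff zero_less_Suc mult.commute)
      finally show "d m n < e" .
    qed
  qed
  note stab = contact_invelope_stability[OF H(1) H(2) H(1) H(2) c' c(2) c(2) d dX]
  have conv: "convex_on {0<..<1} (Hs2 n)" for n using contact_invelopeD(7)[OF H(1)] .
  note C2 = C2_on_unit_contact_invelope[OF H(1)]
  have "\<exists>N. \<forall>m\<ge>N. \<forall>n\<ge>N. integral {a..b} (\<lambda>t. (Hs2 m t - Hs2 n t)\<^sup>2) < e"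
    if ab: "0 < a" "a \<le> b" "b < 1" and e: "0 < e" for a b e :: real
  proof -
    \<comment> \<open>A lower bound for the weight \<open>t * (1 - t)\<close> on \<open>[a,b]\<close>.\<close>
    define w where "w = a * (1 - b)"
    have w: "0 < w" using ab by (simp add: w_def)
    obtain N where N: "\<And>m n. N \<le> m \<Longrightarrow> N \<le> n \<Longrightarrow> d m n < w * e / (1152 * c)"
      using dsmall[of "w * e / (1152 * c)"] w e c' by auto
    show ?thesis
    proof (intro exI allI impI)
      fix m n assume mn: "N \<le> m" "N \<le> n"
      have "w * integral {a..b} (\<lambda>t. (Hs2 m t - Hs2 n t)\<^sup>2) =
          integral {a..b} (\<lambda>t. w * (Hs2 m t - Hs2 n t)\<^sup>2)" by simp
      also have "\<dots> \<le> integral {a..b} (\<lambda>t. t * (1 - t) * (Hs2 m t - Hs2 n t)\<^sup>2)"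
      proof (intro integral_le integrable_continuous_unit continuous_intros
          convex_on_unit_continuous conv)
        fix t assume "t \<in> {a..b}"
        then have "w \<le> t * (1 - t)" unfolding w_def using ab by (intro mult_mono) auto
        then show "w * (Hs2 m t - Hs2 n t)\<^sup>2 \<le> t * (1 - t) * (Hs2 m t - Hs2 n t)\<^sup>2"
          by (intro mult_right_mono) auto
      qed (use ab in auto)
      also have "\<dots> \<le> 1152 * c * d m n" using ab by (intro stab(1)) auto
      also have "\<dots> < w * e" using N[OF mn] c' by (simp add: field_simps)
      finally show "integral {a..b} (\<lambda>t. (Hs2 m t - Hs2 n t)\<^sup>2) < e" using w by simp
    qed
  qed
  then have "Cauchy (\<lambda>n. Hs2 n t)" if "0 < t" "t < 1" for t
    by (intro convex_L2_Cauchy_imp_Cauchy conv that)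
  then have lim2: "(\<lambda>n. Hs2 n t) \<longlonglongrightarrow> lim (\<lambda>n. Hs2 n t)" if "0 < t" "t < 1" for t
    using that by (simp add: Cauchy_convergent_iff convergent_LIMSEQ_iff)
  define h where "h t = lim (\<lambda>n. Hs2 n t)" for t
  note lim2 = lim2[folded h_def]
  define L where "L = 288 * c + 1"
  have L: "0 < L" using c' by (simp add: L_def)
  have "uniformly_Cauchy_on {0..1} Hs"
  proof (rule uniformly_Cauchy_onI)
    fix e :: real assume e: "0 < e"
    obtain N where N: "\<And>m n. N \<le> m \<Longrightarrow> N \<le> n \<Longrightarrow> d m n < (e / L)\<^sup>2"
      using dsmall[of "(e / L)\<^sup>2"] e L by auto
    show "\<exists>M. \<forall>x\<in>{0..1}. \<forall>m\<ge>M. \<forall>n\<ge>M. dist (Hs m x) (Hs n x) < e"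
    proof (intro exI ballI allI impI)
      fix x m n assume x: "x \<in> {0..1::real}" and mn: "N \<le> m" "N \<le> n"
      have "\<bar>Hs m x - Hs n x\<bar> \<le> L * sqrt (d m n)" unfolding L_def using x by (intro stab(2)) auto
      also have "\<dots> < L * sqrt ((e / L)\<^sup>2)"
        by (intro mult_strict_left_mono real_sqrt_less_mono N mn L)
      also have "\<dots> = e" using e L by (simp add: real_sqrt_abs)
      finally show "dist (Hs m x) (Hs n x) < e" by (simp add: dist_real_def)
    qed
  qed
  then obtain H where unif: "uniform_limit {0..1} Hs H sequentially"
    using Cauchy_uniformly_convergent uniformly_convergent_on_def by blast
  have lim0: "(\<lambda>n. Hs n t) \<longlonglongrightarrow> H t" if "0 \<le> t" "t \<le> 1" for t
    using tendsto_uniform_limitI[OF unif] that by auto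
  define H1 where "H1 t = lim (\<lambda>n. Hs1 n t)" for t
  \<comment> \<open>Differentiability is a local property, so a compact neighbourhood of \<open>t\<close> suffices.\<close>
  have interior: "(\<lambda>n. Hs1 n t) \<longlonglongrightarrow> H1 t" "(H has_real_derivative H1 t) (at t)"
    "(H1 has_real_derivative h t) (at t)" if t: "0 < t" "t < 1" for t
  proof -
    define a b where "a = t / 2" and "b = (1 + t) / 2"
    have ab: "0 < a" "a < t" "t < b" "b < 1" using t by (auto simp: a_def b_def)
    obtain K where K: "\<And>s. s \<in> {a..b} \<Longrightarrow> (\<lambda>n. Hs1 n s) \<longlonglongrightarrow> K s"
      "\<And>s. a < s \<Longrightarrow> s < b \<Longrightarrow> (H has_real_derivative K s) (at s)"
      "\<And>s. a < s \<Longrightarrow> s < b \<Longrightarrow> (K has_real_derivative h s) (at s)"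
    proof (rule limit_interior[OF C2 conv lim2, of H a b])
    qed (use ab lim0 in auto)
    have KH: "K s = H1 s" if "s \<in> {a..b}" for s
      unfolding H1_def using K(1)[OF that] by (simp add: limI)
    show "(\<lambda>n. Hs1 n t) \<longlonglongrightarrow> H1 t" "(H has_real_derivative H1 t) (at t)"
      using K(1,2)[of t] KH[of t] ab by auto
    show "(H1 has_real_derivative h t) (at t)"
      by (rule has_field_derivative_transform_within_open[OF K(3), where S = "{a<..<b}"])
        (use KH ab in auto)
  qed
  have hconv: "convex_on {0<..<1} h" using convex_on_pointwise_limit[OF conv lim2] .
  have H_ends: "H 0 = 0" "H 1 = 0" "H1 0 = 0" "H1 1 = 0"
    using lim0[of 0] lim0[of 1] by (auto simp: end0 LIMSEQ_const_iff H1_def)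
  have left: "(H1 \<longlongrightarrow> 0) (at_right 0)" "(H has_real_derivative 0) (at 0 within {0..1})"
    using limit_end_point[OF H X(1,2) close lim2 lim0 interior(1)] by auto
  have right: "((\<lambda>t. - H1 (1 - t)) \<longlongrightarrow> 0) (at_right 0)"
    "((\<lambda>t. H (1 - t)) has_real_derivative 0) (at 0 within {0..1})"
  proof -
    have *: "\<bar>- Xs n (1 - t) - - X (1 - t)\<bar> \<le> 1 / real (Suc n)" if "0 \<le> t" "t \<le> 1" for n t
      using close[of "1 - t" n] that by simp
    have cX: "continuous_on {0..1} (\<lambda>t. - X (1 - t))"
      by (auto intro!: continuous_intros continuous_on_compose2[OF X(1)])
    show "((\<lambda>t. - H1 (1 - t)) \<longlongrightarrow> 0) (at_right 0)"
      "((\<lambda>t. H (1 - t)) has_real_derivative 0) (at 0 within {0..1})"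
      using limit_end_point[where h = "\<lambda>t. h (1 - t)" and H = "\<lambda>t. H (1 - t)"
          and ?H1.0 = "\<lambda>t. - H1 (1 - t)",
          OF contact_invelope_reflect[OF H(1)] clamped_reflect[OF H(2)] cX _ *
          lim2[of "1 - _"] lim0[of "1 - _"] tendsto_minus[OF interior(1)[of "1 - _"]]] X(3)
      by simp_all
  qed
  have right': "(H1 \<longlongrightarrow> 0) (at_left 1)"
  proof -
    have "filterlim (\<lambda>t::real. 1 - t) (at_right 0) (at_left 1)" by real_asymp
    from tendsto_minus[OF filterlim_compose[OF right(1) this]] show ?thesis by simp
  qed
  have der: "(H has_real_derivative H1 t) (at t within {0..1})" if t: "t \<in> {0..1}" for t
  proof -
    consider "t = 0" | "t = 1" | "0 < t" "t < 1" using t by fastforce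
    then show ?thesis
    proof cases
      case 2
      have "(\<lambda>s::real. 1 - s) ` {0..1} = {0..1}"
        by (rule set_eqI) (auto intro: image_eqI[of _ _ "1 - x" for x])
      then have "((\<lambda>t. H (1 - t)) has_real_derivative 0) (at (1 - 1) within (\<lambda>s::real. 1 - s) ` {0..1})"
        using right(2) by simp
      moreover have "((\<lambda>s. 1 - s) has_real_derivative -1) (at (1::real) within {0..1})"
        by (auto intro!: derivative_eq_intros)
      ultimately have "((\<lambda>t. H (1 - t)) \<circ> (\<lambda>s. 1 - s) has_real_derivative 0 * -1) (at 1 within {0..1})"
        by (rule DERIV_image_chain)
      then show ?thesis using 2 H_ends by (simp add: o_def)
    next
      case 3
      then show ?thesis by (intro has_field_derivative_at_within[OF interior(2)])
    qed (use left(2) H_ends in auto)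
  qed
  have Hc: "continuous_on {0..1} H" by (rule DERIV_continuous_on[OF der])
  have Ysd: "\<bar>Ys n t - Y t\<bar> \<le> 2 * (1 / real (Suc n))" if t: "0 \<le> t" "t \<le> 1" for n t
  proof -
    have "\<bar>Ys n t - Y t\<bar> \<le> 2 * (1 / real (Suc n)) * (t * (1 - t))"
      by (rule clamped_abs_le[OF clamped_diff[OF H(2) XY] close t])
    also have "\<dots> \<le> 2 * (1 / real (Suc n)) * 1"
      using t by (intro mult_left_mono mult_le_one) auto
    finally show ?thesis by simp
  qed
  have null: "(\<lambda>n. 2 * (1 / real (Suc n))) \<longlonglongrightarrow> 0"
    using tendsto_mult[OF tendsto_const[of 2] LIMSEQ_Suc[OF lim_1_over_n]] by simp
  have limY: "(\<lambda>n. Ys n t) \<longlonglongrightarrow> Y t" if t: "0 \<le> t" "t \<le> 1" for t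
    by (rule LIM_zero_cancel, rule tendsto_rabs_zero_cancel, rule tendsto_sandwich[OF _ _ tendsto_const null])
      (use Ysd[OF t] in auto)
  have "contact_invelope X Y H H1 h"
    unfolding contact_invelope_def
  proof (intro conjI ballI allI impI)
    show "continuous_on {0..1} H1"
    proof (rule continuous_on_IccI)
      show "(H1 \<longlongrightarrow> H1 0) (at_right 0)" "(H1 \<longlongrightarrow> H1 1) (at_left 1)"
        using left(1) right' H_ends by auto
      show "(H1 \<longlongrightarrow> H1 t) (at t)" if "0 < t" "t < 1" for t
        using DERIV_isCont[OF interior(3)[OF that]] by (simp add: isCont_def)
    qed simp
    show "Y t \<le> H t" if "t \<in> {0..1}" for t
      using that contact_invelopeD(4)[OF H(1)] by (intro LIMSEQ_le[OF limY lim0]) auto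
    fix x y :: real assume xy: "0 < x" "x < y" "y < 1" and gap: "\<forall>t\<in>{x..y}. Y t < H t"
    have "continuous_on {x..y} (\<lambda>t. H t - Y t)"
      using xy by (intro continuous_intros continuous_on_subset[OF Hc] continuous_on_subset[OF Yc]) auto
    then obtain z where "z \<in> {x..y}" "\<And>t. t \<in> {x..y} \<Longrightarrow> H z - Y z \<le> H t - Y t"
      using continuous_attains_inf[of "{x..y}" "\<lambda>t. H t - Y t"] xy by auto
    then obtain m where m: "0 < m" "\<And>t. t \<in> {x..y} \<Longrightarrow> m \<le> H t - Y t"
      using gap by (metis diff_gt_0_iff_gt)
    have "eventually (\<lambda>n. 2 * (1 / real (Suc n)) < m / 3) sequentially"
      by (rule order_tendstoD(2)[OF null]) (use m in simp)
    moreover have "eventually (\<lambda>n. \<forall>t\<in>{0..1}. dist (Hs n t) (H t) < m / 3) sequentially"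
      using uniform_limitD[OF unif, of "m / 3"] m by simp
    ultimately have ev: "eventually (\<lambda>n. \<forall>t\<in>{x..y}.
        Hs2 n t = Hs2 n x + (Hs2 n y - Hs2 n x) / (y - x) * (t - x)) sequentially"
    proof eventually_elim
      case (elim n)
      have "Ys n t < Hs n t" if t: "t \<in> {x..y}" for t
      proof -
        have "\<bar>Ys n t - Y t\<bar> < m / 3" using t xy by (intro le_less_trans[OF Ysd elim(1)]) auto
        moreover have "\<bar>Hs n t - H t\<bar> < m / 3" using elim(2) t xy by (auto simp: dist_real_def)
        ultimately show ?thesis using m(2)[OF t] by linarith
      qed
      then obtain a b where ab: "\<And>t. t \<in> {x..y} \<Longrightarrow> Hs2 n t = a + b * t"
        using contact_invelopeD(12)[OF H(1)[of n] xy] by blast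
      have slope: "(Hs2 n y - Hs2 n x) / (y - x) = b"
        using ab[of x] ab[of y] xy by (simp add: field_simps)
      show ?case
      proof
        fix t assume t: "t \<in> {x..y}"
        show "Hs2 n t = Hs2 n x + (Hs2 n y - Hs2 n x) / (y - x) * (t - x)"
          unfolding slope using ab[OF t] ab[of x] xy by (simp add: algebra_simps)
      qed
    qed
    have "h t = h x + (h y - h x) / (y - x) * (t - x)" if t: "t \<in> {x..y}" for t
    proof (rule LIMSEQ_unique)
      show "(\<lambda>n. Hs2 n t) \<longlonglongrightarrow> h t" using t xy by (intro lim2) auto
      have "(\<lambda>n. Hs2 n x + (Hs2 n y - Hs2 n x) / (y - x) * (t - x)) \<longlonglongrightarrow>
          h x + (h y - h x) / (y - x) * (t - x)"
        using xy by (intro tendsto_intros lim2) auto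
      then show "(\<lambda>n. Hs2 n t) \<longlonglongrightarrow> h x + (h y - h x) / (y - x) * (t - x)"
        by (rule Lim_transform_eventually, use ev in eventually_elim) (rule sym, erule bspec, rule t)
    qed
    note affine = this
    define c where "c = (h y - h x) / (y - x)"
    have "h t = (h x - c * x) + c * t" if "t \<in> {x..y}" for t
      unfolding affine[OF that, folded c_def] by (simp add: algebra_simps)
    then show "\<exists>a b. \<forall>t\<in>{x..y}. h t = a + b * t" by blast
  qed (use der interior(3) hconv H_ends X in auto)
  then show ?thesis by blast
qed

section \<open>Reduction to clamped paths\<close>

text \<open>The cubic polynomial with value 0 and slope \<open>a\<close> at 0, and value \<open>m\<close> and slope \<open>b\<close> at 1.\<close>

definition hermite_cubic :: "real \<Rightarrow> real \<Rightarrow> real \<Rightarrow> real \<Rightarrow> real" where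
  "hermite_cubic a b m t = a * (t - 2 * t\<^sup>2 + t ^ 3) + b * (t ^ 3 - t\<^sup>2) + m * (3 * t\<^sup>2 - 2 * t ^ 3)"

definition hermite_quadratic :: "real \<Rightarrow> real \<Rightarrow> real \<Rightarrow> real \<Rightarrow> real" where
  "hermite_quadratic a b m t = a * (1 - 4 * t + 3 * t\<^sup>2) + b * (3 * t\<^sup>2 - 2 * t) + m * (6 * t - 6 * t\<^sup>2)"

lemma hermite_derivatives:
  "(hermite_cubic a b m has_real_derivative hermite_quadratic a b m t) (at t within S)"
  "(hermite_quadratic a b m has_real_derivative
     ((6 * m - 4 * a - 2 * b) + (6 * a + 6 * b - 12 * m) * t)) (at t within S)"
  unfolding hermite_cubic_def[abs_def] hermite_quadratic_def[abs_def]
  by (rule derivative_eq_intros refl | simp add: algebra_simps power2_eq_square power3_eq_cube)+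

lemma hermite_end_points:
  "hermite_cubic a b m 0 = 0" "hermite_cubic a b m 1 = m"
  "hermite_quadratic a b m 0 = a" "hermite_quadratic a b m 1 = b"
  by (simp_all add: hermite_cubic_def hermite_quadratic_def)

lemma hermite_minus:
  "hermite_cubic (- a) (- b) (- m) t = - hermite_cubic a b m t"
  "hermite_quadratic (- a) (- b) (- m) t = - hermite_quadratic a b m t"
  by (simp_all add: hermite_cubic_def hermite_quadratic_def algebra_simps)

lemma hermite_continuous:
  "continuous_on S (hermite_cubic a b m)" "continuous_on S (hermite_quadratic a b m)"
  by (rule DERIV_continuous_on, rule hermite_derivatives)+

lemma hermite_quadratic_bound:
  assumes "0 \<le> t" "t \<le> 1" "\<bar>a\<bar> \<le> e" "\<bar>b\<bar> \<le> e" "\<bar>m\<bar> \<le> e"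
  shows "\<bar>hermite_quadratic a b m t\<bar> \<le> 4 * e"
proof -
  have q: "0 \<le> t * (1 - t)" "t * (1 - t) \<le> 1/4"
    using assms zero_le_power2[of "t - 1/2"] mult_left_le[of t t] by (simp_all add: power2_eq_square algebra_simps)
  have "\<bar>1 - 4 * t + 3 * t\<^sup>2\<bar> \<le> 1" "\<bar>3 * t\<^sup>2 - 2 * t\<bar> \<le> 1" "\<bar>6 * t - 6 * t\<^sup>2\<bar> \<le> 3/2"
    using q assms(1,2) by (auto simp: abs_le_iff power2_eq_square algebra_simps)
  moreover have "\<bar>x * w\<bar> \<le> e * c" if "\<bar>x\<bar> \<le> e" "\<bar>w\<bar> \<le> c" for x w c
    unfolding abs_mult using that by (intro mult_mono) auto
  ultimately have "\<bar>a * (1 - 4 * t + 3 * t\<^sup>2)\<bar> \<le> e * 1" "\<bar>b * (3 * t\<^sup>2 - 2 * t)\<bar> \<le> e * 1"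
    "\<bar>m * (6 * t - 6 * t\<^sup>2)\<bar> \<le> e * (3/2)"
    using assms by blast+
  then show ?thesis using assms unfolding hermite_quadratic_def by linarith
qed

lemma clamped_hermite:
  assumes "primitive_on_unit X Y"
  shows "clamped (\<lambda>t. X t - hermite_quadratic (X 0) (X 1) (Y 1) t)
    (\<lambda>t. Y t - hermite_cubic (X 0) (X 1) (Y 1) t)"
  using assms unfolding clamped_def primitive_on_unit_def
  by (auto simp: hermite_end_points intro!: continuous_on_diff DERIV_diff hermite_derivatives hermite_continuous)

lemma contact_invelope_diff_hermite:
  assumes H: "contact_invelope X Y H H1 H2"
  shows "contact_invelope (\<lambda>t. X t - hermite_quadratic a b m t) (\<lambda>t. Y t - hermite_cubic a b m t)
    (\<lambda>t. H t - hermite_cubic a b m t) (\<lambda>t. H1 t - hermite_quadratic a b m t)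
    (\<lambda>t. H2 t - ((6 * m - 4 * a - 2 * b) + (6 * a + 6 * b - 12 * m) * t))"
  unfolding contact_invelope_def
proof (intro conjI ballI allI impI)
  note D = contact_invelopeD[OF H]
  show "((\<lambda>t. H t - hermite_cubic a b m t) has_real_derivative H1 t - hermite_quadratic a b m t)
      (at t within {0..1})" if "t \<in> {0..1}" for t
    using D(1) that by (intro DERIV_diff hermite_derivatives) auto
  show "continuous_on {0..1} (\<lambda>t. H1 t - hermite_quadratic a b m t)"
    by (intro continuous_on_diff hermite_continuous D)
  show "((\<lambda>t. H1 t - hermite_quadratic a b m t) has_real_derivative
      H2 t - ((6 * m - 4 * a - 2 * b) + (6 * a + 6 * b - 12 * m) * t)) (at t)" if "t \<in> {0<..<1}" for t
    using that by (intro DERIV_diff hermite_derivatives D) auto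
  show "convex_on {0<..<1} (\<lambda>t. H2 t - ((6 * m - 4 * a - 2 * b) + (6 * a + 6 * b - 12 * m) * t))"
    by (rule subgradient_selection_imp_convex[OF subgradient_selection_diff_affine[OF
          subgradient_selection_right_deriv[OF D(7)]]])
  fix x y :: real assume xy: "0 < x" "x < y" "y < 1"
    and "\<forall>t\<in>{x..y}. Y t - hermite_cubic a b m t < H t - hermite_cubic a b m t"
  then obtain c d where "\<And>t. t \<in> {x..y} \<Longrightarrow> H2 t = c + d * t" using D(12)[OF xy] by auto
  then have "\<forall>t\<in>{x..y}. H2 t - ((6 * m - 4 * a - 2 * b) + (6 * a + 6 * b - 12 * m) * t) =
      (c - (6 * m - 4 * a - 2 * b)) + (d - (6 * a + 6 * b - 12 * m)) * t"
    by (simp add: algebra_simps)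
  then show "\<exists>c d. \<forall>t\<in>{x..y}.
      H2 t - ((6 * m - 4 * a - 2 * b) + (6 * a + 6 * b - 12 * m) * t) = c + d * t" by blast
qed (use contact_invelopeD[OF H] in auto)

lemma primitive_on_unit_bound:
  assumes "primitive_on_unit X Y" "\<And>t. 0 \<le> t \<Longrightarrow> t \<le> 1 \<Longrightarrow> \<bar>X t\<bar> \<le> c" "0 \<le> t" "t \<le> 1"
  shows "\<bar>Y t\<bar> \<le> c"
proof -
  have "norm (Y t - Y 0) \<le> c * norm (t - 0)"
    by (rule field_differentiable_bound[of "{0..1}" Y X])
      (use assms in \<open>auto simp: primitive_on_unit_def\<close>)
  moreover have "c * t \<le> c * 1" using assms(2)[of 0] assms(3,4) by (intro mult_left_mono) auto
  ultimately show ?thesis using assms(1,3) by (simp add: primitive_on_unit_def)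
qed

lemma primitive_on_unit_diff:
  assumes "primitive_on_unit X Y" "primitive_on_unit X' Y'"
  shows "primitive_on_unit (\<lambda>t. X t - X' t) (\<lambda>t. Y t - Y' t)"
  using assms unfolding primitive_on_unit_def by (auto intro!: continuous_on_diff DERIV_diff)

lemma primitive_on_unit_integral:
  assumes "continuous_on {0..1} X"
  shows "primitive_on_unit X (\<lambda>t. integral {0..t} X)"
  using assms integral_has_real_derivative[OF assms] by (auto simp: primitive_on_unit_def)

text \<open>Polynomials approximate \<open>X\<close> uniformly; subtracting the Hermite polynomial of their small boundary
  values makes them clamped without spoiling the approximation.\<close>

lemma contact_invelope_exists_clamped:
  assumes XY: "clamped X Y"
  shows "\<exists>H H1 H2. contact_invelope X Y H H1 H2"
proof -
  have X: "continuous_on {0..1} X" "X 0 = 0" "X 1 = 0" "Y 1 = 0" "primitive_on_unit X Y"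
    using XY by (auto simp: clamped_def primitive_on_unit_def)
  have "\<exists>X' Y' H H1 H2. contact_invelope X' Y' H H1 H2 \<and> clamped X' Y' \<and>
      (\<forall>t\<in>{0..1}. \<bar>X' t - X t\<bar> \<le> 1 / real (Suc n))" for n
  proof -
    \<comment> \<open>The correction is bounded by \<open>4 * e\<close>, the approximation error by \<open>e\<close>.\<close>
    define e where "e = 1 / (5 * real (Suc n))"
    have e: "0 < e" "5 * e = 1 / real (Suc n)" by (simp_all add: e_def del: of_nat_Suc)
    obtain p where p: "real_polynomial_function p" "\<And>t. t \<in> {0..1} \<Longrightarrow> \<bar>X t - p t\<bar> < e"
      using Stone_Weierstrass_real_polynomial_function[OF _ X(1) e(1)] by auto
    obtain p' where p': "real_polynomial_function p'" "\<And>t. (p has_real_derivative p' t) (at t)"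
      using has_real_derivative_polynomial_function[OF p(1)] by auto
    have c: "continuous_on {0..1} p" "continuous_on {0..1} p'"
      using p(1) p'(1) by (auto intro!: continuous_on_polymonial_function simp: real_polynomial_function_eq)
    define P where "P t = integral {0..t} p" for t
    have prim: "primitive_on_unit p P"
      unfolding P_def by (rule primitive_on_unit_integral[OF c(1)])
    have small: "\<bar>p 0\<bar> \<le> e" "\<bar>p 1\<bar> \<le> e" "\<bar>P 1\<bar> \<le> e"
      using p(2)[of 0] p(2)[of 1] X(2-4) primitive_on_unit_bound[OF primitive_on_unit_diff[OF X(5) prim], of e 1]
        less_imp_le[OF p(2)] by auto
    let ?X = "\<lambda>t. p t - hermite_quadratic (p 0) (p 1) (P 1) t"
    let ?Y = "\<lambda>t. P t - hermite_cubic (p 0) (p 1) (P 1) t"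
    let ?l = "\<lambda>t. (6 * P 1 - 4 * p 0 - 2 * p 1) + (6 * p 0 + 6 * p 1 - 12 * P 1) * t"
    have cl: "clamped ?X ?Y" by (rule clamped_hermite[OF prim])
    moreover have "\<exists>H H1 H2. contact_invelope ?X ?Y H H1 H2"
    proof (rule contact_invelope_exists_smooth[OF cl, of "\<lambda>t. p' t - ?l t"])
      show "continuous_on {0..1} (\<lambda>t. p' t - ?l t)" by (intro continuous_intros c)
      show "(?X has_real_derivative p' t - ?l t) (at t within {0..1})" for t
        by (intro DERIV_diff hermite_derivatives has_field_derivative_at_within[OF p'(2)])
    qed
    moreover have "\<bar>?X t - X t\<bar> \<le> 1 / real (Suc n)" if "t \<in> {0..1}" for t
      using hermite_quadratic_bound[of t, OF _ _ small] p(2)[OF that] that e by auto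
    ultimately show ?thesis by blast
  qed
  then obtain Xs Ys Hs Hs1 Hs2 where
    "\<And>n. contact_invelope (Xs n) (Ys n) (Hs n) (Hs1 n) (Hs2 n)" "\<And>n. clamped (Xs n) (Ys n)"
    "\<And>n t. t \<in> {0..1} \<Longrightarrow> \<bar>Xs n t - X t\<bar> \<le> 1 / real (Suc n)"
    by metis
  then show ?thesis by (intro contact_invelope_limit[OF _ _ XY]) auto
qed

lemma contact_invelope_exists:
  assumes "primitive_on_unit X Y"
  shows "\<exists>H H1 H2. contact_invelope X Y H H1 H2"
proof -
  obtain H H1 H2 where "contact_invelope (\<lambda>t. X t - hermite_quadratic (X 0) (X 1) (Y 1) t)
      (\<lambda>t. Y t - hermite_cubic (X 0) (X 1) (Y 1) t) H H1 H2"
    using contact_invelope_exists_clamped[OF clamped_hermite[OF assms]] by blast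
  from contact_invelope_diff_hermite[OF this, of "- X 0" "- X 1" "- Y 1"]
  show ?thesis by (auto simp: hermite_minus)
qed

text \<open>Continuous dependence for general paths follows from the clamped case, since the Hermite
  polynomials depend continuously on the boundary values. Uniqueness is the case of constant
  sequences.\<close>

lemma contact_invelope_continuous:
  assumes H: "\<And>n. contact_invelope (Xs n) (Ys n) (Hs n) (Hs1 n) (Hs2 n)" "\<And>n. primitive_on_unit (Xs n) (Ys n)"
    and G: "contact_invelope X Y G G1 G2" "primitive_on_unit X Y"
    and lim: "uniform_limit {0..1} Xs X sequentially"
    and t: "0 \<le> t" "t \<le> 1"
  shows "(\<lambda>n. Hs n t) \<longlonglongrightarrow> G t"
proof -
  let ?c = "\<lambda>n. hermite_cubic (Xs n 0) (Xs n 1) (Ys n 1)" and ?c' = "hermite_cubic (X 0) (X 1) (Y 1)"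
  let ?q = "\<lambda>n. hermite_quadratic (Xs n 0) (Xs n 1) (Ys n 1)" and ?q' = "hermite_quadratic (X 0) (X 1) (Y 1)"
  have X01: "(\<lambda>n. Xs n 0) \<longlonglongrightarrow> X 0" "(\<lambda>n. Xs n 1) \<longlonglongrightarrow> X 1"
    by (rule tendsto_uniform_limitI[OF lim]; simp)+
  have Y1: "(\<lambda>n. Ys n 1) \<longlonglongrightarrow> Y 1"
  proof (rule tendstoI)
    fix e :: real assume e: "0 < e"
    then have "eventually (\<lambda>n. \<forall>t\<in>{0..1}. dist (Xs n t) (X t) < e / 2) sequentially"
      using uniform_limitD[OF lim, of "e / 2"] by simp
    then show "eventually (\<lambda>n. dist (Ys n 1) (Y 1) < e) sequentially"
    proof eventually_elim
      case (elim n)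
      have "\<bar>Ys n 1 - Y 1\<bar> \<le> e / 2"
        by (rule primitive_on_unit_bound[OF primitive_on_unit_diff[OF H(2) G(2)]])
          (use elim in \<open>auto simp: dist_real_def less_imp_le\<close>)
      then show ?case using e by (simp add: dist_real_def)
    qed
  qed
  have "uniform_limit {0..1} ?q ?q' sequentially"
  proof (rule uniform_limitI)
    fix e :: real assume e: "0 < e"
    have "eventually (\<lambda>n. dist (Xs n 0) (X 0) < e / 8) sequentially"
      "eventually (\<lambda>n. dist (Xs n 1) (X 1) < e / 8) sequentially"
      "eventually (\<lambda>n. dist (Ys n 1) (Y 1) < e / 8) sequentially"
      using e by (intro tendstoD[OF X01(1)] tendstoD[OF X01(2)] tendstoD[OF Y1]; simp)+
    then show "eventually (\<lambda>n. \<forall>t\<in>{0..1}. dist (?q n t) (?q' t) < e) sequentially"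
    proof eventually_elim
      case (elim n)
      show ?case
      proof
        fix t :: real assume t: "t \<in> {0..1}"
        have "?q n t - ?q' t = hermite_quadratic (Xs n 0 - X 0) (Xs n 1 - X 1) (Ys n 1 - Y 1) t"
          by (simp add: hermite_quadratic_def algebra_simps)
        moreover have "\<bar>hermite_quadratic (Xs n 0 - X 0) (Xs n 1 - X 1) (Ys n 1 - Y 1) t\<bar> \<le> 4 * (e / 8)"
          using t elim by (intro hermite_quadratic_bound) (auto simp: dist_real_def)
        ultimately have "\<bar>?q n t - ?q' t\<bar> \<le> 4 * (e / 8)" by (simp only:)
        then show "dist (?q n t) (?q' t) < e" using e unfolding dist_real_def by linarith
      qed
    qed
  qed
  then have "uniform_limit {0..1} (\<lambda>n t. Xs n t - ?q n t) (\<lambda>t. X t - ?q' t) sequentially"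
    using lim by (intro uniform_limit_intros)
  then have "(\<lambda>n. Hs n t - ?c n t) \<longlonglongrightarrow> G t - ?c' t"
    by (rule contact_invelope_tendsto[OF contact_invelope_diff_hermite[OF H(1)] clamped_hermite[OF H(2)]
        contact_invelope_diff_hermite[OF G(1)] clamped_hermite[OF G(2)] _ t])
  moreover have "(\<lambda>n. ?c n t) \<longlonglongrightarrow> ?c' t"
    unfolding hermite_cubic_def by (intro tendsto_intros X01 Y1)
  ultimately have "(\<lambda>n. (Hs n t - ?c n t) + ?c n t) \<longlonglongrightarrow> (G t - ?c' t) + ?c' t" by (rule tendsto_add)
  then show ?thesis by simp
qed

lemma contact_invelope_unique:
  assumes "contact_invelope X Y H H1 H2" "contact_invelope X Y G G1 G2" "primitive_on_unit X Y"
    and "0 \<le> t" "t \<le> 1"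
  shows "H t = G t"
  using contact_invelope_continuous[of "\<lambda>_. X" "\<lambda>_. Y" "\<lambda>_. H" "\<lambda>_. H1" "\<lambda>_. H2" X Y G G1 G2 t] assms
  by (simp add: LIMSEQ_const_iff uniform_limit_const)

section \<open>The complementarity condition as an integral\<close>

lemma sets_stieltjes_measure_Ioc:
  assumes "a < x" "x \<le> y" "y < b"
  shows "{x<..y} \<in> sets (stieltjes_measure a b F)"
proof -
  have "sets (stieltjes_measure a b F) =
      sigma_sets {a<..<b} ((\<lambda>(x, y). {x<..y}) ` {(x, y). a < x \<and> x \<le> y \<and> y < b})"
    unfolding stieltjes_measure_def by (subst sets_extend_measure) auto
  then show ?thesis using assms by (auto intro!: sigma_sets.Basic)
qed

lemma open_rational_Ioc:
  fixes U :: "real set"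
  assumes "open U"
  shows "U = (\<Union>(p, q)\<in>{(p, q). p \<in> \<rat> \<and> q \<in> \<rat> \<and> p < q \<and> {p..q} \<subseteq> U}. {p<..q})"
proof (intro set_eqI iffI)
  fix t assume t: "t \<in> U"
  then obtain e where e: "0 < e" "\<And>s. \<bar>s - t\<bar> < e \<Longrightarrow> s \<in> U"
    using assms by (metis open_real dist_real_def open_dist)
  obtain p where p: "p \<in> \<rat>" "t - e < p" "p < t" using Rats_dense_in_real[of "t - e" t] e by auto
  obtain q where q: "q \<in> \<rat>" "t < q" "q < t + e" using Rats_dense_in_real[of t "t + e"] e by auto
  have "{p..q} \<subseteq> U" using p q by (auto intro!: e(2))
  then show "t \<in> (\<Union>(p, q)\<in>{(p, q). p \<in> \<rat> \<and> q \<in> \<rat> \<and> p < q \<and> {p..q} \<subseteq> U}. {p<..q})"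
    using p q by (intro UN_I[of "(p, q)"]) auto
qed auto

lemma countable_rational_pairs: "countable {(p, q). p \<in> \<rat> \<and> q \<in> \<rat> \<and> P p q}"
  by (rule countable_subset[of _ "\<rat> \<times> \<rat>"]) (auto intro: countable_rat)

lemma open_sets_stieltjes_measure:
  assumes "open U" "U \<subseteq> {a<..<b}"
  shows "U \<in> sets (stieltjes_measure a b F)"
proof -
  have "(\<Union>(p, q)\<in>{(p, q). p \<in> \<rat> \<and> q \<in> \<rat> \<and> p < q \<and> {p..q} \<subseteq> U}. {p<..q})
      \<in> sets (stieltjes_measure a b F)"
  proof (intro sets.countable_UN'' countable_rational_pairs)
    fix z assume z: "z \<in> {(p, q). p \<in> \<rat> \<and> q \<in> \<rat> \<and> p < q \<and> {p..q} \<subseteq> U}"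
    obtain p q where "z = (p, q)" "p < q" "{p..q} \<subseteq> U" using z by auto
    moreover from this have "p \<in> U" "q \<in> U" by auto
    ultimately show "(case z of (p, q) \<Rightarrow> {p<..q}) \<in> sets (stieltjes_measure a b F)"
      using assms(2) by (auto intro!: sets_stieltjes_measure_Ioc)
  qed
  then show ?thesis using open_rational_Ioc[OF assms(1)] by simp
qed

lemma measurable_stieltjes_measure_continuous:
  fixes f :: "real \<Rightarrow> real"
  assumes "continuous_on {a<..<b} f"
  shows "f \<in> borel_measurable (stieltjes_measure a b F)"
  unfolding borel_measurable_iff_greater
proof
  fix c
  have "open {t \<in> {a<..<b}. c < f t}"
    using continuous_openin_preimage_gen[OF assms, of "{c<..}"]
    by (simp add: openin_open_eq vimage_def Int_def)
  then show "{t \<in> space (stieltjes_measure a b F). c < f t} \<in> sets (stieltjes_measure a b F)"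
    using open_sets_stieltjes_measure[of _ a b F] by (simp add: subset_eq)
qed

text \<open>A nonnegative continuous function has integral 0 exactly if it vanishes almost everywhere.
  For the Stieltjes measure of \<open>F\<close> this means that \<open>F\<close> is constant on each interval on
  which the function is positive, since the set of positivity is a countable union of such
  intervals.\<close>

lemma stieltjes_integral_zero_iff:
  fixes f :: "real \<Rightarrow> real"
  assumes mono: "\<And>x y. a < x \<Longrightarrow> x \<le> y \<Longrightarrow> y < b \<Longrightarrow> F x \<le> F y"
    and right_cont: "\<And>x. a < x \<Longrightarrow> x < b \<Longrightarrow> continuous (at_right x) F"
    and f: "continuous_on {a<..<b} f" "\<And>t. a < t \<Longrightarrow> t < b \<Longrightarrow> 0 \<le> f t"
  shows "integrable (stieltjes_measure a b F) f \<and> integral\<^sup>L (stieltjes_measure a b F) f = 0 \<longleftrightarrow>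
    (\<forall>x y. a < x \<longrightarrow> x \<le> y \<longrightarrow> y < b \<longrightarrow> (\<forall>t\<in>{x..y}. 0 < f t) \<longrightarrow> F x = F y)"
    (is "?I \<longleftrightarrow> ?C")
proof -
  let ?M = "stieltjes_measure a b F"
  have em: "emeasure ?M {x<..y} = ennreal (F y - F x)" if "a < x" "x \<le> y" "y < b" for x y
    by (rule emeasure_stieltjes_measure_Ioc[OF mono right_cont that])
  show ?thesis
  proof
    assume I: ?I
    then have "AE t in ?M. f t = 0"
      using f(2) by (subst integral_nonneg_eq_0_iff_AE[symmetric]) (auto intro!: AE_I2)
    then obtain N where N: "{t \<in> space ?M. f t \<noteq> 0} \<subseteq> N" "N \<in> sets ?M" "emeasure ?M N = 0"
      by (auto elim: AE_E)
    show ?C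
    proof (intro allI impI)
      fix x y assume xy: "a < x" "x \<le> y" "y < b" "\<forall>t\<in>{x..y}. 0 < f t"
      have "t \<in> N" if "t \<in> {x<..y}" for t
      proof -
        have "t \<in> {x..y}" using that by simp
        with xy(4) have "0 < f t" by blast
        then have "f t \<noteq> 0" by simp
        then have "t \<in> {t \<in> space ?M. f t \<noteq> 0}" using that xy(1-3) by auto
        then show ?thesis using N(1) by blast
      qed
      then have "emeasure ?M {x<..y} \<le> emeasure ?M N" using N(2) by (intro emeasure_mono) auto
      then have "ennreal (F y - F x) = 0" using em[OF xy(1-3)] N(3) by simp
      then show "F x = F y" using mono[OF xy(1-3)] by (simp add: ennreal_eq_0_iff)
    qed
  next
    assume C: ?C
    define P where "P = {(p, q). p \<in> \<rat> \<and> q \<in> \<rat> \<and> p < q \<and> {p..q} \<subseteq> {t \<in> {a<..<b}. 0 < f t}}"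
    have "open {t \<in> {a<..<b}. 0 < f t}"
      using continuous_openin_preimage_gen[OF f(1), of "{0<..}"]
      by (simp add: openin_open_eq vimage_def Int_def)
    from open_rational_Ioc[OF this]
    have U: "{t \<in> {a<..<b}. 0 < f t} = (\<Union>(p, q)\<in>P. {p<..q})" by (simp add: P_def)
    have "(\<Union>(p, q)\<in>P. {p<..q}) \<in> null_sets ?M"
    proof (rule null_sets_UN')
      show "countable P" unfolding P_def by (rule countable_rational_pairs)
      fix z assume "z \<in> P"
      then obtain p q where z: "z = (p, q)" "p < q" and pq: "{p..q} \<subseteq> {t \<in> {a<..<b}. 0 < f t}"
        by (auto simp: P_def)
      have "p \<in> {p..q}" "q \<in> {p..q}" using z by auto
      with pq have ab: "a < p" "q < b" by auto
      have "\<forall>t\<in>{p..q}. 0 < f t" using pq by blast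
      then have "F p = F q" using C ab z(2) less_imp_le by blast
      then have "emeasure ?M {p<..q} = 0" using em[of p q] ab z by simp
      then show "(case z of (p, q) \<Rightarrow> {p<..q}) \<in> null_sets ?M"
        using sets_stieltjes_measure_Ioc[of a p q b F] ab z by (auto intro: null_setsI)
    qed
    then have ae: "AE t in ?M. f t = 0"
      unfolding U[symmetric] using f(2) by (intro AE_I') (auto simp: less_le)
    have m: "f \<in> borel_measurable ?M" using f(1) by (rule measurable_stieltjes_measure_continuous)
    have "integrable ?M f \<longleftrightarrow> integrable ?M (\<lambda>_. 0 :: real)"
      by (rule integrable_cong_AE[OF m _ ae]) simp
    moreover have "integral\<^sup>L ?M f = integral\<^sup>L ?M (\<lambda>_. 0 :: real)"
      by (rule integral_cong_AE[OF m _ ae]) simp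
    ultimately show ?I by simp
  qed
qed

lemma invelope_iff_contact_invelope:
  assumes Y: "continuous_on {0..1} Y"
  shows "invelope X Y H \<longleftrightarrow> (\<exists>H1 H2. contact_invelope X Y H H1 H2)"
proof -
  have key: "(integrable (stieltjes_measure 0 1 (right_deriv H2)) (\<lambda>t. H t - Y t) \<and>
      (\<integral>t. (H t - Y t) \<partial>stieltjes_measure 0 1 (right_deriv H2)) = 0) \<longleftrightarrow>
      (\<forall>x y. 0 < x \<longrightarrow> x < y \<longrightarrow> y < 1 \<longrightarrow> (\<forall>t\<in>{x..y}. Y t < H t) \<longrightarrow>
        (\<exists>a b. \<forall>t\<in>{x..y}. H2 t = a + b * t))" (is "?I \<longleftrightarrow> ?C")
    if H: "\<forall>t\<in>{0..1}. (H has_real_derivative H1 t) (at t within {0..1})"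
      "continuous_on {0..1} H1" "\<forall>t\<in>{0..1}. Y t \<le> H t"
      "\<forall>t\<in>{0<..<1}. (H1 has_real_derivative H2 t) (at t)" "convex_on {0<..<1} H2"
      "H 0 = Y 0" "H1 0 = X 0" "H 1 = Y 1" "H1 1 = X 1" for H1 H2
  proof -
    let ?k = "right_deriv H2"
    note k = subgradient_selection_right_deriv[OF H(5)]
    have Hc: "continuous_on {0..1} H" using H(1) by (auto intro: DERIV_continuous_on)
    have "?I \<longleftrightarrow> (\<forall>x y. 0 < x \<longrightarrow> x \<le> y \<longrightarrow> y < 1 \<longrightarrow> (\<forall>t\<in>{x..y}. 0 < H t - Y t) \<longrightarrow> ?k x = ?k y)"
    proof (rule stieltjes_integral_zero_iff)
      show "\<And>x y. 0 < x \<Longrightarrow> x \<le> y \<Longrightarrow> y < 1 \<Longrightarrow> ?k x \<le> ?k y"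
        using subgradient_selection_mono[OF k] .
      show "\<And>x. 0 < x \<Longrightarrow> x < 1 \<Longrightarrow> continuous (at_right x) ?k"
        using right_deriv_right_continuous[OF H(5)] .
      show "continuous_on {0<..<1} (\<lambda>t. H t - Y t)"
        by (intro continuous_on_diff continuous_on_subset[OF Hc] continuous_on_subset[OF Y]) auto
    qed (use H(3) in auto)
    also have "\<dots> \<longleftrightarrow> ?C"
    proof
      assume *: "\<forall>x y. 0 < x \<longrightarrow> x \<le> y \<longrightarrow> y < 1 \<longrightarrow> (\<forall>t\<in>{x..y}. 0 < H t - Y t) \<longrightarrow> ?k x = ?k y"
      show ?C
      proof (intro allI impI)
        fix x y :: real assume xy: "0 < x" "x < y" "y < 1" "\<forall>t\<in>{x..y}. Y t < H t"
        then have "?k x = ?k y" using * by auto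
        then have "H2 t = (H2 x - ?k x * x) + ?k x * t" if "t \<in> {x..y}" for t
          using subgradient_selection_const_imp_affine[OF k, of x y t] xy that by (simp add: algebra_simps)
        then show "\<exists>a b. \<forall>t\<in>{x..y}. H2 t = a + b * t" by blast
      qed
    next
      assume ?C
      then have "contact_invelope X Y H H1 H2" using H unfolding contact_invelope_def by blast
      from contact_invelope_subgradient_eq[OF this Y k]
      show "\<forall>x y. 0 < x \<longrightarrow> x \<le> y \<longrightarrow> y < 1 \<longrightarrow> (\<forall>t\<in>{x..y}. 0 < H t - Y t) \<longrightarrow> ?k x = ?k y"
        by force
    qed
    finally show ?thesis .
  qed
  show ?thesis
    unfolding invelope_def contact_invelope_def
    by (intro ex_cong1) (use key in blast)
qed

lemma invelope_cong:
  assumes "\<And>t. 0 \<le> t \<Longrightarrow> t \<le> 1 \<Longrightarrow> H t = G t" "continuous_on {0..1} Y"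
  shows "invelope X Y H \<longleftrightarrow> invelope X Y G"
proof -
  have "contact_invelope X Y G H1 H2"
    if H: "contact_invelope X Y H H1 H2" and eq: "\<And>t. 0 \<le> t \<Longrightarrow> t \<le> 1 \<Longrightarrow> H t = G t" for H G H1 H2
  proof -
    have "(G has_real_derivative H1 t) (at t within {0..1})" if t: "t \<in> {0..1}" for t
    proof (rule has_field_derivative_transform_within)
      show "(H has_real_derivative H1 t) (at t within {0..1})" using contact_invelopeD(1)[OF H] t by auto
    qed (use t eq in \<open>auto intro: zero_less_one\<close>)
    moreover have "(\<forall>t\<in>{x..y}. Y t < G t) \<longleftrightarrow> (\<forall>t\<in>{x..y}. Y t < H t)" if "0 < x" "y < 1" for x y
      using eq that by auto
    ultimately show ?thesis using H eq unfolding contact_invelope_def by auto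
  qed
  from this[of H _ _ G] this[of G _ _ H] show ?thesis
    unfolding invelope_iff_contact_invelope[OF assms(2)] using assms(1) by metis
qed

section \<open>The random invelope\<close>

definition invelope_of :: "(real \<Rightarrow> real) \<Rightarrow> real \<Rightarrow> real" where
  "invelope_of X = (SOME H. \<exists>H1 H2. contact_invelope X (\<lambda>t. integral {0..t} X) H H1 H2)"

lemma invelope_of:
  assumes "continuous_on {0..1} X"
  obtains H1 H2 where "contact_invelope X (\<lambda>t. integral {0..t} X) (invelope_of X) H1 H2"
proof -
  have "\<exists>H H1 H2. contact_invelope X (\<lambda>t. integral {0..t} X) H H1 H2"
    using assms by (intro contact_invelope_exists primitive_on_unit_integral)
  then have "\<exists>H1 H2. contact_invelope X (\<lambda>t. integral {0..t} X) (invelope_of X) H1 H2"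
    unfolding invelope_of_def by (rule someI_ex)
  then show thesis using that by blast
qed

lemma invelope_of_continuous:
  assumes "\<And>n. continuous_on {0..1} (Xs n)" "continuous_on {0..1} X"
    and "uniform_limit {0..1} Xs X sequentially" "0 \<le> t" "t \<le> 1"
  shows "(\<lambda>n. invelope_of (Xs n) t) \<longlonglongrightarrow> invelope_of X t"
proof -
  have "\<exists>H1 H2. contact_invelope (Xs n) (\<lambda>t. integral {0..t} (Xs n)) (invelope_of (Xs n)) H1 H2" for n
    using invelope_of[OF assms(1)] by metis
  then obtain H1 H2 where H: "\<And>n. contact_invelope (Xs n) (\<lambda>t. integral {0..t} (Xs n)) (invelope_of (Xs n)) (H1 n) (H2 n)"
    by metis
  obtain G1 G2 where G: "contact_invelope X (\<lambda>t. integral {0..t} X) (invelope_of X) G1 G2"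
    using invelope_of[OF assms(2)] .
  show ?thesis
    by (rule contact_invelope_continuous[OF H _ G _ assms(3-5)])
      (intro primitive_on_unit_integral assms)+
qed

definition bernstein_sum :: "nat \<Rightarrow> (nat \<Rightarrow> real) \<Rightarrow> real \<Rightarrow> real" where
  "bernstein_sum n c x = (\<Sum>k\<le>n. c k * Bernstein n k x)"

lemma bernstein_sum_continuous: "continuous_on S (bernstein_sum n c)"
  unfolding bernstein_sum_def Bernstein_def by (intro continuous_intros)

text \<open>The invelope of a Bernstein polynomial is a continuous, hence measurable, function of its
  finitely many coefficients.\<close>

lemma invelope_of_bernstein_measurable:
  assumes t: "0 \<le> t" "t \<le> 1"
  shows "(\<lambda>c. invelope_of (bernstein_sum n c) t) \<in> borel_measurable borel"
proof (rule borel_measurable_continuous_onI, rule continuous_on_sequentiallyI)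
  fix cs :: "nat \<Rightarrow> nat \<Rightarrow> real" and c assume "cs \<longlonglongrightarrow> c"
  then have lim: "(\<lambda>j. cs j k) \<longlonglongrightarrow> c k" for k
    using continuous_on_tendsto_compose[OF continuous_on_product_coordinates] by auto
  have "uniform_limit {0..1} (\<lambda>j. bernstein_sum n (cs j)) (bernstein_sum n c) sequentially"
  proof (rule uniform_limitI)
    fix e :: real assume e: "0 < e"
    have "eventually (\<lambda>j. \<forall>k\<in>{..n}. dist (cs j k) (c k) < e / (2 * real (Suc n))) sequentially"
      using e by (intro eventually_ball_finite ballI tendstoD[OF lim]) auto
    then show "eventually (\<lambda>j. \<forall>x\<in>{0..1}. dist (bernstein_sum n (cs j) x) (bernstein_sum n c x) < e) sequentially"
    proof eventually_elim
      case (elim j)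
      show ?case
      proof
        fix x :: real assume x: "x \<in> {0..1}"
        have B: "0 \<le> Bernstein n k x" for k using x by (intro Bernstein_nonneg) auto
        have "dist (bernstein_sum n (cs j) x) (bernstein_sum n c x) =
            \<bar>\<Sum>k\<le>n. (cs j k - c k) * Bernstein n k x\<bar>"
          by (simp add: bernstein_sum_def dist_real_def sum_subtractf[symmetric] left_diff_distrib)
        also have "\<dots> \<le> (\<Sum>k\<le>n. \<bar>(cs j k - c k) * Bernstein n k x\<bar>)" by (rule sum_abs)
        also have "\<dots> \<le> (\<Sum>k\<le>n. e / (2 * real (Suc n)) * Bernstein n k x)"
          unfolding abs_mult using elim B
          by (intro sum_mono mult_mono) (auto simp: dist_real_def less_imp_le)
        also have "\<dots> = e / (2 * real (Suc n))" by (simp only: sum_distrib_left[symmetric] sum_Bernstein mult_1_right)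
        also have "\<dots> \<le> e / 2" using e by (intro divide_left_mono) auto
        finally show "dist (bernstein_sum n (cs j) x) (bernstein_sum n c x) < e" using e by simp
      qed
    qed
  qed
  then show "(\<lambda>j. invelope_of (bernstein_sum n (cs j)) t) \<longlonglongrightarrow> invelope_of (bernstein_sum n c) t"
    using t by (intro invelope_of_continuous bernstein_sum_continuous)
qed

text \<open>The invelope is measurable as the limit of the invelopes of the Bernstein polynomials of the path, which depend on finitely many
  values of the path only.\<close>

lemma ae_unique_random_invelopeI:
  fixes X :: "real \<Rightarrow> 'a \<Rightarrow> real"
  assumes meas: "\<And>t. 0 \<le> t \<Longrightarrow> t \<le> 1 \<Longrightarrow> X t \<in> borel_measurable M"
    and cont: "AE \<omega> in M. continuous_on {0..1} (\<lambda>t. X t \<omega>)"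
  shows "ae_unique_random_invelope M X (\<lambda>t \<omega>. integral {0..t} (\<lambda>s. X s \<omega>))"
proof -
  define c where "c n \<omega> k = (if k \<le> n then X (real k / real n) \<omega> else 0)" for n \<omega> k
  define H where "H t \<omega> = lim (\<lambda>n. invelope_of (bernstein_sum n (c n \<omega>)) t)" for t \<omega>
  have "(\<lambda>\<omega>. c n \<omega>) \<in> borel_measurable M" for n
  proof (rule measurable_coordinatewise_then_product)
    fix k
    show "(\<lambda>\<omega>. c n \<omega> k) \<in> borel_measurable M"
    proof (cases "k \<le> n")
      case True
      then have "real k / real n \<le> 1" by (cases "n = 0") auto
      then show ?thesis using True by (simp add: c_def meas)
    qed (simp add: c_def)
  qed
  then have "H t \<in> borel_measurable M" if "t \<in> {0..1}" for t
    unfolding H_def using that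
    by (intro borel_measurable_lim_metric measurable_compose[OF _ invelope_of_bernstein_measurable]) auto
  moreover have "AE \<omega> in M. invelope (\<lambda>t. X t \<omega>) (\<lambda>t. integral {0..t} (\<lambda>s. X s \<omega>)) (\<lambda>t. H t \<omega>) \<and>
      (\<forall>G. invelope (\<lambda>t. X t \<omega>) (\<lambda>t. integral {0..t} (\<lambda>s. X s \<omega>)) G \<longrightarrow> (\<forall>t\<in>{0..1}. G t = H t \<omega>))"
    using cont
  proof eventually_elim
    case (elim \<omega>)
    let ?X = "\<lambda>t. X t \<omega>" and ?Y = "\<lambda>t. integral {0..t} (\<lambda>s. X s \<omega>)"
    have prim: "primitive_on_unit ?X ?Y" using elim by (rule primitive_on_unit_integral)
    note Yc = primitive_on_unit_continuous[OF prim]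
    have "uniform_limit {0..1} (\<lambda>n. bernstein_sum n (c n \<omega>)) ?X sequentially"
    proof (rule uniform_limitI)
      fix e :: real assume "0 < e"
      from Bernstein_Weierstrass[OF elim this] obtain N where
        N: "\<And>n x. N \<le> n \<Longrightarrow> x \<in> {0..1} \<Longrightarrow>
          \<bar>X x \<omega> - (\<Sum>k\<le>n. X (real k / real n) \<omega> * Bernstein n k x)\<bar> < e" by blast
      have "bernstein_sum n (c n \<omega>) x = (\<Sum>k\<le>n. X (real k / real n) \<omega> * Bernstein n k x)" for n x
        by (simp add: bernstein_sum_def c_def)
      then show "eventually (\<lambda>n. \<forall>x\<in>{0..1}. dist (bernstein_sum n (c n \<omega>) x) (X x \<omega>) < e) sequentially"
        unfolding eventually_sequentially dist_real_def
        using N by (intro exI[of _ N]) (auto simp: abs_minus_commute)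
    qed
    then have "(\<lambda>n. invelope_of (bernstein_sum n (c n \<omega>)) t) \<longlonglongrightarrow> invelope_of ?X t" if "0 \<le> t" "t \<le> 1" for t
      using that by (intro invelope_of_continuous bernstein_sum_continuous elim)
    then have H: "invelope_of ?X t = H t \<omega>" if "0 \<le> t" "t \<le> 1" for t
      using that unfolding H_def by (intro sym[OF limI])
    obtain H1 H2 where I: "contact_invelope ?X ?Y (invelope_of ?X) H1 H2" using invelope_of[OF elim] .
    then have "invelope ?X ?Y (invelope_of ?X)" using invelope_iff_contact_invelope[OF Yc] by blast
    moreover have "invelope ?X ?Y (invelope_of ?X) \<longleftrightarrow> invelope ?X ?Y (\<lambda>t. H t \<omega>)"
      by (rule invelope_cong[OF H Yc])
    ultimately have "invelope ?X ?Y (\<lambda>t. H t \<omega>)" by (rule iffD1[rotated])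
    moreover have "G t = H t \<omega>" if G: "invelope ?X ?Y G" and t: "t \<in> {0..1}" for G t
    proof -
      obtain G1 G2 where "contact_invelope ?X ?Y G G1 G2"
        using G invelope_iff_contact_invelope[OF Yc] by blast
      then have "G t = invelope_of ?X t" using t by (intro contact_invelope_unique[OF _ I prim]) simp_all
      then show ?thesis using H t by simp
    qed
    ultimately show ?case by blast
  qed
  ultimately show ?thesis unfolding ae_unique_random_invelope_def by blast
qed

theorem theorem2p4:
  fixes M :: "'a measure" and U :: "real \<Rightarrow> 'a \<Rightarrow> real"
    and N :: "'b measure" and W :: "real \<Rightarrow> 'b \<Rightarrow> real"
  shows
    "(standard_brownian_bridge M U \<longrightarrow>
        (let X = (\<lambda>t. U (triangular_cdf t));
             Y = (\<lambda>t \<omega>. integral {0..t} (\<lambda>s. X s \<omega>))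
         in ae_unique_random_invelope M X Y)) \<and>
     (standard_brownian_motion N W \<longrightarrow>
        (let Y = (\<lambda>t \<omega>. integral {0..t} (\<lambda>s. W s \<omega>))
         in ae_unique_random_invelope N W Y))"
proof (intro conjI impI)
  assume U: "standard_brownian_bridge M U"
  have F: "triangular_cdf t = 2 * t - t\<^sup>2" "triangular_cdf t \<in> {0..1}" if "0 \<le> t" "t \<le> 1" for t
  proof -
    show eq: "triangular_cdf t = 2 * t - t\<^sup>2" using triangular_cdf_eq[of t] that by simp
    have "0 \<le> t * (2 - t)" "0 \<le> (1 - t)\<^sup>2" using that by auto
    then show "triangular_cdf t \<in> {0..1}" by (simp add: eq power2_eq_square algebra_simps)
  qed
  have Fc: "continuous_on {0..1} triangular_cdf"
    by (rule continuous_on_eq[of _ "\<lambda>t. 2 * t - t\<^sup>2"]) (auto intro!: continuous_intros simp: F(1))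
  have "AE \<omega> in M. continuous_on {0..1} (\<lambda>t. U t \<omega>)"
    using U by (simp add: standard_brownian_bridge_def)
  then have "AE \<omega> in M. continuous_on {0..1} (\<lambda>t. U (triangular_cdf t) \<omega>)"
  proof eventually_elim
    case (elim \<omega>)
    then show ?case by (rule continuous_on_compose2[OF _ Fc]) (use F(2) in auto)
  qed
  moreover have "U (triangular_cdf t) \<in> borel_measurable M" if "0 \<le> t" "t \<le> 1" for t
    using U F(2)[OF that] by (auto simp: standard_brownian_bridge_def gaussian_process_def)
  ultimately show "let X = (\<lambda>t. U (triangular_cdf t)); Y = (\<lambda>t \<omega>. integral {0..t} (\<lambda>s. X s \<omega>))
      in ae_unique_random_invelope M X Y"
    unfolding Let_def by (intro ae_unique_random_invelopeI)
next
  assume W: "standard_brownian_motion N W"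
  then show "let Y = (\<lambda>t \<omega>. integral {0..t} (\<lambda>s. W s \<omega>)) in ae_unique_random_invelope N W Y"
    unfolding Let_def by (intro ae_unique_random_invelopeI) (auto simp: standard_brownian_motion_def)
qed

end
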